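(* Let $T=(T_1,\ldots,T_k)\in B(\mathcal H)^{n_1}\times\cdots\times B(\mathcal H)^{n_k}$ and let $m\in\{1,2,\ldots\}$ or $m=\infty$. Then $T$ is a pure $k$-tuple in the regular $\Lambda$-polyball with $\operatorname{rank}\Delta_T(I)=m$ if and only if $T=(T_1,\ldots,T_k)$ is unitarily equivalent to the compression of $(S_1\otimes I_{\mathbb C^m},\ldots,S_k\otimes I_{\mathbb C^m})$ to a jointly co-invariant subspace $\mathcal M\subset\ell^2(\mathbb F_{n_1}^+\times\cdots\times\mathbb F_{n_k}^+)\otimes\mathbb C^m$ under $S_{i,s}\otimes I_{\mathbb C^m}$, $i\in\{1,\ldots,k\}$, $s\in\{1,\ldots,n_i\}$, with the property that $\dim[(P_{\mathbb C}\otimes I_{\mathbb C^m})\mathcal M]=m$.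
   Context: Fix integers $k\ge1$, $n_1,\ldots,n_k\ge 1$ and, for $i\ne j$ in $\{1,\ldots,k\}$, an $n_i\times n_j$ matrix $\Lambda_{i,j}=[\lambda_{i,j}(s,t)]$ with entries in $\mathbb T=\{z\in\mathbb C:|z|=1\}$, such that $\lambda_{j,i}(t,s)=\overline{\lambda_{i,j}(s,t)}$. For $T=(T_1,\ldots,T_k)$ with $T_i=[T_{i,1}\cdots T_{i,n_i}]$, $T_{i,s}\in B(\mathcal H)$, let $\Phi_{rT_i}(X):=\sum_{s=1}^{n_i}r^2T_{i,s}XT_{i,s}^*$ and $\Delta_T(I):=(id-\Phi_{T_1})\circ\cdots\circ(id-\Phi_{T_k})(I)$. The regular $\Lambda$-polyball is the set of $T$ with $\sum_sT_{i,s}T_{i,s}^*\le I$ for each $i$, $T_{i,s}T_{j,t}=\lambda_{i,j}(s,t)T_{j,t}T_{i,s}$ for all $i\ne j$, $s,t$, and $\Delta_{rT}(I)\ge0$ for all $r\in[0,1)$. $T$ is pure if $\Phi_{T_i}^q(I)\to0$ strongly as $q\to\infty$ for each $i$. $\mathbb F_{n_i}^+$ is the unital free semigroup with generators $g_1^i,\ldots,g_{n_i}^i$ and neutral element $g_0^i$. The standard $k$-tuple $S=(S_1,\ldots,S_k)$, $S_i=[S_{i,1}\cdots S_{i,n_i}]$, acts on $\ell^2(\mathbb F_{n_1}^+\times\cdots\times\mathbb F_{n_k}^+)$ with standard basis $\chi_{(\alpha_1,\ldots,\alpha_k)}$ by $$S_{i,s}\chi_{(\alpha_1,\ldots,\alpha_k)}=\boldsymbol\lambda_{i,1}(s,\alpha_1)\cdots\boldsymbol\lambda_{i,i-1}(s,\alpha_{i-1})\chi_{(\alpha_1,\ldots,\alpha_{i-1},g_s^i\alpha_i,\alpha_{i+1},\ldots,\alpha_k)},$$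 where $\boldsymbol\lambda_{i,j}(s,g^j_{j_1}\cdots g^j_{j_q})=\prod_{b=1}^q\lambda_{i,j}(s,j_b)$, $\boldsymbol\lambda_{i,j}(s,g_0^j)=1$ (no factor if $i=1$). $P_{\mathbb C}$ is the orthogonal projection onto $\mathbb C\chi_{(g_0^1,\ldots,g_0^k)}$. Co-invariant means invariant under the adjoints; subspaces are closed. The compression of $(S_i\otimes I)$ to $\mathcal M$ consists of the operators $P_{\mathcal M}(S_{i,s}\otimes I)|_{\mathcal M}$; unitary equivalence means a single unitary intertwines all corresponding entries. For $m=\infty$ (countably infinite), $\mathbb C^m$ denotes $\ell^2(\mathbb N)$. Rank and dim are the Hilbert space dimensions of the closure of the range, respectively of the closure of the given linear space. *)

theory Defs
  imports "HOL-Analysis.Analysis" "HOL-Library.Extended_Nat" "HOL-Library.FuncSet"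
begin

section \<open>Complex Hilbert spaces\<close>

text \<open>
  A complex inner product space is a real inner product space (with real inner product
  \<open>Re (cinner x y)\<close>) carrying a compatible complex structure. In particular norm, metric and
  topology are the ones of the underlying real space, and
  \<open>(norm x)\<^sup>2 = inner x x = cinner x x\<close>. The form is linear in its first argument.
\<close>

class complex_inner = real_inner +
  fixes scaleC :: "complex \<Rightarrow> 'a \<Rightarrow> 'a" (infixr "*\<^sub>C" 75)
    and cinner :: "'a \<Rightarrow> 'a \<Rightarrow> complex"
  assumes scaleC_add_right: "a *\<^sub>C (x + y) = a *\<^sub>C x + a *\<^sub>C y"
    and scaleC_add_left: "(a + b) *\<^sub>C x = a *\<^sub>C x + b *\<^sub>C x"
    and scaleC_scaleC: "a *\<^sub>C b *\<^sub>C x = (a * b) *\<^sub>C x"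
    and scaleC_of_real: "complex_of_real r *\<^sub>C x = r *\<^sub>R x"
    and cinner_commute: "cinner x y = cnj (cinner y x)"
    and cinner_add_left: "cinner (x + y) z = cinner x z + cinner y z"
    and cinner_scaleC_left: "cinner (a *\<^sub>C x) y = a * cinner x y"
    and Re_cinner: "Re (cinner x y) = inner x y"

class chilbert_space = complex_inner + complete_space

global_interpretation complex_vector: vector_space "scaleC :: complex \<Rightarrow> 'a \<Rightarrow> 'a::complex_inner"
  by unfold_locales
    (auto simp: scaleC_add_right scaleC_add_left scaleC_scaleC scaleC_of_real[of 1, simplified])

abbreviation csubspace :: "'a::complex_inner set \<Rightarrow> bool"
  where "csubspace \<equiv> complex_vector.subspace"

abbreviation cspan :: "'a::complex_inner set \<Rightarrow> 'a set"
  where "cspan \<equiv> complex_vector.span"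

abbreviation clinear :: "('a::complex_inner \<Rightarrow> 'b::complex_inner) \<Rightarrow> bool"
  where "clinear \<equiv> Vector_Spaces.linear scaleC scaleC"

definition bounded_clinear :: "('a::complex_inner \<Rightarrow> 'b::complex_inner) \<Rightarrow> bool"
  where "bounded_clinear A \<longleftrightarrow> clinear A \<and> (\<exists>K. \<forall>x. norm (A x) \<le> K * norm x)"

definition cadjoint :: "('a::chilbert_space \<Rightarrow> 'b::chilbert_space) \<Rightarrow> 'b \<Rightarrow> 'a"
  where "cadjoint A = (THE B. \<forall>x y. cinner (A x) y = cinner x (B y))"

definition positive_op :: "('a::complex_inner \<Rightarrow> 'a) \<Rightarrow> bool"
  where "positive_op A \<longleftrightarrow> (\<forall>x. Im (cinner (A x) x) = 0 \<and> 0 \<le> Re (cinner (A x) x))"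

definition op_le :: "('a::complex_inner \<Rightarrow> 'a) \<Rightarrow> ('a \<Rightarrow> 'a) \<Rightarrow> bool"
  where "op_le A B \<longleftrightarrow> positive_op (\<lambda>x. B x - A x)"

definition orth_proj :: "'a::chilbert_space set \<Rightarrow> 'a \<Rightarrow> 'a"
  where "orth_proj M x = (THE y. y \<in> M \<and> (\<forall>z\<in>M. cinner (x - y) z = 0))"

definition orthonormal :: "'a::complex_inner set \<Rightarrow> bool"
  where "orthonormal B \<longleftrightarrow> (\<forall>x\<in>B. \<forall>y\<in>B. cinner x y = (if x = y then 1 else 0))"

text \<open>
  \<open>{j. enat j < m}\<close> has exactly \<open>m\<close> elements, and is all of \<open>\<nat>\<close> for \<open>m = \<infinity>\<close>; thus
  \<open>m = \<infinity>\<close> stands for countably infinite dimension. The dimension and the rank are stated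
  as relations because \<open>enat\<close> has no value for uncountable dimensions.
\<close>

definition has_hilbert_dim :: "'a::chilbert_space set \<Rightarrow> enat \<Rightarrow> bool"
  where "has_hilbert_dim V m \<longleftrightarrow>
    (\<exists>B. orthonormal B \<and> closure (cspan B) = closure V \<and> (\<exists>e. bij_betw e {j. enat j < m} B))"

definition has_rank :: "('a::chilbert_space \<Rightarrow> 'b::chilbert_space) \<Rightarrow> enat \<Rightarrow> bool"
  where "has_rank A m \<longleftrightarrow> has_hilbert_dim (range A) m"


section \<open>The space \<open>\<ell>\<^sup>2\<close>\<close>

typedef 'a ell2 = "{f :: 'a \<Rightarrow> complex. (\<lambda>x. (cmod (f x))\<^sup>2) summable_on UNIV}"
  morphisms coord Abs_ell2
  by (rule exI[of _ "\<lambda>_. 0"]) simp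

setup_lifting type_definition_ell2

lemma coord_sq_summable: "(\<lambda>x. (cmod (coord f x))\<^sup>2) summable_on UNIV"
  using coord[of f] by simp

lemma ell2_eqI: "(\<And>x. coord f x = coord g x) \<Longrightarrow> f = g"
  by (metis coord_inject ext)

lemma sq_summable_mult:
  fixes f g :: "'a \<Rightarrow> complex"
  assumes "(\<lambda>x. (cmod (f x))\<^sup>2) summable_on UNIV" "(\<lambda>x. (cmod (g x))\<^sup>2) summable_on UNIV"
  shows "(\<lambda>x. f x * cnj (g x)) summable_on UNIV"
proof -
  have "(\<lambda>x. norm (f x * f x)) summable_on UNIV" "(\<lambda>x. norm (cnj (g x) * cnj (g x))) summable_on UNIV"
    using assms by (simp_all add: norm_mult power2_eq_square)
  then have "(\<lambda>x. norm (f x * cnj (g x))) summable_on UNIV"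
    by (rule abs_summable_product)
  then show ?thesis
    by (rule abs_summable_summable)
qed

lemma sq_summable_add:
  fixes f g :: "'a \<Rightarrow> complex"
  assumes "(\<lambda>x. (cmod (f x))\<^sup>2) summable_on UNIV" "(\<lambda>x. (cmod (g x))\<^sup>2) summable_on UNIV"
  shows "(\<lambda>x. (cmod (f x + g x))\<^sup>2) summable_on UNIV"
proof -
  have "(\<lambda>x. 2 * (cmod (f x))\<^sup>2 + 2 * (cmod (g x))\<^sup>2) summable_on UNIV"
    using assms by (intro summable_on_add summable_on_cmult_right)
  moreover have "(cmod (f x + g x))\<^sup>2 \<le> 2 * (cmod (f x))\<^sup>2 + 2 * (cmod (g x))\<^sup>2" for x
  proof -
    have "(cmod (f x + g x))\<^sup>2 \<le> (cmod (f x) + cmod (g x))\<^sup>2"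
      by (intro power_mono norm_triangle_ineq) simp
    also have "\<dots> \<le> 2 * (cmod (f x))\<^sup>2 + 2 * (cmod (g x))\<^sup>2"
      using sum_squares_bound[of "cmod (f x)" "cmod (g x)"] by (simp add: power2_sum)
    finally show ?thesis .
  qed
  ultimately show ?thesis
    by (rule summable_on_comparison_test) auto
qed

lemma sq_summable_cmult:
  fixes f :: "'a \<Rightarrow> complex"
  assumes "(\<lambda>x. (cmod (f x))\<^sup>2) summable_on UNIV"
  shows "(\<lambda>x. (cmod (a * f x))\<^sup>2) summable_on UNIV"
  using summable_on_cmult_right[OF assms, of "(cmod a)\<^sup>2"] by (simp add: norm_mult power_mult_distrib)

instantiation ell2 :: (type) complex_inner
begin

lift_definition zero_ell2 :: "'a ell2" is "\<lambda>_. 0" by simp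

lift_definition plus_ell2 :: "'a ell2 \<Rightarrow> 'a ell2 \<Rightarrow> 'a ell2" is "\<lambda>f g x. f x + g x"
  by (rule sq_summable_add)

lift_definition uminus_ell2 :: "'a ell2 \<Rightarrow> 'a ell2" is "\<lambda>f x. - f x" by simp

lift_definition minus_ell2 :: "'a ell2 \<Rightarrow> 'a ell2 \<Rightarrow> 'a ell2" is "\<lambda>f g x. f x - g x"
  using sq_summable_add[of _ "\<lambda>x. - _ x"] by simp

lift_definition scaleC_ell2 :: "complex \<Rightarrow> 'a ell2 \<Rightarrow> 'a ell2" is "\<lambda>a f x. a * f x"
  by (rule sq_summable_cmult)

lift_definition scaleR_ell2 :: "real \<Rightarrow> 'a ell2 \<Rightarrow> 'a ell2" is "\<lambda>r f x. complex_of_real r * f x"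
  by (rule sq_summable_cmult)

definition cinner_ell2 :: "'a ell2 \<Rightarrow> 'a ell2 \<Rightarrow> complex"
  where "cinner_ell2 f g = (\<Sum>\<^sub>\<infinity>x. coord f x * cnj (coord g x))"

definition inner_ell2 :: "'a ell2 \<Rightarrow> 'a ell2 \<Rightarrow> real"
  where "inner_ell2 f g = Re (cinner f g)"

definition norm_ell2 :: "'a ell2 \<Rightarrow> real"
  where "norm_ell2 f = sqrt (inner f f)"

definition sgn_ell2 :: "'a ell2 \<Rightarrow> 'a ell2"
  where "sgn_ell2 f = inverse (norm f) *\<^sub>R f"

definition dist_ell2 :: "'a ell2 \<Rightarrow> 'a ell2 \<Rightarrow> real"
  where "dist_ell2 f g = norm (f - g)"

definition uniformity_ell2 :: "('a ell2 \<times> 'a ell2) filter"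
  where "uniformity_ell2 = (INF e\<in>{0 <..}. principal {(f, g). dist f g < e})"

definition open_ell2 :: "'a ell2 set \<Rightarrow> bool"
  where "open_ell2 U \<longleftrightarrow> (\<forall>f\<in>U. \<forall>\<^sub>F (f', g) in uniformity. f' = f \<longrightarrow> g \<in> U)"

lemma cinner_ell2_self:
  fixes f :: "'a ell2"
  shows "cinner f f = complex_of_real (\<Sum>\<^sub>\<infinity>x. (cmod (coord f x))\<^sup>2)"
proof -
  have "((\<lambda>x. complex_of_real ((cmod (coord f x))\<^sup>2)) has_sum
      complex_of_real (\<Sum>\<^sub>\<infinity>x. (cmod (coord f x))\<^sup>2)) UNIV"
    by (intro has_sum_of_real has_sum_infsum coord_sq_summable)
  then show ?thesis
    unfolding cinner_ell2_def complex_norm_square by (rule infsumI)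
qed

instance
proof
  fix f g h :: "'a ell2" and a b :: complex and r s :: real
  note reps = zero_ell2.rep_eq plus_ell2.rep_eq uminus_ell2.rep_eq minus_ell2.rep_eq
    scaleC_ell2.rep_eq scaleR_ell2.rep_eq
  show "f + g + h = f + (g + h)" by (rule ell2_eqI) (simp add: reps)
  show "f + g = g + f" by (rule ell2_eqI) (simp add: reps)
  show "0 + f = f" by (rule ell2_eqI) (simp add: reps)
  show "- f + f = 0" by (rule ell2_eqI) (simp add: reps)
  show "f - g = f + - g" by (rule ell2_eqI) (simp add: reps)
  show "r *\<^sub>R (f + g) = r *\<^sub>R f + r *\<^sub>R g" by (rule ell2_eqI) (simp add: reps distrib_left)
  show "(r + s) *\<^sub>R f = r *\<^sub>R f + s *\<^sub>R f" by (rule ell2_eqI) (simp add: reps distrib_right)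
  show "r *\<^sub>R s *\<^sub>R f = (r * s) *\<^sub>R f" by (rule ell2_eqI) (simp add: reps)
  show "1 *\<^sub>R f = f" by (rule ell2_eqI) (simp add: reps)
  show "a *\<^sub>C (f + g) = a *\<^sub>C f + a *\<^sub>C g" by (rule ell2_eqI) (simp add: reps distrib_left)
  show "(a + b) *\<^sub>C f = a *\<^sub>C f + b *\<^sub>C f" by (rule ell2_eqI) (simp add: reps distrib_right)
  show "a *\<^sub>C b *\<^sub>C f = (a * b) *\<^sub>C f" by (rule ell2_eqI) (simp add: reps)
  show "complex_of_real r *\<^sub>C f = r *\<^sub>R f" by (rule ell2_eqI) (simp add: reps)
  show "sgn f = inverse (norm f) *\<^sub>R f"
    by (rule sgn_ell2_def)
  show "dist f g = norm (f - g)"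
    by (rule dist_ell2_def)
  show "(uniformity :: ('a ell2 \<times> 'a ell2) filter) = (INF e\<in>{0 <..}. principal {(f, g). dist f g < e})"
    by (rule uniformity_ell2_def)
  show "open U \<longleftrightarrow> (\<forall>f\<in>U. \<forall>\<^sub>F (f', g) in uniformity. f' = f \<longrightarrow> g \<in> U)" for U :: "'a ell2 set"
    by (rule open_ell2_def)
  show comm: "cinner f g = cnj (cinner g f)" for f g :: "'a ell2"
    unfolding cinner_ell2_def by (subst infsum_cnj[symmetric]) (simp add: mult.commute)
  show add: "cinner (f + g) h = cinner f h + cinner g h" for f g h :: "'a ell2"
    unfolding cinner_ell2_def plus_ell2.rep_eq
    by (simp add: distrib_right infsum_add sq_summable_mult coord_sq_summable)
  show scale: "cinner (a *\<^sub>C f) g = a * cinner f g" for a and f g :: "'a ell2"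
    unfolding cinner_ell2_def scaleC_ell2.rep_eq
    by (simp add: mult.assoc infsum_cmult_right' )
  show "Re (cinner f g) = inner f g"
    by (simp add: inner_ell2_def)
  show "inner f g = inner g f"
    unfolding inner_ell2_def by (subst comm) simp
  show "inner (f + g) h = inner f h + inner g h"
    by (simp add: inner_ell2_def add)
  have "r *\<^sub>R f = complex_of_real r *\<^sub>C f"
    by transfer simp
  then show "inner (r *\<^sub>R f) g = r * inner f g"
    by (simp add: inner_ell2_def scale)
  show "0 \<le> inner f f"
    by (simp add: inner_ell2_def cinner_ell2_self infsum_nonneg)
  show "inner f f = 0 \<longleftrightarrow> f = 0"
  proof
    assume "inner f f = 0"
    then have "(cmod (coord f x))\<^sup>2 = 0" for x
      by (intro nonneg_infsum_le_0D[OF _ coord_sq_summable])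
        (simp_all add: inner_ell2_def cinner_ell2_self)
    then show "f = 0"
      by (intro ell2_eqI) (simp add: zero_ell2.rep_eq)
  qed (simp add: inner_ell2_def cinner_ell2_def zero_ell2.rep_eq)
  show "norm f = sqrt (inner f f)"
    by (rule norm_ell2_def)
qed

end

lemma norm_ell2_sq: "(norm f)\<^sup>2 = (\<Sum>\<^sub>\<infinity>x. (cmod (coord f x))\<^sup>2)" for f :: "'a ell2"
  by (simp add: power2_norm_eq_inner inner_ell2_def cinner_ell2_self)

lemma finite_sum_le_norm_ell2:
  "finite F \<Longrightarrow> (\<Sum>x\<in>F. (cmod (coord f x))\<^sup>2) \<le> (norm f)\<^sup>2"
  unfolding norm_ell2_sq by (rule finite_sum_le_infsum[OF coord_sq_summable]) auto

lemma norm_coord_le: "cmod (coord f x) \<le> norm f"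
  by (rule power2_le_imp_le) (use finite_sum_le_norm_ell2[of "{x}" f] in auto)

instance ell2 :: (type) chilbert_space
proof
  fix X :: "nat \<Rightarrow> 'a ell2"
  assume X: "Cauchy X"
  have "Cauchy (\<lambda>n. coord (X n) x)" for x
  proof (rule metric_CauchyI)
    fix e :: real assume "0 < e"
    then obtain N where N: "\<forall>m\<ge>N. \<forall>n\<ge>N. dist (X m) (X n) < e"
      using X unfolding Cauchy_def by meson
    have "dist (coord (X m) x) (coord (X n) x) \<le> dist (X m) (X n)" for m n
      using norm_coord_le[of "X m - X n" x] by (simp add: dist_norm minus_ell2.rep_eq)
    then show "\<exists>N. \<forall>m\<ge>N. \<forall>n\<ge>N. dist (coord (X m) x) (coord (X n) x) < e"
      using N by (blast intro: le_less_trans)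
  qed
  then have "\<exists>l. (\<lambda>n. coord (X n) x) \<longlonglongrightarrow> l" for x
    using Cauchy_convergent convergent_def by blast
  then obtain l where l: "\<And>x. (\<lambda>n. coord (X n) x) \<longlonglongrightarrow> l x"
    by metis
  have bound: "(\<Sum>x\<in>F. (cmod (coord (X m) x - l x))\<^sup>2) \<le> e\<^sup>2"
    if "finite F" "\<And>n. n \<ge> N \<Longrightarrow> norm (X m - X n) \<le> e" for F m N e
  proof (rule tendsto_upperbound)
    show "(\<lambda>n. \<Sum>x\<in>F. (cmod (coord (X m) x - coord (X n) x))\<^sup>2)
        \<longlonglongrightarrow> (\<Sum>x\<in>F. (cmod (coord (X m) x - l x))\<^sup>2)"
      by (intro tendsto_intros l)
    have "(\<Sum>x\<in>F. (cmod (coord (X m) x - coord (X n) x))\<^sup>2) \<le> e\<^sup>2" if "n \<ge> N" for n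
    proof -
      have "(\<Sum>x\<in>F. (cmod (coord (X m) x - coord (X n) x))\<^sup>2) \<le> (norm (X m - X n))\<^sup>2"
        using finite_sum_le_norm_ell2[OF \<open>finite F\<close>, of "X m - X n"] by (simp add: minus_ell2.rep_eq)
      also have "\<dots> \<le> e\<^sup>2"
        using \<open>\<And>n. n \<ge> N \<Longrightarrow> norm (X m - X n) \<le> e\<close>[OF \<open>n \<ge> N\<close>]
        by (rule power_mono) (rule norm_ge_zero)
      finally show ?thesis .
    qed
    then show "\<forall>\<^sub>F n in sequentially. (\<Sum>x\<in>F. (cmod (coord (X m) x - coord (X n) x))\<^sup>2) \<le> e\<^sup>2"
      using eventually_sequentially by blast
  qed simp
  have summ: "(\<lambda>x. (cmod (coord (X m) x - l x))\<^sup>2) summable_on UNIV"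
    and sum_le: "(\<Sum>\<^sub>\<infinity>x. (cmod (coord (X m) x - l x))\<^sup>2) \<le> e\<^sup>2"
    if "\<And>n. n \<ge> N \<Longrightarrow> norm (X m - X n) \<le> e" for m N e
  proof -
    show *: "(\<lambda>x. (cmod (coord (X m) x - l x))\<^sup>2) summable_on UNIV"
    proof (rule nonneg_bdd_above_summable_on)
      show "bdd_above (sum (\<lambda>x. (cmod (coord (X m) x - l x))\<^sup>2) ` {F. F \<subseteq> UNIV \<and> finite F})"
        by (rule bdd_aboveI2[where M = "e\<^sup>2"], rule bound[OF _ that]) simp_all
    qed simp
    show "(\<Sum>\<^sub>\<infinity>x. (cmod (coord (X m) x - l x))\<^sup>2) \<le> e\<^sup>2"
      by (rule infsum_le_finite_sums[OF *], rule bound[OF _ that]) simp_all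
  qed
  have cauchy: "\<exists>N. \<forall>m\<ge>N. \<forall>n\<ge>N. norm (X m - X n) \<le> e" if "0 < e" for e
    using X[unfolded Cauchy_def dist_norm, rule_format, OF that] by (blast intro: less_imp_le)
  obtain N where "\<forall>m\<ge>N. \<forall>n\<ge>N. norm (X m - X n) \<le> 1"
    using cauchy[of 1] by auto
  then have "(\<lambda>x. (cmod (coord (X N) x - l x))\<^sup>2) summable_on UNIV"
    by (intro summ[where e = 1 and N = N]) blast
  then have "(\<lambda>x. (cmod (- (coord (X N) x - l x)))\<^sup>2) summable_on UNIV"
    by (simp only: norm_minus_cancel)
  from sq_summable_add[OF coord_sq_summable[of "X N"] this]
  have lsum: "(\<lambda>x. (cmod (l x))\<^sup>2) summable_on UNIV"
    by simp
  define L where "L = Abs_ell2 l"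
  have L: "coord L = l"
    using lsum by (simp add: L_def Abs_ell2_inverse)
  have "X \<longlonglongrightarrow> L"
  proof (rule metric_LIMSEQ_I)
    fix r :: real assume "0 < r"
    then obtain N where N: "\<forall>m\<ge>N. \<forall>n\<ge>N. norm (X m - X n) \<le> r / 2"
      using cauchy[of "r / 2"] by auto
    have "dist (X m) L < r" if "m \<ge> N" for m
    proof -
      have "(norm (X m - L))\<^sup>2 \<le> (r / 2)\<^sup>2"
        unfolding norm_ell2_sq minus_ell2.rep_eq L
        by (rule sum_le[where N = N]) (use N that in blast)
      then have "norm (X m - L) \<le> r / 2"
        by (rule power2_le_imp_le) (use \<open>0 < r\<close> in simp)
      with \<open>0 < r\<close> show ?thesis
        by (simp add: dist_norm)
    qed
    then show "\<exists>N. \<forall>m\<ge>N. dist (X m) L < r"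
      by blast
  qed
  then show "convergent X"
    by (auto simp: convergent_def)
qed

lift_definition ket :: "'a \<Rightarrow> 'a ell2" is "\<lambda>a x. if x = a then 1 else 0"
proof -
  fix a :: 'a
  have "(\<lambda>x. (cmod (if x = a then 1 else 0))\<^sup>2) summable_on {a}"
    by simp
  then show "(\<lambda>x. (cmod (if x = a then 1 else 0))\<^sup>2) summable_on UNIV"
    by (rule summable_on_cong_neutral[THEN iffD1, rotated -1]) auto
qed

lemma cinner_ket: "cinner f (ket a) = coord f a"
proof -
  have "cinner f (ket a) = (\<Sum>\<^sub>\<infinity>x\<in>{a}. coord f x * cnj (coord (ket a) x))"
    unfolding cinner_ell2_def by (rule infsum_cong_neutral) (auto simp: ket.rep_eq)
  then show ?thesis
    by (simp add: ket.rep_eq)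
qed

lemma inner_sum_ket:
  assumes "finite F"
  shows "inner g (\<Sum>a\<in>F. c a *\<^sub>C ket a) = (\<Sum>a\<in>F. Re (cnj (c a) * coord g a))"
proof -
  have "inner g (c a *\<^sub>C ket a) = Re (cnj (c a) * coord g a)" for a
    by (metis Re_cinner cinner_commute cinner_ket cinner_scaleC_left complex_cnj_mult complex_cnj_cnj)
  then show ?thesis
    by (simp add: inner_sum_right)
qed

lemma coord_sum: "coord (\<Sum>a\<in>F. h a) x = (\<Sum>a\<in>F. coord (h a) x)"
  by (induction F rule: infinite_finite_induct) (auto simp: zero_ell2.rep_eq plus_ell2.rep_eq)

lemma has_sum_ket: "((\<lambda>a. coord f a *\<^sub>C ket a) has_sum f) UNIV"
proof -
  let ?p = "\<lambda>F. \<Sum>a\<in>F. coord f a *\<^sub>C ket a"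
  have dist: "(dist (?p F) f)\<^sup>2 = (norm f)\<^sup>2 - (\<Sum>a\<in>F. (cmod (coord f a))\<^sup>2)" if "finite F" for F
  proof -
    have *: "Re (cnj z * z) = (cmod z)\<^sup>2" for z
      by (metis Re_complex_of_real complex_norm_square mult.commute)
    have "coord (?p F) a = coord f a" if "a \<in> F" for a
      using \<open>finite F\<close> that
      by (simp add: coord_sum scaleC_ell2.rep_eq ket.rep_eq if_distrib[where f = "\<lambda>z. _ * z"] cong: if_cong)
    then have "inner (?p F) (?p F) = (\<Sum>a\<in>F. (cmod (coord f a))\<^sup>2)"
      unfolding inner_sum_ket[OF that] by (intro sum.cong refl) (simp only: *)
    moreover have "inner f (?p F) = (\<Sum>a\<in>F. (cmod (coord f a))\<^sup>2)"
      unfolding inner_sum_ket[OF that] by (intro sum.cong refl) (simp only: *)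
    ultimately show ?thesis
      by (simp add: dist_norm power2_norm_eq_inner inner_diff_left inner_diff_right inner_commute)
  qed
  have "((\<lambda>a. (cmod (coord f a))\<^sup>2) has_sum (norm f)\<^sup>2) UNIV"
    unfolding norm_ell2_sq by (rule has_sum_infsum[OF coord_sq_summable])
  then have lim: "((\<lambda>F. (norm f)\<^sup>2 - (\<Sum>a\<in>F. (cmod (coord f a))\<^sup>2)) \<longlongrightarrow> (norm f)\<^sup>2 - (norm f)\<^sup>2)
      (finite_subsets_at_top UNIV)"
    unfolding has_sum_def by (intro tendsto_diff tendsto_const)
  have ev: "\<forall>\<^sub>F F in finite_subsets_at_top UNIV.
      (norm f)\<^sup>2 - (\<Sum>a\<in>F. (cmod (coord f a))\<^sup>2) = (dist (?p F) f)\<^sup>2"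
    by (rule eventually_finite_subsets_at_top_weakI) (simp add: dist)
  have "((\<lambda>F. (dist (?p F) f)\<^sup>2) \<longlongrightarrow> 0) (finite_subsets_at_top UNIV)"
    using tendsto_cong[OF ev, THEN iffD1, OF lim] by (simp only: diff_self)
  then have "((\<lambda>F. sqrt ((dist (?p F) f)\<^sup>2)) \<longlongrightarrow> sqrt 0) (finite_subsets_at_top UNIV)"
    by (rule tendsto_real_sqrt)
  then show ?thesis
    unfolding has_sum_def by (subst tendsto_dist_iff) simp
qed

text \<open>\<open>\<ell>\<^sup>2(A)\<close> for a set \<open>A\<close> of indices, as a closed subspace of \<open>\<ell>\<^sup>2\<close> of the whole index type.\<close>

definition ell2_on :: "'a set \<Rightarrow> 'a ell2 set"
  where "ell2_on A = {f. \<forall>x. x \<notin> A \<longrightarrow> coord f x = 0}"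


subsection \<open>Tensor products with \<open>\<ell>\<^sup>2\<close>\<close>

text \<open>
  \<open>\<ell>\<^sup>2(A) \<otimes> \<ell>\<^sup>2(B)\<close> is realised as \<open>\<ell>\<^sup>2(A \<times> B)\<close>, with elementary tensors as follows.
  The lemmas \<open>cinner_tensor\<close> and \<open>closure_cspan_tensor\<close> below say that this is the Hilbert
  space tensor product.
\<close>

lift_definition tensor_ell2 :: "'a ell2 \<Rightarrow> 'b ell2 \<Rightarrow> ('a \<times> 'b) ell2" (infixr "\<otimes>\<^sub>2" 70)
  is "\<lambda>f g (a, b). f a * g b"
proof -
  fix f :: "'a \<Rightarrow> complex" and g :: "'b \<Rightarrow> complex"
  assume f: "(\<lambda>x. (cmod (f x))\<^sup>2) summable_on UNIV" and g: "(\<lambda>x. (cmod (g x))\<^sup>2) summable_on UNIV"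
  have "(\<lambda>(a, b). (cmod (f a))\<^sup>2 * (cmod (g b))\<^sup>2) summable_on Sigma UNIV (\<lambda>_. UNIV)"
    by (rule summable_on_SigmaI[where g = "\<lambda>a. (cmod (f a))\<^sup>2 * (\<Sum>\<^sub>\<infinity>b. (cmod (g b))\<^sup>2)"])
      (auto intro!: has_sum_cmult_right has_sum_infsum g summable_on_cmult_left f)
  then show "(\<lambda>x. (cmod (case x of (a, b) \<Rightarrow> f a * g b))\<^sup>2) summable_on UNIV"
    by (simp add: case_prod_unfold norm_mult power_mult_distrib)
qed

lemma cinner_tensor: "cinner (f \<otimes>\<^sub>2 g) (f' \<otimes>\<^sub>2 g') = cinner f f' * cinner g g'"
proof -
  let ?F = "\<lambda>a. coord f a * cnj (coord f' a)" and ?G = "\<lambda>b. coord g b * cnj (coord g' b)"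
  have eq: "(\<lambda>(a, b). ?F a * ?G b) = (\<lambda>x. coord (f \<otimes>\<^sub>2 g) x * cnj (coord (f' \<otimes>\<^sub>2 g') x))"
    by (auto simp: tensor_ell2.rep_eq fun_eq_iff)
  have "(\<lambda>(a, b). ?F a * ?G b) summable_on Sigma UNIV (\<lambda>_. UNIV)"
    unfolding eq using sq_summable_mult[OF coord_sq_summable coord_sq_summable] by simp
  then have "(\<Sum>\<^sub>\<infinity>a. \<Sum>\<^sub>\<infinity>b. ?F a * ?G b) = (\<Sum>\<^sub>\<infinity>x\<in>Sigma UNIV (\<lambda>_. UNIV). case x of (a, b) \<Rightarrow> ?F a * ?G b)"
    by (rule infsum_Sigma'_banach)
  then have "cinner (f \<otimes>\<^sub>2 g) (f' \<otimes>\<^sub>2 g') = (\<Sum>\<^sub>\<infinity>a. \<Sum>\<^sub>\<infinity>b. ?F a * ?G b)"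
    unfolding cinner_ell2_def eq[symmetric] by simp
  also have "\<dots> = cinner f f' * cinner g g'"
    unfolding cinner_ell2_def by (simp add: infsum_cmult_right' infsum_cmult_left')
  finally show ?thesis .
qed

lemma ket_tensor_ket: "ket a \<otimes>\<^sub>2 ket b = ket (a, b)"
  by (rule ell2_eqI) (auto simp: tensor_ell2.rep_eq ket.rep_eq split: if_splits)

lemma closure_cspan_tensor: "closure (cspan {f \<otimes>\<^sub>2 g | f g. True}) = UNIV"
proof -
  have "h \<in> closure (cspan {f \<otimes>\<^sub>2 g | f g. True})" for h :: "('a \<times> 'b) ell2"
  proof -
    have "(\<Sum>x\<in>F. coord h x *\<^sub>C ket x) \<in> cspan {f \<otimes>\<^sub>2 g | f g. True}" for F
    proof (intro complex_vector.span_sum complex_vector.span_scale complex_vector.span_base)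
      fix x :: "'a \<times> 'b"
      have "ket x = ket (fst x) \<otimes>\<^sub>2 ket (snd x)"
        by (simp add: ket_tensor_ket)
      then show "ket x \<in> {f \<otimes>\<^sub>2 g | f g. True}"
        by blast
    qed
    then have "\<forall>\<^sub>F F in finite_subsets_at_top UNIV.
        (\<Sum>x\<in>F. coord h x *\<^sub>C ket x) \<in> closure (cspan {f \<otimes>\<^sub>2 g | f g. True})"
      using closure_subset by (auto intro!: always_eventually)
    then show ?thesis
      using has_sum_ket[of h] unfolding has_sum_def
      by (intro Lim_in_closed_set[OF closed_closure]) auto
  qed
  then show ?thesis
    by blast
qed

definition slice :: "('a \<times> 'b) ell2 \<Rightarrow> 'b \<Rightarrow> 'a ell2"
  where "slice f b = Abs_ell2 (\<lambda>a. coord f (a, b))"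

text \<open>
  The operator \<open>A \<otimes> I\<close> on \<open>\<ell>\<^sup>2(A \<times> B)\<close>: it acts as \<open>A\<close> on each slice \<open>f (\<cdot>, b)\<close>. By
  \<open>bounded_clinear_amplify\<close>, \<open>amplify_tensor\<close> and \<open>closure_cspan_tensor\<close> it is the bounded
  operator determined by \<open>f \<otimes> g \<mapsto> A f \<otimes> g\<close>.
\<close>

definition amplify :: "('a ell2 \<Rightarrow> 'a ell2) \<Rightarrow> ('a \<times> 'b) ell2 \<Rightarrow> ('a \<times> 'b) ell2"
  where "amplify A f = Abs_ell2 (\<lambda>(a, b). coord (A (slice f b)) a)"

lemma coord_slice: "coord (slice f b) a = coord f (a, b)"
proof -
  have "(\<lambda>x. (cmod (coord f x))\<^sup>2) summable_on range (\<lambda>a. (a, b))"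
    by (rule summable_on_subset[OF coord_sq_summable]) simp
  then have "(\<lambda>a. (cmod (coord f (a, b)))\<^sup>2) summable_on UNIV"
    by (subst (asm) summable_on_reindex) (auto simp: inj_on_def o_def)
  then show ?thesis
    by (simp add: slice_def Abs_ell2_inverse)
qed

lemma sum_slice_le:
  fixes f :: "('a \<times> 'b) ell2"
  assumes "finite B"
  shows "(\<Sum>b\<in>B. (norm (slice f b))\<^sup>2) \<le> (norm f)\<^sup>2"
proof -
  let ?q = "\<lambda>b a. (cmod (coord f (a, b)))\<^sup>2"
  have "(\<lambda>x. (cmod (coord f x))\<^sup>2) summable_on (\<lambda>(b, a). (a, b)) ` (B \<times> UNIV)"
    by (rule summable_on_subset[OF coord_sq_summable]) simp
  then have summ: "(\<lambda>(b, a). ?q b a) summable_on B \<times> UNIV"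
    by (subst (asm) summable_on_reindex) (auto simp: inj_on_def o_def case_prod_unfold)
  have "(\<Sum>b\<in>B. (norm (slice f b))\<^sup>2) = (\<Sum>\<^sub>\<infinity>b\<in>B. \<Sum>\<^sub>\<infinity>a. ?q b a)"
    using assms by (simp add: norm_ell2_sq coord_slice)
  also have "\<dots> = (\<Sum>\<^sub>\<infinity>(b, a)\<in>B \<times> UNIV. ?q b a)"
    by (rule infsum_Sigma'_banach[OF summ])
  also have "\<dots> = (\<Sum>\<^sub>\<infinity>x\<in>(\<lambda>(b, a). (a, b)) ` (B \<times> UNIV). (cmod (coord f x))\<^sup>2)"
    by (subst infsum_reindex) (auto simp: inj_on_def o_def case_prod_unfold)
  also have "\<dots> \<le> (norm f)\<^sup>2"
    unfolding norm_ell2_sq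
    by (rule infsum_mono2) (auto intro: summable_on_subset[OF coord_sq_summable] coord_sq_summable)
  finally show ?thesis .
qed

lemma amplify_bound:
  fixes f :: "('a \<times> 'b) ell2"
  assumes "\<And>g. norm (A g) \<le> K * norm g" "finite F"
  shows "(\<Sum>(a, b)\<in>F. (cmod (coord (A (slice f b)) a))\<^sup>2) \<le> (K * norm f)\<^sup>2"
proof -
  have "(\<Sum>(a, b)\<in>F. (cmod (coord (A (slice f b)) a))\<^sup>2)
      \<le> (\<Sum>(a, b)\<in>fst ` F \<times> snd ` F. (cmod (coord (A (slice f b)) a))\<^sup>2)"
    using assms by (intro sum_mono2) (auto simp: rev_image_eqI)
  also have "\<dots> = (\<Sum>b\<in>snd ` F. \<Sum>a\<in>fst ` F. (cmod (coord (A (slice f b)) a))\<^sup>2)"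
    by (subst sum.swap) (simp add: sum.cartesian_product)
  also have "\<dots> \<le> (\<Sum>b\<in>snd ` F. (norm (A (slice f b)))\<^sup>2)"
    using assms by (intro sum_mono finite_sum_le_norm_ell2) auto
  also have "\<dots> \<le> (\<Sum>b\<in>snd ` F. (K * norm (slice f b))\<^sup>2)"
    by (intro sum_mono power_mono assms) simp
  also have "\<dots> = K\<^sup>2 * (\<Sum>b\<in>snd ` F. (norm (slice f b))\<^sup>2)"
    by (simp add: power_mult_distrib sum_distrib_left)
  also have "\<dots> \<le> K\<^sup>2 * (norm f)\<^sup>2"
    using assms by (intro mult_left_mono sum_slice_le) auto
  finally show ?thesis
    by (simp add: power_mult_distrib)
qed

lemma amplify_summable:
  assumes "\<And>g. norm (A g) \<le> K * norm g"
  shows "(\<lambda>(a, b). (cmod (coord (A (slice f b)) a))\<^sup>2) summable_on UNIV"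
  by (rule nonneg_bdd_above_summable_on)
    (auto intro!: bdd_aboveI2[where M = "(K * norm f)\<^sup>2"] amplify_bound[OF assms])

lemma coord_amplify:
  assumes "bounded_clinear A"
  shows "coord (amplify A f) (a, b) = coord (A (slice f b)) a"
proof -
  obtain K where "\<And>g. norm (A g) \<le> K * norm g"
    using assms by (auto simp: bounded_clinear_def)
  from amplify_summable[of A, OF this, of f] show ?thesis
    by (simp add: amplify_def Abs_ell2_inverse case_prod_unfold)
qed

lemma bounded_clinear_amplify:
  fixes A :: "'a ell2 \<Rightarrow> 'a ell2"
  assumes "bounded_clinear A"
  shows "bounded_clinear (amplify A :: ('a \<times> 'b) ell2 \<Rightarrow> ('a \<times> 'b) ell2)"
proof -
  obtain K where K: "\<And>g. norm (A g) \<le> K * norm g"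
    using assms by (auto simp: bounded_clinear_def)
  have "K * norm (ket undefined :: 'a ell2) \<ge> 0"
    by (rule order_trans[OF norm_ge_zero K])
  moreover have "norm (ket undefined :: 'a ell2) \<ge> 1"
    using norm_coord_le[of "ket undefined" undefined] by (simp add: ket.rep_eq)
  ultimately have "K \<ge> 0"
    by (auto simp: zero_le_mult_iff)
  interpret A: Vector_Spaces.linear scaleC scaleC A
    using assms by (simp add: bounded_clinear_def)
  have "slice (f + g) b = slice f b + slice g b" "slice (c *\<^sub>C f) b = c *\<^sub>C slice f b"
    for f g :: "('a \<times> 'b) ell2" and c b
    by (auto intro!: ell2_eqI simp: coord_slice plus_ell2.rep_eq scaleC_ell2.rep_eq)
  then have "clinear (amplify A :: ('a \<times> 'b) ell2 \<Rightarrow> ('a \<times> 'b) ell2)"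
    by unfold_locales
      (auto intro!: ell2_eqI simp: coord_amplify[OF assms] plus_ell2.rep_eq scaleC_ell2.rep_eq A.add A.scale)
  moreover have "norm (amplify A f) \<le> K * norm f" for f :: "('a \<times> 'b) ell2"
  proof (rule power2_le_imp_le)
    have "(norm (amplify A f))\<^sup>2 = (\<Sum>\<^sub>\<infinity>(a, b). (cmod (coord (A (slice f b)) a))\<^sup>2)"
      unfolding norm_ell2_sq by (rule infsum_cong) (auto simp: coord_amplify[OF assms])
    also have "\<dots> \<le> (K * norm f)\<^sup>2"
      by (intro infsum_le_finite_sums amplify_summable[OF K] amplify_bound[OF K])
    finally show "(norm (amplify A f))\<^sup>2 \<le> (K * norm f)\<^sup>2" .
  qed (use \<open>K \<ge> 0\<close> in simp)
  ultimately show ?thesis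
    by (auto simp: bounded_clinear_def)
qed

lemma amplify_tensor:
  assumes "bounded_clinear A"
  shows "amplify A (f \<otimes>\<^sub>2 g) = A f \<otimes>\<^sub>2 g"
proof -
  interpret A: Vector_Spaces.linear scaleC scaleC A
    using assms by (simp add: bounded_clinear_def)
  have "slice (f \<otimes>\<^sub>2 g) b = coord g b *\<^sub>C f" for b
    by (rule ell2_eqI) (simp add: coord_slice tensor_ell2.rep_eq scaleC_ell2.rep_eq)
  then show ?thesis
    by (intro ell2_eqI)
      (auto simp: coord_amplify[OF assms] A.scale tensor_ell2.rep_eq scaleC_ell2.rep_eq)
qed

section \<open>Regular \<open>\<Lambda>\<close>-polyballs\<close>

text \<open>
  Tuples \<open>T\<close> are functions of \<open>i \<in> {1..k}\<close> and \<open>s \<in> {1..n i}\<close>; their values at other arguments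
  are irrelevant. \<open>\<Lambda> i j s t\<close> stands for \<open>\<lambda>\<^sub>i\<^sub>,\<^sub>j(s,t)\<close>.

  \<open>cp_map r N A\<close> is \<open>X \<mapsto> r\<^sup>2 A\<^sub>1 X A\<^sub>1\<^sup>* + \<dots> + r\<^sup>2 A\<^sub>N X A\<^sub>N\<^sup>*\<close>, and \<open>defect r k n T\<close> is
  \<open>\<Delta>\<^bsub>rT\<^esub>(I)\<close>.
\<close>

definition cp_map ::
    "real \<Rightarrow> nat \<Rightarrow> (nat \<Rightarrow> 'h::chilbert_space \<Rightarrow> 'h) \<Rightarrow> ('h \<Rightarrow> 'h) \<Rightarrow> 'h \<Rightarrow> 'h"
  where "cp_map r N A X = (\<lambda>x. \<Sum>s=1..N. r\<^sup>2 *\<^sub>R A s (X (cadjoint (A s) x)))"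

definition defect ::
    "real \<Rightarrow> nat \<Rightarrow> (nat \<Rightarrow> nat) \<Rightarrow> (nat \<Rightarrow> nat \<Rightarrow> 'h::chilbert_space \<Rightarrow> 'h) \<Rightarrow> 'h \<Rightarrow> 'h"
  where "defect r k n T = foldr (\<lambda>i X x. X x - cp_map r (n i) (T i) X x) [1..<Suc k] id"

definition regular_polyball ::
    "nat \<Rightarrow> (nat \<Rightarrow> nat) \<Rightarrow> (nat \<Rightarrow> nat \<Rightarrow> nat \<Rightarrow> nat \<Rightarrow> complex)
      \<Rightarrow> (nat \<Rightarrow> nat \<Rightarrow> 'h::chilbert_space \<Rightarrow> 'h) set"
  where "regular_polyball k n \<Lambda> = {T.
    (\<forall>i\<in>{1..k}. \<forall>s\<in>{1..n i}. bounded_clinear (T i s)) \<and>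
    (\<forall>i\<in>{1..k}. op_le (\<lambda>x. \<Sum>s=1..n i. T i s (cadjoint (T i s) x)) id) \<and>
    (\<forall>i\<in>{1..k}. \<forall>j\<in>{1..k}. i \<noteq> j \<longrightarrow> (\<forall>s\<in>{1..n i}. \<forall>t\<in>{1..n j}. \<forall>x.
      T i s (T j t x) = \<Lambda> i j s t *\<^sub>C T j t (T i s x))) \<and>
    (\<forall>r\<in>{0..<1}. positive_op (defect r k n T))}"

definition pure_tuple ::
    "nat \<Rightarrow> (nat \<Rightarrow> nat) \<Rightarrow> (nat \<Rightarrow> nat \<Rightarrow> 'h::chilbert_space \<Rightarrow> 'h) \<Rightarrow> bool"
  where "pure_tuple k n T \<longleftrightarrow>
    (\<forall>i\<in>{1..k}. \<forall>x. (\<lambda>q. (cp_map 1 (n i) (T i) ^^ q) id x) \<longlonglongrightarrow> 0)"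


section \<open>The standard \<open>k\<close>-tuple\<close>

text \<open>
  Elements of the free semigroup on \<open>N\<close> generators are words, i.e. lists over \<open>{1..N}\<close>: the
  generator \<open>g\<^sub>s\<close> acts from the left by \<open>(#) s\<close>, and the neutral element is \<open>[]\<close>.
\<close>

definition free_tuples :: "nat \<Rightarrow> (nat \<Rightarrow> nat) \<Rightarrow> (nat \<Rightarrow> nat list) set"
  where "free_tuples k n = (\<Pi>\<^sub>E i\<in>{1..k}. lists {1..n i})"

definition neutral_tuple :: "nat \<Rightarrow> nat \<Rightarrow> nat list"
  where "neutral_tuple k = (\<lambda>i\<in>{1..k}. [])"

definition word_phase ::
    "(nat \<Rightarrow> nat \<Rightarrow> nat \<Rightarrow> nat \<Rightarrow> complex) \<Rightarrow> nat \<Rightarrow> nat \<Rightarrow> nat \<Rightarrow> nat list \<Rightarrow> complex"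
  where "word_phase \<Lambda> i j s w = (\<Prod>t\<leftarrow>w. \<Lambda> i j s t)"

definition shift_phase ::
    "(nat \<Rightarrow> nat \<Rightarrow> nat \<Rightarrow> nat \<Rightarrow> complex) \<Rightarrow> nat \<Rightarrow> nat \<Rightarrow> (nat \<Rightarrow> nat list) \<Rightarrow> complex"
  where "shift_phase \<Lambda> i s \<alpha> = (\<Prod>j\<in>{1..<i}. word_phase \<Lambda> i j s (\<alpha> j))"

text \<open>
  The operator \<open>S\<^sub>i\<^sub>,\<^sub>s\<close>, i.e. the linear and continuous extension of its action on the basis
  vectors \<open>ket \<alpha>\<close> with \<open>\<alpha> \<in> free_tuples k n\<close> (lemmas \<open>std_shift_ket\<close>, \<open>bounded_clinear_std_shift\<close>).
  It is extended by \<open>0\<close> to the orthogonal complement of \<open>ell2_on (free_tuples k n)\<close> in the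
  ambient type, and that subspace reduces it (\<open>std_shift_in_ell2_on\<close>, \<open>std_shift_eq_0\<close>). So its
  adjoint and that of its amplification restrict to the adjoints formed in
  \<open>ell2_on (free_tuples k n)\<close> and in \<open>ell2_on (free_tuples k n \<times> J)\<close>.
\<close>

definition std_shift ::
    "nat \<Rightarrow> (nat \<Rightarrow> nat) \<Rightarrow> (nat \<Rightarrow> nat \<Rightarrow> nat \<Rightarrow> nat \<Rightarrow> complex) \<Rightarrow> nat \<Rightarrow> nat
      \<Rightarrow> (nat \<Rightarrow> nat list) ell2 \<Rightarrow> (nat \<Rightarrow> nat list) ell2"
  where "std_shift k n \<Lambda> i s f =
    (\<Sum>\<^sub>\<infinity>\<alpha>\<in>free_tuples k n. coord f \<alpha> *\<^sub>C shift_phase \<Lambda> i s \<alpha> *\<^sub>C ket (\<alpha>(i := s # \<alpha> i)))"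

text \<open>The orthogonal projection \<open>P\<^sub>\<complex>\<close> onto the line spanned by the basis vector of the neutral element.\<close>

definition vacuum_proj :: "nat \<Rightarrow> (nat \<Rightarrow> nat list) ell2 \<Rightarrow> (nat \<Rightarrow> nat list) ell2"
  where "vacuum_proj k = orth_proj (cspan {ket (neutral_tuple k)})"

lemma weighted_shift:
  fixes h :: "'a \<Rightarrow> 'b" and \<phi> :: "'a \<Rightarrow> complex" and f :: "'a ell2"
  assumes inj: "inj_on h G" and \<phi>: "\<And>a. a \<in> G \<Longrightarrow> cmod (\<phi> a) = 1"
  defines "W \<equiv> \<lambda>f. \<Sum>\<^sub>\<infinity>a\<in>G. coord f a *\<^sub>C \<phi> a *\<^sub>C ket (h a)"
  shows weighted_shift_in: "a \<in> G \<Longrightarrow> coord (W f) (h a) = \<phi> a * coord f a"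
    and weighted_shift_notin: "b \<notin> h ` G \<Longrightarrow> coord (W f) b = 0"
    and weighted_shift_norm: "norm (W f) \<le> norm f"
proof -
  define g where "g b = (if b \<in> h ` G then \<phi> (the_inv_into G h b) * coord f (the_inv_into G h b) else 0)" for b
  have g: "g (h a) = \<phi> a * coord f a" if "a \<in> G" for a
    using that inj by (simp add: g_def the_inv_into_f_f)
  have "((\<lambda>a. (cmod (coord f a))\<^sup>2) has_sum (\<Sum>\<^sub>\<infinity>a\<in>G. (cmod (coord f a))\<^sup>2)) G"
    by (intro has_sum_infsum summable_on_subset[OF coord_sq_summable]) simp
  then have "((\<lambda>a. (cmod (g (h a)))\<^sup>2) has_sum (\<Sum>\<^sub>\<infinity>a\<in>G. (cmod (coord f a))\<^sup>2)) G"
    by (subst has_sum_cong[where g = "\<lambda>a. (cmod (coord f a))\<^sup>2"]) (simp_all add: g \<phi> norm_mult)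
  then have "((\<lambda>b. (cmod (g b))\<^sup>2) has_sum (\<Sum>\<^sub>\<infinity>a\<in>G. (cmod (coord f a))\<^sup>2)) (h ` G)"
    by (simp add: has_sum_reindex[OF inj] o_def)
  then have sum: "((\<lambda>b. (cmod (g b))\<^sup>2) has_sum (\<Sum>\<^sub>\<infinity>a\<in>G. (cmod (coord f a))\<^sup>2)) UNIV"
    by (rule has_sum_cong_neutral[THEN iffD1, rotated -1]) (auto simp: g_def)
  then have coord_g: "coord (Abs_ell2 g) = g"
    by (intro Abs_ell2_inverse) (auto simp: summable_on_def)
  have "((\<lambda>b. g b *\<^sub>C ket b) has_sum Abs_ell2 g) UNIV"
    using has_sum_ket[of "Abs_ell2 g"] by (simp add: coord_g)
  then have "((\<lambda>b. g b *\<^sub>C ket b) has_sum Abs_ell2 g) (h ` G)"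
    by (rule has_sum_cong_neutral[THEN iffD1, rotated -1]) (auto simp: g_def)
  then have "((\<lambda>a. g (h a) *\<^sub>C ket (h a)) has_sum Abs_ell2 g) G"
    by (simp add: has_sum_reindex[OF inj] o_def)
  then have "((\<lambda>a. coord f a *\<^sub>C \<phi> a *\<^sub>C ket (h a)) has_sum Abs_ell2 g) G"
    by (rule has_sum_cong[THEN iffD1, rotated]) (simp add: g mult.commute)
  then have W: "W f = Abs_ell2 g"
    unfolding W_def by (rule infsumI)
  show "a \<in> G \<Longrightarrow> coord (W f) (h a) = \<phi> a * coord f a"
    by (simp add: W coord_g g)
  show "b \<notin> h ` G \<Longrightarrow> coord (W f) b = 0"
    by (simp add: W coord_g g_def)
  have "(norm (W f))\<^sup>2 = (\<Sum>\<^sub>\<infinity>a\<in>G. (cmod (coord f a))\<^sup>2)"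
    unfolding norm_ell2_sq W coord_g by (rule infsumI[OF sum])
  also have "\<dots> \<le> (norm f)\<^sup>2"
    unfolding norm_ell2_sq
    by (rule infsum_mono2) (auto intro: summable_on_subset[OF coord_sq_summable] coord_sq_summable)
  finally show "norm (W f) \<le> norm f"
    by (rule power2_le_imp_le) simp
qed

lemma weighted_shift_bounded_clinear:
  fixes h :: "'a \<Rightarrow> 'b" and \<phi> :: "'a \<Rightarrow> complex"
  assumes inj: "inj_on h G" and \<phi>: "\<And>a. a \<in> G \<Longrightarrow> cmod (\<phi> a) = 1"
  shows "bounded_clinear (\<lambda>f. \<Sum>\<^sub>\<infinity>a\<in>G. coord f a *\<^sub>C \<phi> a *\<^sub>C ket (h a))" 
proof -
  define W where "W f = (\<Sum>\<^sub>\<infinity>a\<in>G. coord f a *\<^sub>C \<phi> a *\<^sub>C ket (h a))" for f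
  note W = weighted_shift_in[where h = h and \<phi> = \<phi>, OF inj \<phi>, folded W_def]
    weighted_shift_notin[where h = h and \<phi> = \<phi>, OF inj \<phi>, folded W_def]
    weighted_shift_norm[where h = h and \<phi> = \<phi>, OF inj \<phi>, folded W_def]
  have "W (f + g) = W f + W g" for f g
  proof (rule ell2_eqI)
    show "coord (W (f + g)) b = coord (W f + W g) b" for b
      by (cases "b \<in> h ` G") (auto simp: W plus_ell2.rep_eq distrib_left)
  qed
  moreover have "W (c *\<^sub>C f) = c *\<^sub>C W f" for c f
  proof (rule ell2_eqI)
    show "coord (W (c *\<^sub>C f)) b = coord (c *\<^sub>C W f) b" for b
      by (cases "b \<in> h ` G") (auto simp: W scaleC_ell2.rep_eq)
  qed
  ultimately have "clinear W"
    by unfold_locales auto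
  moreover have "norm (W f) \<le> 1 * norm f" for f
    using W(3) by simp
  ultimately show ?thesis
    unfolding bounded_clinear_def W_def[symmetric] by blast
qed

lemma inj_cons_at: "inj_on (\<lambda>\<alpha>. \<alpha>(i := s # \<alpha> i)) G"
proof (rule inj_onI)
  fix \<alpha> \<beta> :: "'a \<Rightarrow> 'b list"
  assume eq: "\<alpha>(i := s # \<alpha> i) = \<beta>(i := s # \<beta> i)"
  show "\<alpha> = \<beta>"
  proof
    show "\<alpha> j = \<beta> j" for j
      using fun_cong[OF eq, of j] by (cases "j = i") auto
  qed
qed

context
  fixes k :: nat and n :: "nat \<Rightarrow> nat" and \<Lambda> :: "nat \<Rightarrow> nat \<Rightarrow> nat \<Rightarrow> nat \<Rightarrow> complex" and i s :: nat
  assumes \<Lambda>: "\<And>i j s t. i \<in> {1..k} \<Longrightarrow> j \<in> {1..k} \<Longrightarrow> i \<noteq> j \<Longrightarrow> s \<in> {1..n i} \<Longrightarrow> t \<in> {1..n j}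
      \<Longrightarrow> cmod (\<Lambda> i j s t) = 1"
    and i: "i \<in> {1..k}" and s: "s \<in> {1..n i}"
begin

lemma cmod_shift_phase:
  assumes "\<alpha> \<in> free_tuples k n"
  shows "cmod (shift_phase \<Lambda> i s \<alpha>) = 1"
proof -
  have "cmod (word_phase \<Lambda> i j s w) = 1" if "j \<in> {1..<i}" "set w \<subseteq> {1..n j}" for j w
    using that(2) by (induction w) (use \<Lambda>[of i j s] that(1) i s in \<open>auto simp: word_phase_def norm_mult\<close>)
  moreover have "set (\<alpha> j) \<subseteq> {1..n j}" if "j \<in> {1..<i}" for j
    using assms i that by (auto simp: free_tuples_def PiE_iff lists_eq_set)
  ultimately show ?thesis
    unfolding shift_phase_def by (simp add: prod_norm[symmetric])
qed

lemma bounded_clinear_std_shift: "bounded_clinear (std_shift k n \<Lambda> i s)"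
  unfolding std_shift_def by (intro weighted_shift_bounded_clinear inj_cons_at cmod_shift_phase)

lemma std_shift_ket:
  assumes "\<alpha> \<in> free_tuples k n"
  shows "std_shift k n \<Lambda> i s (ket \<alpha>) = shift_phase \<Lambda> i s \<alpha> *\<^sub>C ket (\<alpha>(i := s # \<alpha> i))"
proof -
  have "std_shift k n \<Lambda> i s (ket \<alpha>) =
      (\<Sum>\<^sub>\<infinity>\<beta>\<in>{\<alpha>}. coord (ket \<alpha>) \<beta> *\<^sub>C shift_phase \<Lambda> i s \<beta> *\<^sub>C ket (\<beta>(i := s # \<beta> i)))"
    unfolding std_shift_def
    by (rule infsum_cong_neutral) (use assms in \<open>auto simp: ket.rep_eq\<close>)
  then show ?thesis
    by (simp add: ket.rep_eq)
qed

lemma std_shift_in_ell2_on: "std_shift k n \<Lambda> i s f \<in> ell2_on (free_tuples k n)"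
proof -
  have "\<alpha>(i := s # \<alpha> i) \<in> free_tuples k n" if "\<alpha> \<in> free_tuples k n" for \<alpha>
    using that i s by (auto simp: free_tuples_def PiE_iff extensional_def lists_eq_set)
  then have "\<beta> \<notin> (\<lambda>\<alpha>. \<alpha>(i := s # \<alpha> i)) ` free_tuples k n" if "\<beta> \<notin> free_tuples k n" for \<beta>
    using that by blast
  from weighted_shift_notin[where \<phi> = "shift_phase \<Lambda> i s", OF inj_cons_at cmod_shift_phase this]
  show ?thesis
    unfolding ell2_on_def std_shift_def by blast
qed

lemma std_shift_eq_0:
  assumes "\<And>\<alpha>. \<alpha> \<in> free_tuples k n \<Longrightarrow> coord f \<alpha> = 0"
  shows "std_shift k n \<Lambda> i s f = 0"
  unfolding std_shift_def using assms by (simp cong: infsum_cong)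

end

lemma vacuum_proj_eq: "vacuum_proj k f = coord f (neutral_tuple k) *\<^sub>C ket (neutral_tuple k)"
proof -
  let ?v = "ket (neutral_tuple k)"
  have span: "cspan {?v} = range (\<lambda>c. c *\<^sub>C ?v)"
    by (rule complex_vector.span_singleton)
  have *: "cinner (f - c *\<^sub>C ?v) (d *\<^sub>C ?v) = cnj d * (coord f (neutral_tuple k) - c)" for c d
  proof -
    have "cinner (f - c *\<^sub>C ?v) (d *\<^sub>C ?v) = cnj (d * cinner ?v (f - c *\<^sub>C ?v))"
      by (metis cinner_commute cinner_scaleC_left)
    also have "\<dots> = cnj d * cinner (f - c *\<^sub>C ?v) ?v"
      by (metis cinner_commute complex_cnj_mult)
    finally show ?thesis
      by (simp add: cinner_ket minus_ell2.rep_eq scaleC_ell2.rep_eq ket.rep_eq)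
  qed
  show ?thesis
    unfolding vacuum_proj_def orth_proj_def span
  proof (rule the_equality)
    show "coord f (neutral_tuple k) *\<^sub>C ?v \<in> range (\<lambda>c. c *\<^sub>C ?v) \<and>
        (\<forall>z\<in>range (\<lambda>c. c *\<^sub>C ?v). cinner (f - coord f (neutral_tuple k) *\<^sub>C ?v) z = 0)"
      by (auto simp: *)
    fix y
    assume "y \<in> range (\<lambda>c. c *\<^sub>C ?v) \<and> (\<forall>z\<in>range (\<lambda>c. c *\<^sub>C ?v). cinner (f - y) z = 0)"
    then obtain c where "y = c *\<^sub>C ?v" "cinner (f - c *\<^sub>C ?v) (1 *\<^sub>C ?v) = 0"
      by blast
    then show "y = coord f (neutral_tuple k) *\<^sub>C ?v"
      unfolding * by simp
  qed
qed


section \<open>Compressions and unitary equivalence\<close>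

text \<open>
  \<open>T\<close> is unitarily equivalent to the compression of the tuple \<open>V\<close> to the closed subspace \<open>M\<close>:
  one unitary \<open>U\<close> from the whole space of \<open>T\<close> onto \<open>M\<close> intertwines \<open>T i s\<close> with the restriction of
  \<open>P\<^sub>M \<circ> V i s\<close> to \<open>M\<close>.
\<close>

definition unitarily_equiv_compression ::
    "nat \<Rightarrow> (nat \<Rightarrow> nat) \<Rightarrow> (nat \<Rightarrow> nat \<Rightarrow> 'h::chilbert_space \<Rightarrow> 'h)
      \<Rightarrow> (nat \<Rightarrow> nat \<Rightarrow> 'g::chilbert_space \<Rightarrow> 'g) \<Rightarrow> 'g set \<Rightarrow> bool"
  where "unitarily_equiv_compression k n T V M \<longleftrightarrow>
    (\<exists>U. clinear U \<and> (\<forall>x y. cinner (U x) (U y) = cinner x y) \<and> range U = M \<and>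
      (\<forall>i\<in>{1..k}. \<forall>s\<in>{1..n i}. \<forall>x. U (T i s x) = orth_proj M (V i s (U x))))"

definition jointly_coinvariant ::
    "nat \<Rightarrow> (nat \<Rightarrow> nat) \<Rightarrow> (nat \<Rightarrow> nat \<Rightarrow> 'g::chilbert_space \<Rightarrow> 'g) \<Rightarrow> 'g set \<Rightarrow> bool"
  where "jointly_coinvariant k n V M \<longleftrightarrow>
    (\<forall>i\<in>{1..k}. \<forall>s\<in>{1..n i}. cadjoint (V i s) ` M \<subseteq> M)"

end

theory Submission
  imports Defs
begin

text \<open>
  Everything is read off from quadratic forms. With \<open>B\<^sub>i\<^sub>,\<^sub>s = T\<^sub>i\<^sub>,\<^sub>s\<^sup>*\<close>, the map \<open>\<Phi>\<^bsub>rT\<^sub>i\<^esub>\<close> turns the form \<open>p\<close> of an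
  operator into \<open>x \<mapsto> \<Sum>s. r\<^sup>2 p (B\<^sub>i\<^sub>,\<^sub>s x)\<close>; since the phases have modulus 1, these maps commute for
  different \<open>i\<close>.

  Given a pure \<open>T\<close> in the polyball, letting \<open>r \<rightarrow> 1\<close> gives \<open>\<Delta>\<^sub>T(I) \<ge> 0\<close>, so \<open>\<Delta>\<^sub>T(I) = L\<^sup>* L\<close> with
  \<open>L : H \<rightarrow> \<ell>\<^sup>2(m)\<close>. The Berezin kernel \<open>K x = (L T\<^sub>\<alpha>\<^sup>* x)\<^sub>\<alpha>\<close> intertwines \<open>T\<^sub>i\<^sub>,\<^sub>s\<^sup>*\<close> with
  \<open>S\<^sub>i\<^sub>,\<^sub>s\<^sup>* \<otimes> I\<close>, and it is isometric because the sum of \<open>T\<^sub>\<alpha> \<Delta>\<^sub>T(I) T\<^sub>\<alpha>\<^sup>*\<close> over the words of length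
  below \<open>Q\<close> telescopes to \<open>(id - \<Phi>\<^sub>1\<^sup>Q) \<dots> (id - \<Phi>\<^sub>k\<^sup>Q) (I) \<rightarrow> I\<close>. Take \<open>M\<close> to be the range of \<open>K\<close>.

  Conversely, for a compression to a co-invariant subspace all forms involved are diagonal:
  \<open>\<Phi>\<^sub>i\<close> shifts the weights \<open>w\<close> of \<open>f \<mapsto> \<Sum>\<alpha>. w \<alpha> |f \<alpha>|\<^sup>2\<close>, and the form of \<open>\<Delta>\<^bsub>rT\<^esub>(I)\<close> has weight
  \<open>1 - r\<^sup>2\<close> for every nonempty component of \<open>\<alpha>\<close>. In both directions
  \<open>\<langle>\<Delta>\<^sub>T(I) x, x\<rangle> = \<parallel>(P\<^sub>\<complex> \<otimes> I) U x\<parallel>\<^sup>2\<close> identifies the two dimensions by polar decomposition.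
\<close>

subsection \<open>Complex inner products and bounded operators\<close>

lemma cinner_add_right: "cinner x (y + z) = cinner x y + cinner x z"
  by (metis cinner_add_left cinner_commute complex_cnj_add)

lemma cinner_scaleC_right: "cinner x (c *\<^sub>C y) = cnj c * cinner x y"
  by (metis cinner_commute cinner_scaleC_left complex_cnj_mult)

lemma cinner_zero_left [simp]: "cinner 0 x = 0"
  by (metis add_cancel_left_right cinner_add_left)

lemma cinner_zero_right [simp]: "cinner x 0 = 0"
  by (metis add_cancel_left_right cinner_add_right)

lemma cinner_minus_left: "cinner (- x) y = - cinner x y"
  by (metis add.right_inverse add_eq_0_iff cinner_add_left cinner_zero_left)

lemma cinner_minus_right: "cinner x (- y) = - cinner x y"
  by (metis add.right_inverse add_eq_0_iff cinner_add_right cinner_zero_right)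

lemma cinner_diff_left: "cinner (x - y) z = cinner x z - cinner y z"
  using cinner_add_left[of x "- y"] by (simp add: cinner_minus_left)

lemma cinner_diff_right: "cinner x (y - z) = cinner x y - cinner x z"
  using cinner_add_right[of x y "- z"] by (simp add: cinner_minus_right)

lemma cinner_sum_left: "cinner (\<Sum>a\<in>S. f a) y = (\<Sum>a\<in>S. cinner (f a) y)"
  by (induction S rule: infinite_finite_induct) (simp_all add: cinner_add_left)

lemma cinner_sum_right: "cinner y (\<Sum>a\<in>S. f a) = (\<Sum>a\<in>S. cinner y (f a))"
  by (induction S rule: infinite_finite_induct) (simp_all add: cinner_add_right)

lemma scaleR_eq_scaleC: "r *\<^sub>R x = complex_of_real r *\<^sub>C x"
  by (simp add: scaleC_of_real)

lemma cinner_scaleR_left: "cinner (r *\<^sub>R x) y = r * cinner x y"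
  by (simp add: scaleR_eq_scaleC cinner_scaleC_left)

lemma cinner_scaleR_right: "cinner x (r *\<^sub>R y) = r * cinner x y"
  by (simp add: scaleR_eq_scaleC cinner_scaleC_right)

lemma cinner_self: "cinner x x = complex_of_real ((norm x)\<^sup>2)"
proof (rule complex_eqI)
  show "Re (cinner x x) = Re (complex_of_real ((norm x)\<^sup>2))"
    by (simp add: Re_cinner power2_norm_eq_inner)
  show "Im (cinner x x) = Im (complex_of_real ((norm x)\<^sup>2))"
    by (metis Im_complex_of_real Reals_cnj_iff cinner_commute complex_is_Real_iff)
qed

text \<open>Both parts of \<open>cinner\<close> become values of the real form, so orthogonality or
  isometry for \<open>inner\<close> upgrades to \<open>cinner\<close> on anything stable under
  multiplication by \<open>\<i>\<close>.\<close>

lemma Im_cinner: "Im (cinner x y) = inner x (\<i> *\<^sub>C y)"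
  by (simp add: cinner_scaleC_right flip: Re_cinner)

lemma cinner_extI:
  assumes "\<And>z. cinner x z = cinner y z"
  shows "x = y"
proof -
  have "cinner (x - y) (x - y) = 0"
    by (simp add: cinner_diff_left assms)
  then show ?thesis
    by (simp add: cinner_self)
qed

lemma norm_scaleC: "norm (c *\<^sub>C x) = cmod c * norm x"
proof -
  have "complex_of_real ((norm (c *\<^sub>C x))\<^sup>2) = c * cnj c * complex_of_real ((norm x)\<^sup>2)"
    unfolding cinner_self[symmetric] by (simp add: cinner_scaleC_left cinner_scaleC_right)
  also have "\<dots> = complex_of_real ((cmod c * norm x)\<^sup>2)"
    by (metis complex_norm_square of_real_mult power_mult_distrib)
  finally have "(norm (c *\<^sub>C x))\<^sup>2 = (cmod c * norm x)\<^sup>2"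
    using of_real_eq_iff by blast
  then show ?thesis
    by simp
qed

text \<open>A unimodular rotation of \<open>x\<close> makes the inner product real and nonnegative,
  so the real Cauchy-Schwarz inequality suffices.\<close>

lemma cmod_cinner_le: "cmod (cinner x y) \<le> norm x * norm y"
proof (cases "cinner x y = 0")
  case False
  define c where "c = cnj (cinner x y) / cmod (cinner x y)"
  have "cmod c = 1"
    using False by (simp add: c_def norm_divide)
  have "c * cinner x y = cmod (cinner x y)"
    unfolding c_def using False
    by (simp add: field_simps complex_norm_square flip: power2_eq_square of_real_power)
  then have "cmod (cinner x y) = inner (c *\<^sub>C x) y"
    by (metis Re_cinner Re_complex_of_real cinner_scaleC_left)
  also have "\<dots> \<le> norm (c *\<^sub>C x) * norm y"
    by (rule norm_cauchy_schwarz)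
  finally show ?thesis
    by (simp add: norm_scaleC \<open>cmod c = 1\<close>)
qed simp

lemma bounded_bilinear_cinner: "bounded_bilinear (cinner :: 'a::complex_inner \<Rightarrow> 'a \<Rightarrow> complex)"
proof
  show "\<exists>K. \<forall>a b :: 'a. norm (cinner a b) \<le> norm a * norm b * K"
    by (rule exI[of _ 1]) (simp add: cmod_cinner_le)
qed (simp_all add: cinner_add_left cinner_add_right cinner_scaleR_left cinner_scaleR_right scaleR_conv_of_real)

lemmas tendsto_cinner [tendsto_intros] = bounded_bilinear.tendsto[OF bounded_bilinear_cinner]

lemma bounded_linear_scaleC: "bounded_linear (\<lambda>x::'a::complex_inner. c *\<^sub>C x)"
proof (rule bounded_linear_intro)
  show "c *\<^sub>C (r *\<^sub>R x) = r *\<^sub>R (c *\<^sub>C x)" for r and x :: 'a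
    by (simp add: scaleR_eq_scaleC scaleC_scaleC mult.commute)
  show "norm (c *\<^sub>C x) \<le> norm x * cmod c" for x :: 'a
    by (simp add: norm_scaleC)
qed (simp add: scaleC_add_right)

lemmas tendsto_scaleC [tendsto_intros] = bounded_linear.tendsto[OF bounded_linear_scaleC]

text \<open>Polarization. Having \<open>R\<close> in place of the identity also covers the partial
  isometry \<open>R x \<mapsto> A x\<close> of a polar decomposition.\<close>

lemma isometric_cinner:
  fixes A :: "'a::complex_inner \<Rightarrow> 'b::complex_inner" and R :: "'a \<Rightarrow> 'c::complex_inner"
  assumes "clinear A" "clinear R" and norm: "\<And>x. norm (A x) = norm (R x)"
  shows "cinner (A x) (A y) = cinner (R x) (R y)"
proof -
  interpret A: Vector_Spaces.linear scaleC scaleC A by fact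
  interpret R: Vector_Spaces.linear scaleC scaleC R by fact
  have *: "inner (A x) (A y) = inner (R x) (R y)" for x y
    by (simp only: dot_norm norm flip: A.add R.add)
  have "Im (cinner (A x) (A y)) = Im (cinner (R x) (R y))"
    by (simp only: Im_cinner * flip: A.scale R.scale)
  then show ?thesis
    using * by (intro complex_eqI) (simp_all only: Re_cinner)
qed

section \<open>Bounded complex-linear operators\<close>

lemma clinearI:
  assumes "\<And>x y. A (x + y) = A x + A y" "\<And>c x. A (c *\<^sub>C x) = c *\<^sub>C A x"
  shows "clinear A"
  using assms by unfold_locales auto

lemma bounded_clinear_bounded_linear:
  assumes "bounded_clinear A"
  shows "bounded_linear A"
proof -
  obtain K where "clinear A" and K: "\<And>x. norm (A x) \<le> K * norm x"
    using assms by (auto simp: bounded_clinear_def)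
  interpret A: Vector_Spaces.linear scaleC scaleC A by fact
  show ?thesis
    by (rule bounded_linear_intro[where K = K])
      (simp_all add: A.add A.scale scaleR_eq_scaleC K mult.commute)
qed

lemma bounded_clinearI:
  assumes "\<And>x y. A (x + y) = A x + A y" "\<And>c x. A (c *\<^sub>C x) = c *\<^sub>C A x" "\<And>x. norm (A x) \<le> K * norm x"
  shows "bounded_clinear A"
  unfolding bounded_clinear_def using clinearI[of A] assms by blast

text \<open>Separating complex homogeneity from \<open>bounded_linear\<close> lets the closure
  properties that follow be inherited from the real theory.\<close>

lemma bounded_clinear_iff: "bounded_clinear A \<longleftrightarrow> bounded_linear A \<and> (\<forall>c x. A (c *\<^sub>C x) = c *\<^sub>C A x)"
proof safe
  assume A: "bounded_clinear A"
  then show "bounded_linear A"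
    by (rule bounded_clinear_bounded_linear)
  interpret A: Vector_Spaces.linear scaleC scaleC A
    using A by (simp add: bounded_clinear_def)
  show "A (c *\<^sub>C x) = c *\<^sub>C A x" for c x
    by (rule A.scale)
next
  assume A: "bounded_linear A" "\<forall>c x. A (c *\<^sub>C x) = c *\<^sub>C A x"
  interpret A: bounded_linear A by fact
  obtain K where "\<And>x. norm (A x) \<le> norm x * K"
    using A.bounded by blast
  then show "bounded_clinear A"
    using A by (intro bounded_clinearI[of _ K]) (simp_all add: A.add mult.commute)
qed

lemma bounded_clinear_scaleC: "bounded_clinear A \<Longrightarrow> A (c *\<^sub>C x) = c *\<^sub>C A x"
  by (simp add: bounded_clinear_iff)

lemma bounded_clinear_id: "bounded_clinear id"
  by (rule bounded_clinearI[where K = 1]) auto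

lemma bounded_clinear_compose:
  "bounded_clinear A \<Longrightarrow> bounded_clinear B \<Longrightarrow> bounded_clinear (\<lambda>x. A (B x))"
  by (simp add: bounded_clinear_iff bounded_linear_compose)

lemma bounded_clinear_add:
  "bounded_clinear A \<Longrightarrow> bounded_clinear B \<Longrightarrow> bounded_clinear (\<lambda>x. A x + B x)"
  by (simp add: bounded_clinear_iff bounded_linear_add scaleC_add_right)

lemma bounded_clinear_diff:
  "bounded_clinear A \<Longrightarrow> bounded_clinear B \<Longrightarrow> bounded_clinear (\<lambda>x. A x - B x)"
  by (simp add: bounded_clinear_iff bounded_linear_sub complex_vector.scale_right_diff_distrib)

lemma bounded_clinear_scaleR:
  "bounded_clinear A \<Longrightarrow> bounded_clinear (\<lambda>x. r *\<^sub>R A x)"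
  by (auto simp: bounded_clinear_iff scaleR_eq_scaleC scaleC_scaleC mult.commute
      intro: bounded_linear_compose[OF bounded_linear_scaleC])

lemma bounded_clinear_sum:
  "(\<And>s. s \<in> S \<Longrightarrow> bounded_clinear (A s)) \<Longrightarrow> bounded_clinear (\<lambda>x. \<Sum>s\<in>S. A s x)"
  by (auto simp: bounded_clinear_iff complex_vector.scale_sum_right intro: bounded_linear_sum)

subsection \<open>Orthogonal projections and adjoints\<close>

lemma closest_point_exists:
  fixes x :: "'a::chilbert_space"
  assumes M: "csubspace M" "closed M"
  obtains y where "y \<in> M" "\<And>z. z \<in> M \<Longrightarrow> norm (x - y) \<le> norm (x - z)"
proof -
  define d where "d = (INF z\<in>M. (norm (x - z))\<^sup>2)"
  have "0 \<in> M"
    using M by (simp add: complex_vector.subspace_0)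
  have bdd: "bdd_below ((\<lambda>z. (norm (x - z))\<^sup>2) ` M)"
    by (rule bdd_belowI2[where m = 0]) simp
  have d_le: "d \<le> (norm (x - z))\<^sup>2" if "z \<in> M" for z
    unfolding d_def using that by (rule cINF_lower[OF bdd])
  have "\<exists>y\<in>M. (norm (x - y))\<^sup>2 < d + inverse (real (Suc n))" for n
    using cINF_less_iff[OF _ bdd, of "d + inverse (real (Suc n))"] \<open>0 \<in> M\<close>
    by (auto simp flip: d_def)
  then obtain Y where Y: "\<And>n. Y n \<in> M" "\<And>n. (norm (x - Y n))\<^sup>2 < d + inverse (real (Suc n))"
    by metis
  have dist: "(norm (Y p - Y q))\<^sup>2 \<le> 2 * inverse (real (Suc p)) + 2 * inverse (real (Suc q))" for p q
  proof -
    \<comment> \<open>Parallelogram law: the midpoint lies in \<open>M\<close>, so its squared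
      distance to \<open>x\<close> is at least \<open>d\<close>, which forces two near-minimizers to
      be close to each other.\<close>
    have mid: "(1 / 2) *\<^sub>R (Y p + Y q) \<in> M"
      using M Y by (simp add: scaleR_eq_scaleC complex_vector.subspace_add complex_vector.subspace_scale)
    have "(norm (Y p - Y q))\<^sup>2 = 2 * (norm (x - Y p))\<^sup>2 + 2 * (norm (x - Y q))\<^sup>2
        - 4 * (norm (x - (1 / 2) *\<^sub>R (Y p + Y q)))\<^sup>2"
      by (simp add: power2_norm_eq_inner inner_diff_left inner_diff_right inner_add_left
          inner_add_right inner_commute algebra_simps)
    with d_le[OF mid] Y(2)[of p] Y(2)[of q] show ?thesis
      by simp
  qed
  have "Cauchy Y"
  proof (rule metric_CauchyI)
    fix e :: real assume "0 < e"
    then obtain N where N: "inverse (real (Suc N)) < e\<^sup>2 / 4"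
      using reals_Archimedean[of "e\<^sup>2 / 4"] by auto
    have "dist (Y p) (Y q) < e" if "p \<ge> N" "q \<ge> N" for p q
    proof -
      have "inverse (real (Suc p)) \<le> inverse (real (Suc N))" "inverse (real (Suc q)) \<le> inverse (real (Suc N))"
        using that by (simp_all add: field_simps)
      with dist[of p q] N have "(norm (Y p - Y q))\<^sup>2 < e\<^sup>2"
        by linarith
      then show ?thesis
        unfolding dist_norm by (rule power2_less_imp_less) (use \<open>0 < e\<close> in simp)
    qed
    then show "\<exists>N. \<forall>p\<ge>N. \<forall>q\<ge>N. dist (Y p) (Y q) < e"
      by blast
  qed
  then obtain y where y: "Y \<longlonglongrightarrow> y"
    using Cauchy_convergent convergent_def by blast
  have "(\<lambda>n. (norm (x - Y n))\<^sup>2) \<longlonglongrightarrow> (norm (x - y))\<^sup>2"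
    by (intro tendsto_intros y)
  moreover have "(\<lambda>n. d + inverse (real (Suc n))) \<longlonglongrightarrow> d"
    using tendsto_add[OF tendsto_const LIMSEQ_inverse_real_of_nat, of d] by simp
  ultimately have "(norm (x - y))\<^sup>2 \<le> d"
    by (rule LIMSEQ_le) (use Y(2) in \<open>auto intro!: less_imp_le exI[of _ 0]\<close>)
  then have "norm (x - y) \<le> norm (x - z)" if "z \<in> M" for z
    using power2_le_imp_le[OF order_trans[OF _ d_le[OF that]]] by simp
  moreover have "y \<in> M"
    using closed_sequentially[OF \<open>closed M\<close> Y(1) y] .
  ultimately show thesis
    using that by blast
qed

lemma closest_point_orthogonal:
  fixes x :: "'a::complex_inner"
  assumes M: "csubspace M" and y: "y \<in> M" "\<And>z. z \<in> M \<Longrightarrow> norm (x - y) \<le> norm (x - z)"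
    and z: "z \<in> M"
  shows "cinner (x - y) z = 0"
proof -
  have re: "inner (x - y) z = 0" if "z \<in> M" for z
  proof (cases "z = 0")
    case False
    \<comment> \<open>\<open>t\<close> minimizes the norm of \<open>x - y - t *\<^sub>R z\<close>;
      minimality of \<open>y\<close> then leaves no room for a nonzero
      \<open>inner (x - y) z\<close>.\<close>
    define t where "t = inner (x - y) z / (norm z)\<^sup>2"
    have "y + t *\<^sub>R z \<in> M"
      using M y that by (simp add: scaleR_eq_scaleC complex_vector.subspace_add complex_vector.subspace_scale)
    then have "(norm (x - y))\<^sup>2 \<le> (norm (x - y - t *\<^sub>R z))\<^sup>2"
      using y(2) by (intro power_mono) (auto simp: algebra_simps)
    also have "\<dots> = (norm (x - y))\<^sup>2 - 2 * t * inner (x - y) z + t * t * (norm z)\<^sup>2"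
      by (simp add: power2_norm_eq_inner inner_diff_left inner_diff_right inner_commute algebra_simps)
    also have "\<dots> = (norm (x - y))\<^sup>2 - (inner (x - y) z)\<^sup>2 / (norm z)\<^sup>2"
      using False by (simp add: t_def power2_eq_square)
    finally show ?thesis
      using False by (simp add: divide_le_0_iff)
  qed simp
  have "\<i> *\<^sub>C z \<in> M"
    using M z by (rule complex_vector.subspace_scale)
  with re z show ?thesis
    by (intro complex_eqI) (simp_all add: Re_cinner Im_cinner)
qed

lemma orth_proj_unique:
  assumes M: "csubspace M" and y: "y \<in> M" "\<And>z. z \<in> M \<Longrightarrow> cinner (x - y) z = 0"
  shows "orth_proj M x = y"
  unfolding orth_proj_def
proof (rule the_equality)
  fix y' assume y': "y' \<in> M \<and> (\<forall>z\<in>M. cinner (x - y') z = 0)"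
  with M y have "y' - y \<in> M"
    by (simp add: complex_vector.subspace_diff)
  moreover have "cinner (y' - y) (y' - y) = cinner (x - y) (y' - y) - cinner (x - y') (y' - y)"
    by (simp flip: cinner_diff_left)
  ultimately show "y' = y"
    using y y' by (simp add: cinner_self)
qed (use y in blast)

lemma
  fixes x :: "'a::chilbert_space"
  assumes M: "csubspace M" "closed M"
  shows orth_proj_in: "orth_proj M x \<in> M"
    and cinner_orth_proj: "z \<in> M \<Longrightarrow> cinner (orth_proj M x) z = cinner x z"
proof -
  obtain y where y: "y \<in> M" "\<And>z. z \<in> M \<Longrightarrow> norm (x - y) \<le> norm (x - z)"
    using closest_point_exists[OF M, of x] by blast
  note orth = closest_point_orthogonal[OF M(1) y]
  have eq: "orth_proj M x = y"
    by (rule orth_proj_unique[OF M(1) y(1) orth])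
  show "orth_proj M x \<in> M" "z \<in> M \<Longrightarrow> cinner (orth_proj M x) z = cinner x z"
    using y(1) orth[of z] by (simp_all add: eq cinner_diff_left)
qed

text \<open>The residual \<open>x - orth_proj M x\<close> is orthogonal to \<open>M\<close>, hence
  by hypothesis to \<open>x\<close>, hence to itself. This double-complement criterion serves to
  compare closures of ranges.\<close>

lemma orthogonal_complement_trivial:
  fixes x :: "'a::chilbert_space"
  assumes M: "csubspace M" "closed M" and x: "\<And>y. (\<And>z. z \<in> M \<Longrightarrow> cinner y z = 0) \<Longrightarrow> cinner y x = 0"
  shows "x \<in> M"
proof -
  let ?p = "orth_proj M x"
  have orth: "cinner (x - ?p) z = 0" if "z \<in> M" for z
    using cinner_orth_proj[OF M that] by (simp add: cinner_diff_left)
  have "cinner (x - ?p) (x - ?p) = 0"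
    using x[OF orth] orth[OF orth_proj_in[OF M]] by (simp add: cinner_diff_right)
  then show ?thesis
    using orth_proj_in[OF M, of x] by (simp add: cinner_self)
qed

lemma riesz_representation:
  fixes \<phi> :: "'a::chilbert_space \<Rightarrow> complex"
  assumes \<phi>_add: "\<And>x y. \<phi> (x + y) = \<phi> x + \<phi> y" and \<phi>_scale: "\<And>c x. \<phi> (c *\<^sub>C x) = c * \<phi> x"
    and bound: "\<And>x. cmod (\<phi> x) \<le> K * norm x"
  obtains y where "\<And>x. \<phi> x = cinner x y"
proof (cases "\<forall>x. \<phi> x = 0")
  case True
  then show ?thesis
    by (intro that[of 0]) simp
next
  case False
  interpret bounded_linear \<phi>
    by (rule bounded_linear_intro[where K = K])
      (simp_all add: \<phi>_add \<phi>_scale bound scaleR_eq_scaleC scaleR_conv_of_real mult.commute)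
  define M where "M = {x. \<phi> x = 0}"
  have M: "csubspace M" "closed M"
    unfolding M_def complex_vector.subspace_def
    by (auto simp: \<phi>_add \<phi>_scale zero intro!: closed_Collect_eq continuous_on continuous_on_const continuous_on_id)
  obtain u where "\<phi> u \<noteq> 0"
    using False by blast
  \<comment> \<open>The component of \<open>u\<close> orthogonal to the kernel. The kernel has
    codimension one, so the representing vector must be a multiple of \<open>v\<close>.\<close>
  define v where "v = u - orth_proj M u"
  have "\<phi> v \<noteq> 0"
    using orth_proj_in[OF M, of u] \<open>\<phi> u \<noteq> 0\<close> by (simp add: v_def diff M_def)
  then have "v \<noteq> 0"
    using zero by auto
  have v: "cinner v z = 0" if "\<phi> z = 0" for z
    using cinner_orth_proj[OF M, of z u] that by (simp add: v_def cinner_diff_left M_def)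
  have "\<phi> x = cinner x ((cnj (\<phi> v) / (norm v)\<^sup>2) *\<^sub>C v)" for x
  proof -
    \<comment> \<open>This combination lies in the kernel and is therefore orthogonal to
      \<open>v\<close>; solving for \<open>\<phi> x\<close> gives the formula.\<close>
    have "\<phi> (\<phi> v *\<^sub>C x - \<phi> x *\<^sub>C v) = 0"
      by (simp add: diff \<phi>_scale)
    then have "cinner (\<phi> v *\<^sub>C x - \<phi> x *\<^sub>C v) v = 0"
      by (metis cinner_commute complex_cnj_zero v)
    then have "\<phi> v * cinner x v = \<phi> x * (norm v)\<^sup>2"
      by (simp add: cinner_diff_left cinner_scaleC_left cinner_self)
    then show ?thesis
      using \<open>v \<noteq> 0\<close> by (simp add: cinner_scaleC_right field_simps)
  qed
  then show ?thesis
    using that by blast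
qed

section \<open>Adjoints of bounded operators\<close>

lemma cadjoint_unique:
  assumes "\<And>x y. cinner (A x) y = cinner x (B y)"
  shows "cadjoint A = B"
  unfolding cadjoint_def
proof (rule the_equality)
  fix C assume C: "\<forall>x y. cinner (A x) y = cinner x (C y)"
  have "cinner (C y) x = cinner (B y) x" for x y
    by (metis C assms cinner_commute)
  then show "C = B"
    by (intro ext cinner_extI)
qed (use assms in blast)

text \<open>\<open>cadjoint\<close> is a definite description, so its defining identity rests on
  existence by Riesz, one \<open>y\<close> at a time, together with
  \<open>cadjoint_unique\<close>.\<close>

lemma cinner_cadjoint_right:
  assumes "bounded_clinear A"
  shows "cinner x (cadjoint A y) = cinner (A x) y"
proof -
  interpret bounded_linear A
    using assms by (rule bounded_clinear_bounded_linear)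
  obtain K where K: "\<And>x. norm (A x) \<le> norm x * K"
    using bounded by blast
  have "\<exists>z. \<forall>x. cinner (A x) y = cinner x z" for y
  proof -
    have "cmod (cinner (A x) y) \<le> (K * norm y) * norm x" for x
    proof -
      have "norm (A x) * norm y \<le> (norm x * K) * norm y"
        by (intro mult_right_mono K) simp
      then show ?thesis
        using cmod_cinner_le[of "A x" y] by (simp add: mult_ac)
    qed
    then obtain z where "\<And>x. cinner (A x) y = cinner x z"
      by (rule riesz_representation[rotated 2])
        (auto simp: add cinner_add_left bounded_clinear_scaleC[OF assms] cinner_scaleC_left)
    then show ?thesis
      by blast
  qed
  then obtain B where "\<And>x y. cinner (A x) y = cinner x (B y)"
    by metis
  then show ?thesis
    using cadjoint_unique[of A B] by simp
qed

lemma cinner_cadjoint_left: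
  "bounded_clinear A \<Longrightarrow> cinner (cadjoint A x) y = cinner x (A y)"
  by (metis cinner_cadjoint_right cinner_commute)

lemma bounded_clinear_cadjoint:
  assumes "bounded_clinear A"
  shows "bounded_clinear (cadjoint A)"
proof -
  interpret bounded_linear A
    using assms by (rule bounded_clinear_bounded_linear)
  obtain K where "K \<ge> 0" and K: "\<And>x. norm (A x) \<le> norm x * K"
    using nonneg_bounded by blast
  have "norm (cadjoint A x) \<le> K * norm x" for x
  proof (cases "cadjoint A x = 0")
    case False
    \<comment> \<open>Moving the adjoint across leaves a factor \<open>norm (cadjoint A x)\<close>
      on both sides, which cancels. Linearity follows below by testing against all vectors.\<close>
    have "(norm (cadjoint A x))\<^sup>2 = cmod (cinner (cadjoint A x) (cadjoint A x))"
      by (simp add: cinner_self norm_power)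
    also have "\<dots> = cmod (cinner x (A (cadjoint A x)))"
      by (simp add: cinner_cadjoint_left[OF assms])
    also have "\<dots> \<le> norm x * (norm (cadjoint A x) * K)"
      by (rule order_trans[OF cmod_cinner_le]) (intro mult_left_mono K norm_ge_zero)
    finally show ?thesis
      using False by (simp add: power2_eq_square mult_ac)
  qed (simp add: \<open>K \<ge> 0\<close>)
  then show ?thesis
    by (intro bounded_clinearI[where K = K] cinner_extI)
      (simp_all add: cinner_cadjoint_left[OF assms] cinner_add_left cinner_scaleC_left)
qed

instance chilbert_space \<subseteq> banach ..

subsection \<open>Positive operators and their square roots\<close>

definition selfadjoint :: "('a::complex_inner \<Rightarrow> 'a) \<Rightarrow> bool"
  where "selfadjoint X \<longleftrightarrow> bounded_clinear X \<and> (\<forall>x y. cinner (X x) y = cinner x (X y))"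

lemma selfadjoint_bounded_clinear: "selfadjoint X \<Longrightarrow> bounded_clinear X"
  by (simp add: selfadjoint_def)

lemma selfadjoint_cinner: "selfadjoint X \<Longrightarrow> cinner (X x) y = cinner x (X y)"
  by (simp add: selfadjoint_def)

lemma selfadjoint_inner: "selfadjoint X \<Longrightarrow> inner (X x) y = inner x (X y)"
  by (simp add: selfadjoint_def flip: Re_cinner)

lemma positive_op_selfadjoint:
  assumes "selfadjoint X"
  shows "positive_op X \<longleftrightarrow> (\<forall>x. 0 \<le> inner (X x) x)"
proof -
  have "cnj (cinner (X x) x) = cinner (X x) x" for x
    by (metis assms cinner_commute selfadjoint_cinner)
  then have "Im (cinner (X x) x) = 0" for x
    using Reals_cnj_iff complex_is_Real_iff by blast
  then show ?thesis
    by (simp add: positive_op_def Re_cinner)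
qed

text \<open>Nonnegativity of the form at \<open>x - t *\<^sub>R X x\<close> is a quadratic
  inequality in \<open>t\<close>. Bounding norms by forms yields contractivity for the square root
  and, in \<open>pure_iff\<close>, strong convergence from weak.\<close>

lemma positive_norm_sq_le:
  assumes X: "selfadjoint X" and pos: "\<And>x. 0 \<le> inner (X x) x"
    and le: "\<And>x. inner (X x) x \<le> c * (norm x)\<^sup>2"
  shows "(norm (X x))\<^sup>2 \<le> c * inner (X x) x"
proof (cases "X x = 0")
  case False
  interpret bounded_linear X
    by (intro bounded_clinear_bounded_linear selfadjoint_bounded_clinear X)
  have *: "0 \<le> inner (X x) x - 2 * t * (norm (X x))\<^sup>2 + t * t * (c * (norm (X x))\<^sup>2)" for t
  proof -
    have "0 \<le> inner (X (x - t *\<^sub>R X x)) (x - t *\<^sub>R X x)"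
      by (rule pos)
    also have "\<dots> = inner (X x) x - 2 * t * (norm (X x))\<^sup>2 + t * t * inner (X (X x)) (X x)"
      by (simp add: diff scaleR power2_norm_eq_inner inner_diff_left inner_diff_right
          selfadjoint_inner[OF X, of "X x" x] algebra_simps)
    also have "\<dots> \<le> inner (X x) x - 2 * t * (norm (X x))\<^sup>2 + t * t * (c * (norm (X x))\<^sup>2)"
      by (intro add_left_mono mult_left_mono le) simp
    finally show ?thesis .
  qed
  have "0 \<le> c * (norm (X x))\<^sup>2"
    using pos[of "X x"] le[of "X x"] by linarith
  then have "c \<ge> 0"
    using False by (simp add: zero_le_mult_iff)
  \<comment> \<open>For \<open>c = 0\<close> the quadratic term vanishes, and \<open>t = 1\<close>
    already forces \<open>X x = 0\<close>.\<close>
  moreover have "c \<noteq> 0"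
  proof
    assume "c = 0"
    then have "inner (X x) x \<le> 0" "2 * (norm (X x))\<^sup>2 \<le> inner (X x) x"
      using *[of 1] le[of x] by simp_all
    then have "(norm (X x))\<^sup>2 \<le> 0"
      by linarith
    then show False
      using False by simp
  qed
  ultimately have "c > 0"
    by simp
  \<comment> \<open>The choice \<open>t = 1 / c\<close> minimizes the quadratic.\<close>
  then show ?thesis
    using *[of "1 / c"] by (simp add: field_simps)
qed (simp)

text \<open>
  The iteration \<open>Y \<mapsto> (A + Y\<^sup>2) / 2\<close> converges to a solution of \<open>(I - Y)\<^sup>2 = I - A\<close>; its
  increments are dominated by those of the same iteration for the scalar \<open>1\<close>.
\<close>

lemma sqrt_iteration:
  fixes A :: "'a::chilbert_space \<Rightarrow> 'a"
  assumes A: "selfadjoint A" and contr: "\<And>x. norm (A x) \<le> norm x"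
  shows "\<exists>Z. selfadjoint Z \<and> (\<forall>x. 2 *\<^sub>R Z x = A x + Z (Z x))"
proof -
  define Y where "Y = rec_nat (\<lambda>x. 0 :: 'a) (\<lambda>_ Z x. (1 / 2) *\<^sub>R (A x + Z (Z x)))"
  define y where "y = rec_nat (0 :: real) (\<lambda>_ z. (1 + z * z) / 2)"
  have Y_0: "Y 0 x = 0" and Y_Suc: "Y (Suc n) x = (1 / 2) *\<^sub>R (A x + Y n (Y n x))" for n x
    by (simp_all add: Y_def)
  have y_0: "y 0 = 0" and y_Suc: "y (Suc n) = (1 + y n * y n) / 2" for n
    by (simp_all add: y_def)
  have bcl: "bounded_clinear (Y n)" for n
  proof (induction n)
    case 0
    show ?case
      by (rule bounded_clinearI[where K = 0]) (auto simp: Y_0)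
  next
    case (Suc n)
    then show ?case
      unfolding Y_Suc
      by (intro bounded_clinear_scaleR bounded_clinear_add bounded_clinear_compose[OF Suc Suc]
          selfadjoint_bounded_clinear[OF A])
  qed
  note Y_diff = linear_diff[OF bounded_linear.linear[OF bounded_clinear_bounded_linear[OF bcl]]]
  have Y_sa: "cinner (Y n u) v = cinner u (Y n v)" for n u v
    by (induction n arbitrary: u v)
      (simp_all add: Y_0 Y_Suc cinner_scaleR_left cinner_scaleR_right cinner_add_left
        cinner_add_right selfadjoint_cinner[OF A])
  \<comment> \<open>\<open>Y n\<close> is a polynomial in \<open>A\<close>, so whatever commutes
    with \<open>A\<close> commutes with it; in particular the iterates commute with each
    other.\<close>
  have comm: "B (Y n u) = Y n (B u)" if B: "bounded_linear B" "\<And>u. B (A u) = A (B u)" for B n u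
    using linear_scale[OF bounded_linear.linear[OF B(1)]] linear_add[OF bounded_linear.linear[OF B(1)]]
      linear_0[OF bounded_linear.linear[OF B(1)]]
    by (induction n arbitrary: u) (simp_all add: Y_0 Y_Suc B(2))
  have comm_Y: "Y p (Y n u) = Y n (Y p u)" for p n u
  proof (rule comm[OF bounded_clinear_bounded_linear[OF bcl]])
    show "Y p (A u) = A (Y p u)" for u
      by (rule comm[symmetric, OF bounded_clinear_bounded_linear[OF selfadjoint_bounded_clinear[OF A]]]) simp
  qed
  have y_bounds: "0 \<le> y n \<and> y n \<le> 1" for n
    by (induction n) (auto simp: y_0 y_Suc mult_le_one)
  have y_mono: "y n \<le> y (Suc n)" for n
  proof -
    have "0 \<le> (1 - y n)\<^sup>2"
      by simp
    then show ?thesis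
      by (simp add: y_Suc power2_eq_square algebra_simps)
  qed
  have Y_norm: "norm (Y n u) \<le> y n * norm u" for n u
  proof (induction n arbitrary: u)
    case (Suc n)
    have "norm (Y n (Y n u)) \<le> y n * (y n * norm u)"
      by (rule order_trans[OF Suc mult_left_mono[OF Suc]]) (use y_bounds in simp)
    then have "norm (A u + Y n (Y n u)) \<le> norm u + y n * (y n * norm u)"
      using contr[of u] norm_triangle_ineq[of "A u" "Y n (Y n u)"] by linarith
    then show ?case
      unfolding Y_Suc y_Suc norm_scaleR by (simp add: distrib_right mult.assoc)
  qed (simp add: Y_0 y_0)
  have Y_incr: "norm (Y (Suc n) u - Y n u) \<le> (y (Suc n) - y n) * norm u" for n u
  proof (induction n arbitrary: u)
    case 0
    show ?case
      using contr[of u] by (simp add: Y_0 Y_Suc y_0 y_Suc)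
  next
    case (Suc n)
    let ?D = "\<lambda>u. Y (Suc n) u - Y n u"
    have "Y (Suc (Suc n)) u - Y (Suc n) u = (1 / 2) *\<^sub>R (Y (Suc n) (Y (Suc n) u) - Y n (Y n u))"
      unfolding Y_Suc[of "Suc n"] Y_Suc[of n u] by (simp add: algebra_simps)
    \<comment> \<open>Commuting iterates let the difference of squares factor through
      \<open>?D\<close>, so the induction hypothesis applies to both summands.\<close>
    also have "\<dots> = (1 / 2) *\<^sub>R (?D (Y (Suc n) u) + ?D (Y n u))"
      using comm_Y[of n "Suc n" u] by simp
    also have "norm \<dots> \<le> (1 / 2) * (norm (?D (Y (Suc n) u)) + norm (?D (Y n u)))"
      using norm_triangle_ineq by simp
    also have "\<dots> \<le> (1 / 2) * ((y (Suc n) - y n) * (y (Suc n) * norm u) + (y (Suc n) - y n) * (y n * norm u))"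
      using y_mono[of n]
      by (intro mult_left_mono add_mono order_trans[OF Suc] Y_norm) auto
    also have "\<dots> = ((1 + y (Suc n) * y (Suc n)) / 2 - (1 + y n * y n) / 2) * norm u"
      by (simp add: algebra_simps)
    also have "\<dots> = (y (Suc (Suc n)) - y (Suc n)) * norm u"
      by (simp only: y_Suc)
    finally show ?case .
  qed
  have "convergent y"
    using y_bounds incseqD[OF incseq_SucI[of y, OF y_mono]]
    by (intro Bseq_mono_convergent BseqI'[of _ 1]) auto
  then have summ: "summable (\<lambda>n. y (Suc n) - y n)"
    by (auto simp: convergent_def intro: telescope_summable)
  have "convergent (\<lambda>n. Y n u)" for u
  proof -
    have "summable (\<lambda>n. Y (Suc n) u - Y n u)"
      by (rule summable_comparison_test'[OF summable_mult2[OF summ, of "norm u"]]) (rule Y_incr)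
    then have "convergent (\<lambda>n. \<Sum>i<n. Y (Suc i) u - Y i u)"
      by (simp add: summable_iff_convergent)
    then show ?thesis
      by (simp add: sum_lessThan_telescope[of "\<lambda>i. Y i u"] Y_0)
  qed
  then obtain Z where Z: "\<And>u. (\<lambda>n. Y n u) \<longlonglongrightarrow> Z u"
    unfolding convergent_def by metis
  have Z_sa: "cinner (Z u) v = cinner u (Z v)" for u v
  proof (rule LIMSEQ_unique)
    show "(\<lambda>n. cinner (Y n u) v) \<longlonglongrightarrow> cinner (Z u) v"
      by (intro tendsto_intros Z)
    show "(\<lambda>n. cinner (Y n u) v) \<longlonglongrightarrow> cinner u (Z v)"
      unfolding Y_sa by (intro tendsto_intros Z)
  qed
  have "norm (Z u) \<le> 1 * norm u" for u
  proof (rule tendsto_upperbound[OF tendsto_norm[OF Z]])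
    have "norm (Y n u) \<le> 1 * norm u" for n
      by (rule order_trans[OF Y_norm mult_right_mono]) (use y_bounds in auto)
    then show "\<forall>\<^sub>F n in sequentially. norm (Y n u) \<le> 1 * norm u"
      by simp
  qed simp
  then have "bounded_clinear Z"
    by (intro bounded_clinearI[where K = 1] cinner_extI)
      (simp_all add: Z_sa cinner_add_left cinner_scaleC_left)
  moreover have "2 *\<^sub>R Z u = A u + Z (Z u)" for u
  proof -
    \<comment> \<open>The uniform contractivity of \<open>Y n\<close> is what passes the pointwise
      limit through the square.\<close>
    have "(\<lambda>n. Y n (Y n u - Z u)) \<longlonglongrightarrow> 0"
    proof (rule Lim_null_comparison)
      have "norm (Y n (Y n u - Z u)) \<le> 1 * norm (Y n u - Z u)" for n
        by (rule order_trans[OF Y_norm mult_right_mono]) (use y_bounds in auto)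
      then show "\<forall>\<^sub>F n in sequentially. norm (Y n (Y n u - Z u)) \<le> norm (Y n u - Z u)"
        by simp
      show "(\<lambda>n. norm (Y n u - Z u)) \<longlonglongrightarrow> 0"
        using Z[of u] tendsto_norm_zero LIM_zero by blast
    qed
    from tendsto_add[OF this Z[of "Z u"]] have "(\<lambda>n. Y n (Y n u)) \<longlonglongrightarrow> Z (Z u)"
      by (simp add: Y_diff)
    then have "(\<lambda>n. Y (Suc n) u) \<longlonglongrightarrow> (1 / 2) *\<^sub>R (A u + Z (Z u))"
      unfolding Y_Suc by (intro tendsto_intros)
    from LIMSEQ_unique[OF this LIMSEQ_Suc[OF Z[of u]]] show ?thesis
      by (metis (no_types) mult_numeral_1_right nonzero_mult_div_cancel_left pth_1 scaleR_half_double
          scaleR_scaleR times_divide_eq_right zero_neq_numeral)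
  qed
  ultimately show ?thesis
    using Z_sa by (intro exI[of _ Z]) (simp add: selfadjoint_def)
qed

text \<open>Rescaling by a norm bound \<open>c\<close> gives A = I - D/c between 0 and I. A solution
  of 2Z = A + ZZ satisfies (I - Z)(I - Z) = I - A = D/c, so \<open>sqrt c\<close> times I - Z is a
  root of D.\<close>

lemma positive_sqrt_exists:
  fixes D :: "'a::chilbert_space \<Rightarrow> 'a"
  assumes D: "selfadjoint D" and pos: "\<And>x. 0 \<le> inner (D x) x"
  shows "\<exists>R. selfadjoint R \<and> (\<forall>x. R (R x) = D x)"
proof -
  interpret D: bounded_linear D
    by (intro bounded_clinear_bounded_linear selfadjoint_bounded_clinear D)
  obtain c where "c > 0" and c: "\<And>x. norm (D x) \<le> norm x * c"
    using D.pos_bounded by blast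
  define A where "A x = x - (1 / c) *\<^sub>R D x" for x
  have A: "selfadjoint A"
    unfolding A_def selfadjoint_def
    using bounded_clinear_diff[OF bounded_clinear_id bounded_clinear_scaleR[OF selfadjoint_bounded_clinear[OF D]]]
    by (auto simp: cinner_diff_left cinner_diff_right cinner_scaleR_left cinner_scaleR_right
        selfadjoint_cinner[OF D])
  have "inner (D x) x \<le> c * (norm x)\<^sup>2" for x
    using norm_cauchy_schwarz[of "D x" x] mult_right_mono[OF c[of x], of "norm x"]
    by (simp add: power2_eq_square mult_ac)
  then have inner_A: "0 \<le> inner (A x) x" "inner (A x) x \<le> 1 * (norm x)\<^sup>2" for x
    using pos[of x] \<open>c > 0\<close> by (simp_all add: A_def inner_diff_left power2_norm_eq_inner field_simps)
  have "norm (A x) \<le> norm x" for x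
    by (rule power2_le_imp_le[OF order_trans[OF positive_norm_sq_le[OF A inner_A(1) inner_A(2)]]])
      (use inner_A(2)[of x] in auto)
  then obtain Z where Z: "selfadjoint Z" "\<And>x. 2 *\<^sub>R Z x = A x + Z (Z x)"
    using sqrt_iteration[OF A] by blast
  interpret Z: bounded_linear Z
    by (intro bounded_clinear_bounded_linear selfadjoint_bounded_clinear Z)
  define R where "R x = sqrt c *\<^sub>R (x - Z x)" for x
  have "selfadjoint R"
    unfolding R_def selfadjoint_def
    using bounded_clinear_scaleR[OF bounded_clinear_diff[OF bounded_clinear_id selfadjoint_bounded_clinear[OF Z(1)]]]
    by (auto simp: cinner_diff_left cinner_diff_right cinner_scaleR_left cinner_scaleR_right
        selfadjoint_cinner[OF Z(1)])
  moreover have "R (R x) = D x" for x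
  proof -
    have "R (R x) = c *\<^sub>R (x - 2 *\<^sub>R Z x + Z (Z x))"
      using \<open>c > 0\<close> by (simp add: R_def Z.diff Z.scaleR algebra_simps scaleR_2)
    also have "\<dots> = D x"
      using \<open>c > 0\<close> by (simp add: Z(2) A_def)
    finally show ?thesis .
  qed
  ultimately show ?thesis
    by blast
qed

subsection \<open>Hilbert dimension of ranges\<close>

lemma csubspace_closure:
  fixes V :: "'a::complex_inner set"
  assumes V: "csubspace V"
  shows "csubspace (closure V)"
  unfolding complex_vector.subspace_def
proof (intro conjI ballI allI)
  show "0 \<in> closure V"
    using closure_subset complex_vector.subspace_0[OF V] by blast
  fix x assume "x \<in> closure V"
  then obtain f where f: "\<And>n. f n \<in> V" "f \<longlonglongrightarrow> x"
    by (auto simp: closure_sequential)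
  show "c *\<^sub>C x \<in> closure V" for c
    unfolding closure_sequential
    by (intro exI[of _ "\<lambda>n. c *\<^sub>C f n"] conjI allI complex_vector.subspace_scale V f tendsto_intros)
  fix y assume "y \<in> closure V"
  then obtain g where g: "\<And>n. g n \<in> V" "g \<longlonglongrightarrow> y"
    by (auto simp: closure_sequential)
  show "x + y \<in> closure V"
    unfolding closure_sequential
    by (intro exI[of _ "\<lambda>n. f n + g n"] conjI allI complex_vector.subspace_add V f g tendsto_intros)
qed

lemma csubspace_range: "clinear A \<Longrightarrow> csubspace (range A)"
  unfolding Vector_Spaces.linear_iff complex_vector.subspace_def
  by (safe; metis complex_vector.scale_zero_left rangeI)

lemma closure_cspan_subset:
  fixes B :: "'a::complex_inner set"
  assumes "csubspace V" "B \<subseteq> closure V"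
  shows "closure (cspan B) \<subseteq> closure V"
  by (intro closure_minimal complex_vector.span_minimal assms csubspace_closure closed_closure)

text \<open>
  The isometry \<open>R x \<mapsto> A x\<close> of the polar decomposition carries an orthonormal basis of the closed
  range of \<open>R\<close> to one of the closed range of \<open>A\<close>.
\<close>

lemma has_hilbert_dim_range_isometric:
  fixes A :: "'a::complex_inner \<Rightarrow> 'b::chilbert_space" and R :: "'a \<Rightarrow> 'c::chilbert_space"
  assumes A: "clinear A" and R: "clinear R" and norm: "\<And>x. norm (A x) = norm (R x)"
    and dim: "has_hilbert_dim (range R) m"
  shows "has_hilbert_dim (range A) m"
proof -
  interpret A: Vector_Spaces.linear scaleC scaleC A by fact
  interpret R: Vector_Spaces.linear scaleC scaleC R by fact
  \<comment> \<open>The graph of the closure of \<open>R x \<mapsto> A x\<close>. As a relation it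
    can be used before it is known to be single-valued, and \<open>\<Gamma>_cinner\<close> shows
    that it preserves inner products.\<close>
  define \<Gamma> where "\<Gamma> y z \<longleftrightarrow> (\<exists>u. (\<lambda>n. R (u n)) \<longlonglongrightarrow> y \<and> (\<lambda>n. A (u n)) \<longlonglongrightarrow> z)" for y z
  have \<Gamma>_cinner: "cinner z z' = cinner y y'" if yz: "\<Gamma> y z" "\<Gamma> y' z'" for y z y' z'
  proof -
    obtain u v where lim: "(\<lambda>n. R (u n)) \<longlonglongrightarrow> y" "(\<lambda>n. A (u n)) \<longlonglongrightarrow> z"
      "(\<lambda>n. R (v n)) \<longlonglongrightarrow> y'" "(\<lambda>n. A (v n)) \<longlonglongrightarrow> z'"
      using yz unfolding \<Gamma>_def by blast
    have "(\<lambda>n. cinner (A (u n)) (A (v n))) \<longlonglongrightarrow> cinner z z'"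
      by (intro tendsto_intros lim)
    moreover have "(\<lambda>n. cinner (A (u n)) (A (v n))) \<longlonglongrightarrow> cinner y y'"
      unfolding isometric_cinner[OF A R norm] by (intro tendsto_intros lim)
    ultimately show ?thesis
      by (rule LIMSEQ_unique)
  qed
  have \<Gamma>_add: "\<Gamma> (y + y') (z + z')" if yz: "\<Gamma> y z" "\<Gamma> y' z'" for y z y' z'
  proof -
    obtain u v where lim: "(\<lambda>n. R (u n)) \<longlonglongrightarrow> y" "(\<lambda>n. A (u n)) \<longlonglongrightarrow> z"
      "(\<lambda>n. R (v n)) \<longlonglongrightarrow> y'" "(\<lambda>n. A (v n)) \<longlonglongrightarrow> z'"
      using yz unfolding \<Gamma>_def by blast
    show ?thesis
      unfolding \<Gamma>_def
      by (rule exI[of _ "\<lambda>n. u n + v n"]) (simp add: A.add R.add tendsto_add[OF lim(1) lim(3)] tendsto_add[OF lim(2) lim(4)])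
  qed
  have \<Gamma>_scale: "\<Gamma> (c *\<^sub>C y) (c *\<^sub>C z)" if yz: "\<Gamma> y z" for c y z
  proof -
    obtain u where lim: "(\<lambda>n. R (u n)) \<longlonglongrightarrow> y" "(\<lambda>n. A (u n)) \<longlonglongrightarrow> z"
      using yz unfolding \<Gamma>_def by blast
    show ?thesis
      unfolding \<Gamma>_def
      by (rule exI[of _ "\<lambda>n. c *\<^sub>C u n"]) (simp add: A.scale R.scale tendsto_scaleC[OF lim(1)] tendsto_scaleC[OF lim(2)])
  qed
  have \<Gamma>_range: "\<Gamma> (R x) (A x)" for x
    unfolding \<Gamma>_def by (rule exI[of _ "\<lambda>_. x"]) simp
  obtain B e where B: "orthonormal B" "closure (cspan B) = closure (range R)"
    and e: "bij_betw e {j. enat j < m} B"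
    using dim unfolding has_hilbert_dim_def by blast
  \<comment> \<open>The isometry carries a Cauchy sequence in the range of \<open>R\<close> to one
    in the range of \<open>A\<close>; completeness of the target supplies the partner of
    \<open>b\<close>.\<close>
  have "\<exists>z. \<Gamma> b z" if "b \<in> B" for b
  proof -
    have "b \<in> closure (range R)"
      using that B(2) closure_subset complex_vector.span_base by blast
    then obtain f where range: "\<forall>n. f n \<in> range R" and f: "f \<longlonglongrightarrow> b"
      unfolding closure_sequential by blast
    from range have "\<forall>n. \<exists>x. f n = R x"
      by blast
    then obtain u where u: "\<And>n. f n = R (u n)"
      by metis
    have "dist (A (u p)) (A (u q)) = dist (f p) (f q)" for p q
      by (simp add: dist_norm u norm flip: A.diff R.diff)
    moreover have "Cauchy f"
      using f by (rule LIMSEQ_imp_Cauchy)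
    ultimately have "Cauchy (\<lambda>n. A (u n))"
      by (simp add: Cauchy_def)
    then obtain z where "(\<lambda>n. A (u n)) \<longlonglongrightarrow> z"
      using Cauchy_convergent convergent_def by blast
    moreover have "f = (\<lambda>n. R (u n))"
      using u by blast
    ultimately show ?thesis
      using f unfolding \<Gamma>_def by blast
  qed
  then obtain c where c: "\<And>b. b \<in> B \<Longrightarrow> \<Gamma> b (c b)"
    by metis
  have cinner_c: "cinner (c b) (c b') = (if b = b' then 1 else 0)" if "b \<in> B" "b' \<in> B" for b b'
    using \<Gamma>_cinner[OF c c, OF that] B(1) that by (simp add: orthonormal_def)
  then have inj: "inj_on c B"
    by (metis inj_onI one_neq_zero)
  have "orthonormal (c ` B)"
    using cinner_c inj by (auto simp: orthonormal_def inj_on_eq_iff)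
  moreover have "bij_betw (c \<circ> e) {j. enat j < m} (c ` B)"
    by (rule bij_betw_trans[OF e inj_on_imp_bij_betw[OF inj]])
  moreover have "closure (cspan (c ` B)) = closure (range A)"
  proof
    have \<Gamma>_closure: "z \<in> closure (range A)" if yz: "\<Gamma> y z" for y z
    proof -
      obtain u where "(\<lambda>n. A (u n)) \<longlonglongrightarrow> z"
        using yz unfolding \<Gamma>_def by blast
      then show ?thesis
        unfolding closure_sequential by (intro exI[of _ "\<lambda>n. A (u n)"]) simp
    qed
    have "c ` B \<subseteq> closure (range A)"
      by (rule image_subsetI) (rule \<Gamma>_closure[OF c])
    then show "closure (cspan (c ` B)) \<subseteq> closure (range A)"
      by (rule closure_cspan_subset[OF csubspace_range[OF A]])
    \<comment> \<open>A finite combination of \<open>B\<close> close to \<open>R x\<close> is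
      carried by \<open>\<Gamma>\<close> to a finite combination of the vectors \<open>c b\<close>
      that is equally close to \<open>A x\<close>.\<close>
    have "A x \<in> closure (cspan (c ` B))" for x
      unfolding closure_approachable
    proof (intro allI impI)
      fix r :: real assume "0 < r"
      have "R x \<in> closure (cspan B)"
        unfolding B(2) by (rule subsetD[OF closure_subset rangeI])
      then obtain y where y: "y \<in> cspan B" "dist y (R x) < r"
        using \<open>0 < r\<close> by (auto simp: closure_approachable)
      from y(1) have "\<exists>z\<in>cspan (c ` B). \<Gamma> y z"
      proof (induction rule: complex_vector.span_induct_alt)
        case base
        show ?case
          using \<Gamma>_range[of 0] by (auto simp: R.zero A.zero intro!: bexI[of _ 0] complex_vector.span_zero)
      next
        case (step d b y)
        then obtain z where "z \<in> cspan (c ` B)" "\<Gamma> y z"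
          by blast
        with step(1) have "\<Gamma> (d *\<^sub>C b + y) (d *\<^sub>C c b + z)"
          by (intro \<Gamma>_add \<Gamma>_scale c)
        moreover have "d *\<^sub>C c b + z \<in> cspan (c ` B)"
          by (intro complex_vector.span_add complex_vector.span_scale \<open>z \<in> _\<close>
              complex_vector.span_base imageI step(1))
        ultimately show ?case
          by blast
      qed
      then obtain z where z: "z \<in> cspan (c ` B)" "\<Gamma> y z"
        by blast
      have "\<Gamma> (y + (- 1) *\<^sub>C R x) (z + (- 1) *\<^sub>C A x)"
        by (intro \<Gamma>_add \<Gamma>_scale \<Gamma>_range z)
      then have "\<Gamma> (y - R x) (z - A x)"
        by simp
      from \<Gamma>_cinner[OF this this] have "norm (z - A x) = norm (y - R x)"
        by (simp only: cinner_self of_real_eq_iff power2_eq_iff_nonneg norm_ge_zero)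
      then show "\<exists>z\<in>cspan (c ` B). dist z (A x) < r"
        using y(2) by (intro bexI[OF _ z(1)]) (simp add: dist_norm)
    qed
    then show "closure (range A) \<subseteq> closure (cspan (c ` B))"
      by (intro closure_minimal closed_closure) blast
  qed
  ultimately show ?thesis
    unfolding has_hilbert_dim_def by blast
qed

text \<open>If \<open>y\<close> is orthogonal to the range of the square, then
  \<open>cinner y (R (R y)) = 0\<close> says that \<open>R y = 0\<close>, so \<open>y\<close> is
  orthogonal to the range of \<open>R\<close> as well.\<close>

lemma closure_range_square:
  fixes R :: "'a::chilbert_space \<Rightarrow> 'a"
  assumes R: "selfadjoint R"
  shows "closure (range (\<lambda>x. R (R x))) = closure (range R)"
proof
  let ?M = "closure (range (\<lambda>x. R (R x)))"
  have "bounded_clinear (\<lambda>x. R (R x))"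
    using R by (intro bounded_clinear_compose[of R R] selfadjoint_bounded_clinear)
  then have M: "csubspace ?M" "closed ?M"
    by (auto intro!: csubspace_closure csubspace_range simp: bounded_clinear_def)
  have "R x \<in> ?M" for x
  proof (rule orthogonal_complement_trivial[OF M])
    fix y assume y: "\<And>z. z \<in> ?M \<Longrightarrow> cinner y z = 0"
    have "cinner y (R (R y)) = 0"
      by (rule y[OF subsetD[OF closure_subset]]) blast
    then have "R y = 0"
      by (simp add: cinner_self flip: selfadjoint_cinner[OF R])
    then show "cinner y (R x) = 0"
      by (simp flip: selfadjoint_cinner[OF R])
  qed
  then show "closure (range R) \<subseteq> ?M"
    by (intro closure_minimal closed_closure) blast
qed (auto intro!: closure_mono)

text \<open>The square root \<open>R\<close> of \<open>D\<close> satisfies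
  \<open>norm (R x) = norm (A x)\<close>, and the ranges of \<open>D\<close> and \<open>R\<close>
  have the same closure. This turns the rank of the defect operator into the dimension of the vacuum
  part of \<open>M\<close>.\<close>

lemma has_rank_iff_isometric:
  fixes D :: "'a::chilbert_space \<Rightarrow> 'a" and A :: "'a \<Rightarrow> 'b::chilbert_space"
  assumes D: "selfadjoint D" and A: "clinear A" and eq: "\<And>x. inner (D x) x = (norm (A x))\<^sup>2"
  shows "has_rank D m \<longleftrightarrow> has_hilbert_dim (range A) m"
proof -
  have "0 \<le> inner (D x) x" for x
    by (simp add: eq)
  then obtain R where R: "selfadjoint R" "\<And>x. R (R x) = D x"
    using positive_sqrt_exists[OF D] by blast
  have D_eq: "D = (\<lambda>x. R (R x))"
    using R by auto
  have "(norm (R x))\<^sup>2 = (norm (A x))\<^sup>2" for x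
  proof -
    have "(norm (R x))\<^sup>2 = inner (D x) x"
      by (simp only: D_eq selfadjoint_inner[OF R(1)] power2_norm_eq_inner)
    then show ?thesis
      by (simp only: eq)
  qed
  then have norm: "norm (R x) = norm (A x)" for x
    by simp
  have "clinear R"
    using selfadjoint_bounded_clinear[OF R(1)] by (simp add: bounded_clinear_def)
  then have "has_hilbert_dim (range R) m \<longleftrightarrow> has_hilbert_dim (range A) m"
    using has_hilbert_dim_range_isometric[OF A _ norm[symmetric]]
      has_hilbert_dim_range_isometric[OF _ A norm] by blast
  then show ?thesis
    using closure_range_square[OF R(1)] by (simp add: D_eq has_rank_def has_hilbert_dim_def)
qed

subsection \<open>Quadratic forms of completely positive maps\<close>

text \<open>The effect of \<open>X \<mapsto> \<Sum>s. r\<^sup>2 A\<^sub>s X A\<^sub>s\<^sup>*\<close> on quadratic forms, where \<open>B s\<close> is the adjoint of \<open>A\<^sub>s\<close>.\<close>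

definition form_map :: "real \<Rightarrow> nat \<Rightarrow> (nat \<Rightarrow> 'h \<Rightarrow> 'h) \<Rightarrow> ('h \<Rightarrow> real) \<Rightarrow> 'h \<Rightarrow> real"
  where "form_map r N B p = (\<lambda>x. \<Sum>s=1..N. r\<^sup>2 * p (B s x))"

lemma cp_map_form:
  assumes A: "\<And>s. s \<in> {1..N} \<Longrightarrow> bounded_clinear (A s)"
  shows "inner (cp_map r N A X x) x = form_map r N (\<lambda>s. cadjoint (A s)) (\<lambda>y. inner (X y) y) x"
proof -
  have "inner (A s z) x = inner z (cadjoint (A s) x)" if "s \<in> {1..N}" for s z
    using cinner_cadjoint_right[OF A[OF that], of z x] by (simp flip: Re_cinner)
  then show ?thesis
    by (simp add: cp_map_def form_map_def inner_sum_left)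
qed

lemma selfadjoint_cp_map:
  assumes A: "\<And>s. s \<in> {1..N} \<Longrightarrow> bounded_clinear (A s)" and X: "selfadjoint X"
  shows "selfadjoint (cp_map r N A X)"
  unfolding selfadjoint_def
proof (intro conjI allI)
  have "bounded_clinear (\<lambda>x. A s (X (cadjoint (A s) x)))" if "s \<in> {1..N}" for s
    by (rule bounded_clinear_compose[OF A[OF that] bounded_clinear_compose[OF
          selfadjoint_bounded_clinear[OF X] bounded_clinear_cadjoint[OF A[OF that]]]])
  then show "bounded_clinear (cp_map r N A X)"
    unfolding cp_map_def by (intro bounded_clinear_sum bounded_clinear_scaleR) auto
  have "cinner (A s (X (cadjoint (A s) x))) y = cinner x (A s (X (cadjoint (A s) y)))"
    if "s \<in> {1..N}" for s x y
    by (simp add: cinner_cadjoint_right[OF A[OF that], symmetric] cinner_cadjoint_left[OF A[OF that], symmetric]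
        selfadjoint_cinner[OF X])
  then show "cinner (cp_map r N A X x) y = cinner x (cp_map r N A X y)" for x y
    by (simp add: cp_map_def cinner_sum_left cinner_sum_right cinner_scaleR_left cinner_scaleR_right)
qed

lemma selfadjoint_id: "selfadjoint id"
  by (simp add: selfadjoint_def bounded_clinear_id)

lemma selfadjoint_diff: "selfadjoint X \<Longrightarrow> selfadjoint Y \<Longrightarrow> selfadjoint (\<lambda>x. X x - Y x)"
  by (simp add: selfadjoint_def bounded_clinear_diff cinner_diff_left cinner_diff_right)

text \<open>Both folds peel off the same outermost factor, so induction over arbitrary lists matches
  them. From here on the defect operator enters through its form and its selfadjointness.\<close>

lemma
  assumes T: "\<And>i s. i \<in> {1..k} \<Longrightarrow> s \<in> {1..n i} \<Longrightarrow> bounded_clinear (T i s)"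
  shows selfadjoint_defect: "selfadjoint (defect r k n T)"
    and defect_form: "inner (defect r k n T x) x =
      foldr (\<lambda>i p x. p x - form_map r (n i) (\<lambda>s. cadjoint (T i s)) p x) [1..<Suc k] (\<lambda>x. (norm x)\<^sup>2) x"
proof -
  let ?X = "\<lambda>js. foldr (\<lambda>i X x. X x - cp_map r (n i) (T i) X x) js id"
  let ?p = "\<lambda>js. foldr (\<lambda>i p x. p x - form_map r (n i) (\<lambda>s. cadjoint (T i s)) p x) js (\<lambda>x. (norm x)\<^sup>2)"
  have "selfadjoint (?X js) \<and> (\<lambda>x. inner (?X js x) x) = ?p js" if "set js \<subseteq> {1..k}" for js
    using that
  proof (induction js)
    case Nil
    show ?case
      by (simp add: selfadjoint_id[unfolded id_def] power2_norm_eq_inner)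
  next
    case (Cons i js)
    have "set js \<subseteq> {1..k}" and T': "\<And>s. s \<in> {1..n i} \<Longrightarrow> bounded_clinear (T i s)"
      using T Cons.prems by auto
    note IH = conjunct1[OF Cons.IH[OF this(1)]] conjunct2[OF Cons.IH[OF this(1)]]
    have "selfadjoint (cp_map r (n i) (T i) (?X js))"
      by (rule selfadjoint_cp_map[OF T' IH(1)])
    with IH(1) have "selfadjoint (?X (i # js))"
      unfolding foldr.simps o_apply by (rule selfadjoint_diff)
    moreover have "(\<lambda>x. inner (?X (i # js) x) x) = ?p (i # js)"
      by (simp only: foldr.simps o_apply inner_diff_left cp_map_form[where A = "T i", OF T'] IH(2)[symmetric])
    ultimately show ?case
      by (rule conjI)
  qed
  moreover have "set [1..<Suc k] \<subseteq> {1..k}"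
    by auto
  ultimately have *: "selfadjoint (defect r k n T) \<and> (\<lambda>x. inner (defect r k n T x) x) = ?p [1..<Suc k]"
    unfolding defect_def by blast
  show "selfadjoint (defect r k n T)"
    using * by (rule conjunct1)
  show "inner (defect r k n T x) x = ?p [1..<Suc k] x"
    by (rule fun_cong[OF conjunct2[OF *]])
qed

lemma
  assumes A: "\<And>s. s \<in> {1..N} \<Longrightarrow> bounded_clinear (A s)"
  shows selfadjoint_cp_map_funpow: "selfadjoint ((cp_map r N A ^^ q) id)"
    and cp_map_funpow_form: "inner ((cp_map r N A ^^ q) id x) x =
      (form_map r N (\<lambda>s. cadjoint (A s)) ^^ q) (\<lambda>x. (norm x)\<^sup>2) x"
proof -
  have "selfadjoint ((cp_map r N A ^^ q) id) \<and> (\<lambda>x. inner ((cp_map r N A ^^ q) id x) x) =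
      (form_map r N (\<lambda>s. cadjoint (A s)) ^^ q) (\<lambda>x. (norm x)\<^sup>2)"
  proof (induction q)
    case 0
    show ?case
      by (simp add: selfadjoint_id[unfolded id_def] power2_norm_eq_inner)
  next
    case (Suc q)
    have "selfadjoint ((cp_map r N A ^^ Suc q) id)"
      unfolding funpow.simps o_apply by (rule selfadjoint_cp_map[OF A conjunct1[OF Suc]])
    moreover have "(\<lambda>x. inner ((cp_map r N A ^^ Suc q) id x) x) =
        (form_map r N (\<lambda>s. cadjoint (A s)) ^^ Suc q) (\<lambda>x. (norm x)\<^sup>2)"
      by (simp only: funpow.simps o_apply cp_map_form[where A = A, OF A] conjunct2[OF Suc, symmetric])
    ultimately show ?case
      by (rule conjI)
  qed
  note * = this
  show "selfadjoint ((cp_map r N A ^^ q) id)"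
    using * by (rule conjunct1)
  show "inner ((cp_map r N A ^^ q) id x) x = (form_map r N (\<lambda>s. cadjoint (A s)) ^^ q) (\<lambda>x. (norm x)\<^sup>2) x"
    by (rule fun_cong[OF conjunct2[OF *]])
qed

lemma form_map_diff: "form_map r N B (\<lambda>x. p x - q x) = (\<lambda>x. form_map r N B p x - form_map r N B q x)"
  by (simp add: form_map_def sum_subtractf right_diff_distrib)

lemma form_map_sum: "form_map r N B (\<lambda>x. \<Sum>a\<in>S. p a x) = (\<lambda>x. \<Sum>a\<in>S. form_map r N B (p a) x)"
  unfolding form_map_def by (subst sum.swap) (simp add: sum_distrib_left)

lemma form_map_mono: "(\<And>x. p x \<le> q x) \<Longrightarrow> form_map r N B p x \<le> form_map r N B q x"
  unfolding form_map_def by (intro sum_mono mult_left_mono) auto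

lemma form_map_funpow_diff:
  "(form_map r N B ^^ Q) (\<lambda>x. p x - q x) = (\<lambda>x. (form_map r N B ^^ Q) p x - (form_map r N B ^^ Q) q x)"
  by (induction Q) (simp_all add: form_map_diff)

lemma form_map_funpow_cmult: "(form_map r N B ^^ Q) (\<lambda>x. c * p x) = (\<lambda>x. c * (form_map r N B ^^ Q) p x)"
  by (induction Q) (simp_all add: form_map_def sum_distrib_left mult_ac)

lemma form_map_funpow_mono:
  "(\<And>x. p x \<le> q x) \<Longrightarrow> (form_map r N B ^^ Q) p x \<le> (form_map r N B ^^ Q) q x"
  by (induction Q arbitrary: x) (simp_all add: form_map_mono)

text \<open>\<open>fold\<close> applies the first letter first, so with \<open>B s\<close> the
  adjoint of \<open>A s\<close>, the operator \<open>fold B w\<close> is the adjoint of the product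
  of the \<open>A s\<close> in the order of the word \<open>w\<close>.\<close>

lemma form_map_funpow_words:
  "(form_map 1 N B ^^ q) p x = (\<Sum>w | set w \<subseteq> {1..N} \<and> length w = q. p (fold B w x))"
proof (induction q arbitrary: x)
  case 0
  have "{w. set w \<subseteq> {1..N} \<and> length w = 0} = {[]}"
    by auto
  then show ?case
    by simp
next
  case (Suc q)
  let ?W = "{w. set w \<subseteq> {1..N} \<and> length w = q}"
  have W: "{w. set w \<subseteq> {1..N} \<and> length w = Suc q} = (\<lambda>(s, w). s # w) ` ({1..N} \<times> ?W)"
    by (auto simp: length_Suc_conv image_iff)
  have "(form_map 1 N B ^^ Suc q) p x = (\<Sum>s=1..N. \<Sum>w\<in>?W. p (fold B w (B s x)))"
    by (simp add: form_map_def Suc)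
  also have "\<dots> = (\<Sum>(s, w)\<in>{1..N} \<times> ?W. p (fold B w (B s x)))"
    by (rule sum.cartesian_product)
  also have "\<dots> = (\<Sum>w\<in>(\<lambda>(s, w). s # w) ` ({1..N} \<times> ?W). p (fold B w x))"
    by (subst sum.reindex) (auto simp: inj_on_def intro!: sum.cong)
  finally show ?case
    by (simp only: W)
qed

subsection \<open>Telescoping\<close>

text \<open>The truncated Neumann series of \<open>p \<mapsto> p - form_map 1 N B p\<close>, which
  it inverts up to the remainder given by the \<open>Q\<close>-th power.\<close>

definition geometric_form :: "nat \<Rightarrow> nat \<Rightarrow> (nat \<Rightarrow> 'h \<Rightarrow> 'h) \<Rightarrow> ('h \<Rightarrow> real) \<Rightarrow> 'h \<Rightarrow> real"
  where "geometric_form Q N B p = (\<lambda>x. \<Sum>q<Q. (form_map 1 N B ^^ q) p x)"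

lemma geometric_form_words:
  "geometric_form Q N B p x = (\<Sum>w | set w \<subseteq> {1..N} \<and> length w < Q. p (fold B w x))"
proof -
  have "{w. set w \<subseteq> {1..N} \<and> length w < Q} = (\<Union>q<Q. {w. set w \<subseteq> {1..N} \<and> length w = q})"
    by auto
  then show ?thesis
    unfolding geometric_form_def form_map_funpow_words
    by (subst sum.UNION_disjoint[symmetric]) (auto simp: finite_lists_length_eq)
qed

lemma finite_words_less: "finite {w. set w \<subseteq> {1..N::nat} \<and> length w < Q}"
  by (rule finite_subset[OF _ finite_lists_length_le[of "{1..N}" Q]]) auto

lemma geometric_form_telescope:
  "geometric_form Q N B (\<lambda>x. p x - form_map 1 N B p x) = (\<lambda>x. p x - (form_map 1 N B ^^ Q) p x)"
proof
  fix x
  have "geometric_form Q N B (\<lambda>x. p x - form_map 1 N B p x) x =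
      (\<Sum>q<Q. (form_map 1 N B ^^ q) p x - (form_map 1 N B ^^ Suc q) p x)"
    by (simp add: geometric_form_def form_map_funpow_diff funpow_swap1)
  also have "\<dots> = p x - (form_map 1 N B ^^ Q) p x"
    by (subst sum_lessThan_telescope') simp
  finally show "geometric_form Q N B (\<lambda>x. p x - form_map 1 N B p x) x = p x - (form_map 1 N B ^^ Q) p x" .
qed

text \<open>Operators of different components commute only up to a unimodular constant. Forms with
  this invariance do not see the constant, and the forms built here from the squared norm all have
  it.\<close>

definition phase_invariant :: "('h::complex_inner \<Rightarrow> real) \<Rightarrow> bool"
  where "phase_invariant p \<longleftrightarrow> (\<forall>c x. cmod c = 1 \<longrightarrow> p (c *\<^sub>C x) = p x)"

locale commuting_tuple =
  fixes I :: "nat set" and N :: "nat \<Rightarrow> nat" and B :: "nat \<Rightarrow> nat \<Rightarrow> 'h::complex_inner \<Rightarrow> 'h"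
  assumes B_scaleC: "\<And>i s c x. i \<in> I \<Longrightarrow> s \<in> {1..N i} \<Longrightarrow> B i s (c *\<^sub>C x) = c *\<^sub>C B i s x"
    and B_commute: "\<And>i j s t. \<lbrakk>i \<in> I; j \<in> I; i \<noteq> j; s \<in> {1..N i}; t \<in> {1..N j}\<rbrakk>
      \<Longrightarrow> \<exists>c. cmod c = 1 \<and> (\<forall>x. B i s (B j t x) = c *\<^sub>C B j t (B i s x))"
begin

abbreviation (input) "F i \<equiv> form_map 1 (N i) (B i)"
abbreviation (input) "G Q i \<equiv> geometric_form Q (N i) (B i)"
abbreviation (input) "D i p \<equiv> (\<lambda>x. p x - F i p x)"

lemma phase_invariant_F: "i \<in> I \<Longrightarrow> phase_invariant p \<Longrightarrow> phase_invariant (F i p)"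
  by (simp add: phase_invariant_def form_map_def B_scaleC)

lemma phase_invariant_F_funpow: "i \<in> I \<Longrightarrow> phase_invariant p \<Longrightarrow> phase_invariant ((F i ^^ q) p)"
  by (induction q) (simp_all add: phase_invariant_F)

lemma phase_invariant_D: "i \<in> I \<Longrightarrow> phase_invariant p \<Longrightarrow> phase_invariant (D i p)"
  using phase_invariant_F[of i p] by (simp add: phase_invariant_def)

lemma phase_invariant_G: "i \<in> I \<Longrightarrow> phase_invariant p \<Longrightarrow> phase_invariant (G Q i p)"
  using phase_invariant_F_funpow[of i p] by (simp add: phase_invariant_def geometric_form_def)

lemma phase_invariant_foldr:
  assumes "\<And>i p. i \<in> I \<Longrightarrow> phase_invariant p \<Longrightarrow> phase_invariant (E i p)" "set js \<subseteq> I" "phase_invariant p"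
  shows "phase_invariant (foldr E js p)"
  using assms(2) by (induction js) (simp_all add: assms(1,3))

lemma F_commute:
  assumes i: "i \<in> I" and j: "j \<in> I" and "i \<noteq> j" and p: "phase_invariant p"
  shows "F i (F j p) = F j (F i p)"
proof
  fix x
  have "p (B j t (B i s x)) = p (B i s (B j t x))" if "s \<in> {1..N i}" "t \<in> {1..N j}" for s t
    using B_commute[OF i j \<open>i \<noteq> j\<close> that] p by (auto simp: phase_invariant_def)
  then show "F i (F j p) x = F j (F i p) x"
    unfolding form_map_def power_one mult_1 by (subst sum.swap) simp
qed

lemma F_funpow_commute:
  assumes "i \<in> I" "j \<in> I" "i \<noteq> j" "phase_invariant p"
  shows "(F j ^^ q) (F i p) = F i ((F j ^^ q) p)"
proof (induction q)
  case (Suc q)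
  then show ?case
    using F_commute[of j i "(F j ^^ q) p"] assms by (simp add: phase_invariant_F_funpow)
qed simp

lemma G_D_commute:
  assumes "i \<in> I" "j \<in> I" "i \<noteq> j" "phase_invariant p"
  shows "G Q j (D i p) = D i (G Q j p)"
  using F_funpow_commute[OF assms]
  by (simp add: geometric_form_def form_map_funpow_diff form_map_sum sum_subtractf)

lemma foldr_G_D_commute:
  assumes "i \<in> I" "i \<notin> set js" "set js \<subseteq> I" "phase_invariant p"
  shows "foldr (G Q) js (D i p) = D i (foldr (G Q) js p)"
  using assms(2,3)
proof (induction js)
  case (Cons j js)
  then have "foldr (G Q) (j # js) (D i p) = G Q j (D i (foldr (G Q) js p))"
    by simp
  also have "\<dots> = D i (G Q j (foldr (G Q) js p))"
    using Cons.prems assms by (intro G_D_commute phase_invariant_foldr phase_invariant_G) auto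
  finally show ?case
    by simp
qed simp

text \<open>Each difference \<open>D i\<close> is moved outwards past the sums of the other
  components until it meets its own \<open>G Q i\<close>, where
  \<open>geometric_form_telescope\<close> collapses the pair. Distinctness of the list licenses
  these exchanges.\<close>

lemma foldr_telescope:
  assumes "distinct js" "set js \<subseteq> I" "phase_invariant p"
  shows "foldr (G Q) js (foldr (\<lambda>i p. D i p) js p) = foldr (\<lambda>i p x. p x - (F i ^^ Q) p x) js p"
  using assms(1,2)
proof (induction js)
  case (Cons i js)
  have "phase_invariant (foldr (\<lambda>i p. D i p) js p)"
    using Cons.prems assms(3) by (intro phase_invariant_foldr phase_invariant_D) auto
  then have "foldr (G Q) (i # js) (foldr (\<lambda>i p. D i p) (i # js) p) =
      G Q i (D i (foldr (G Q) js (foldr (\<lambda>i p. D i p) js p)))"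
    using Cons.prems foldr_G_D_commute[of i js] by simp
  then show ?case
    using Cons by (simp add: geometric_form_telescope)
qed simp

lemma foldr_G_words:
  assumes "distinct js"
  shows "foldr (G Q) js p x =
    (\<Sum>\<alpha>\<in>(\<Pi>\<^sub>E i\<in>set js. {w. set w \<subseteq> {1..N i} \<and> length w < Q}). p (fold (\<lambda>i. fold (B i) (\<alpha> i)) js x))"
  using assms
proof (induction js arbitrary: x)
  case (Cons i js)
  let ?W = "\<lambda>i. {w. set w \<subseteq> {1..N i} \<and> length w < Q}"
  let ?P = "\<Pi>\<^sub>E i\<in>set js. ?W i"
  have inj: "inj_on (\<lambda>(w, \<alpha>). \<alpha>(i := w)) (?W i \<times> ?P)"
    using inj_combinator[of i "set js" ?W] Cons.prems by simp
  \<comment> \<open>Updating component \<open>i\<close> is invisible to the fold over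
    \<open>js\<close>, which by distinctness does not contain \<open>i\<close>.\<close>
  have "fold (\<lambda>j. fold (B j) ((\<alpha>(i := w)) j)) js y = fold (\<lambda>j. fold (B j) (\<alpha> j)) js y" for \<alpha> w y
    by (rule fold_cong) (use Cons.prems in auto)
  then have "(\<Sum>\<alpha>\<in>(\<Pi>\<^sub>E i\<in>set (i # js). ?W i). p (fold (\<lambda>i. fold (B i) (\<alpha> i)) (i # js) x)) =
      (\<Sum>(w, \<alpha>)\<in>?W i \<times> ?P. p (fold (\<lambda>i. fold (B i) (\<alpha> i)) js (fold (B i) w x)))"
    unfolding list.set PiE_insert_eq by (subst sum.reindex[OF inj]) (auto intro!: sum.cong)
  also have "\<dots> = (\<Sum>w\<in>?W i. \<Sum>\<alpha>\<in>?P. p (fold (\<lambda>i. fold (B i) (\<alpha> i)) js (fold (B i) w x)))"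
    by (rule sum.cartesian_product[symmetric])
  also have "\<dots> = foldr (G Q) (i # js) p x"
    using Cons.prems by (simp only: foldr.simps o_apply geometric_form_words Cons.IH distinct.simps)
  finally show ?case ..
qed simp

text \<open>In the induction step \<open>F i ^^ Q\<close> acts on a form that itself depends on
  \<open>Q\<close>. A bound by \<open>C * (norm x)\<^sup>2\<close> uniform in \<open>Q\<close> is
  therefore carried along; it dominates the subtracted term by \<open>C\<close> times
  \<open>F i ^^ Q\<close> of the squared norm, which purity sends to 0.\<close>

lemma foldr_telescope_tendsto:
  assumes contr: "\<And>i x. i \<in> I \<Longrightarrow> F i (\<lambda>x. (norm x)\<^sup>2) x \<le> (norm x)\<^sup>2"
    and pure: "\<And>i x. i \<in> I \<Longrightarrow> (\<lambda>Q. (F i ^^ Q) (\<lambda>x. (norm x)\<^sup>2) x) \<longlonglongrightarrow> 0"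
    and js: "set js \<subseteq> I"
  shows "(\<lambda>Q. foldr (\<lambda>i p x. p x - (F i ^^ Q) p x) js (\<lambda>x. (norm x)\<^sup>2) x) \<longlonglongrightarrow> (norm x)\<^sup>2"
proof -
  let ?Z = "\<lambda>js Q. foldr (\<lambda>i p x. p x - (F i ^^ Q) p x) js (\<lambda>x. (norm x)\<^sup>2)"
  have contr_funpow: "(F i ^^ Q) (\<lambda>x. (norm x)\<^sup>2) x \<le> (norm x)\<^sup>2" if "i \<in> I" for i Q x
  proof (induction Q)
    case (Suc Q)
    have "(F i ^^ Suc Q) (\<lambda>x. (norm x)\<^sup>2) x \<le> (F i ^^ Q) (\<lambda>x. (norm x)\<^sup>2) x"
      unfolding funpow_Suc_right o_def by (rule form_map_funpow_mono) (rule contr[OF that])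
    with Suc show ?case
      by linarith
  qed simp
  have "(\<exists>C. \<forall>Q x. \<bar>?Z js Q x\<bar> \<le> C * (norm x)\<^sup>2) \<and> (\<forall>x. (\<lambda>Q. ?Z js Q x) \<longlonglongrightarrow> (norm x)\<^sup>2)"
    using js
  proof (induction js)
    case Nil
    show ?case
      by (auto intro!: exI[of _ 1])
  next
    case (Cons i js)
    then obtain C where C: "\<And>Q x. \<bar>?Z js Q x\<bar> \<le> C * (norm x)\<^sup>2"
      and lim: "\<And>x. (\<lambda>Q. ?Z js Q x) \<longlonglongrightarrow> (norm x)\<^sup>2" and "i \<in> I"
      by auto
    have bound: "\<bar>(F i ^^ Q) (?Z js Q) x\<bar> \<le> C * (F i ^^ Q) (\<lambda>x. (norm x)\<^sup>2) x" for Q x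
    proof -
      have "(F i ^^ Q) (?Z js Q) x \<le> (F i ^^ Q) (\<lambda>x. C * (norm x)\<^sup>2) x"
        using C[of Q] by (intro form_map_funpow_mono) (auto simp: abs_le_iff)
      moreover have "(F i ^^ Q) (\<lambda>x. (- C) * (norm x)\<^sup>2) x \<le> (F i ^^ Q) (?Z js Q) x"
        using C[of Q] by (intro form_map_funpow_mono) (auto simp: abs_le_iff minus_le_iff)
      ultimately show ?thesis
        unfolding form_map_funpow_cmult by (simp add: abs_le_iff)
    qed
    have bound': "C * (F i ^^ Q) (\<lambda>x. (norm x)\<^sup>2) x \<le> \<bar>C\<bar> * (norm x)\<^sup>2" for Q x
    proof -
      have "0 \<le> (F i ^^ Q) (\<lambda>x. (norm x)\<^sup>2) x"
        unfolding form_map_funpow_words by (intro sum_nonneg) simp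
      then show ?thesis
        using mult_right_mono[OF abs_ge_self[of C]] mult_left_mono[OF contr_funpow[OF \<open>i \<in> I\<close>, of Q x], of "\<bar>C\<bar>"]
        by (meson abs_ge_zero order_trans)
    qed
    have "\<bar>?Z (i # js) Q x\<bar> \<le> (C + \<bar>C\<bar>) * (norm x)\<^sup>2" for Q x
    proof -
      have "?Z (i # js) Q x = ?Z js Q x - (F i ^^ Q) (?Z js Q) x"
        by simp
      moreover have "\<bar>?Z js Q x - (F i ^^ Q) (?Z js Q) x\<bar> \<le> C * (norm x)\<^sup>2 + \<bar>C\<bar> * (norm x)\<^sup>2"
        using C[of Q x] bound[of Q x] bound'[of Q x]
          abs_triangle_ineq4[of "?Z js Q x" "(F i ^^ Q) (?Z js Q) x"] by linarith
      ultimately show ?thesis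
        by (simp only: distrib_right)
    qed
    moreover have "(\<lambda>Q. ?Z (i # js) Q x) \<longlonglongrightarrow> (norm x)\<^sup>2" for x
    proof -
      have "(\<lambda>Q. (F i ^^ Q) (?Z js Q) x) \<longlonglongrightarrow> 0"
        by (rule Lim_null_comparison[OF always_eventually])
          (use bound tendsto_mult_right_zero[OF pure[OF \<open>i \<in> I\<close>], of C x] in auto)
      from tendsto_diff[OF lim this] show ?thesis
        by simp
    qed
    ultimately show ?case
      by blast
  qed
  then show ?thesis
    by blast
qed

end

subsection \<open>Coordinates with respect to an orthonormal sequence\<close>

text \<open>The difference of the two sides is the squared distance of \<open>y\<close> from its
  projection onto the span.\<close>

lemma bessel_inequality:
  fixes b :: "'j \<Rightarrow> 'a::complex_inner"
  assumes b: "\<And>i j. i \<in> F \<Longrightarrow> j \<in> F \<Longrightarrow> cinner (b i) (b j) = (if i = j then 1 else 0)" and "finite F"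
  shows "(\<Sum>j\<in>F. (cmod (cinner y (b j)))\<^sup>2) \<le> (norm y)\<^sup>2"
proof -
  let ?p = "\<Sum>j\<in>F. cinner y (b j) *\<^sub>C b j" and ?s = "\<Sum>j\<in>F. (cmod (cinner y (b j)))\<^sup>2"
  have sq: "z * cnj z = complex_of_real ((cmod z)\<^sup>2)" for z
    by (rule complex_norm_square[symmetric])
  have yp: "cinner y ?p = ?s"
    by (simp add: cinner_sum_right cinner_scaleC_right mult.commute[of "cnj _"] sq del: of_real_power)
  moreover have "cinner ?p y = ?s"
    by (subst cinner_commute) (simp only: yp complex_cnj_complex_of_real)
  moreover have "cinner ?p (b j) = cinner y (b j)" if "j \<in> F" for j
    using that \<open>finite F\<close> by (simp add: cinner_sum_left cinner_scaleC_left b if_distrib[where f = "\<lambda>z. _ * z"] cong: if_cong)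
  then have "cinner ?p ?p = ?s"
    by (subst (2) sum.cong[OF refl refl]) (simp add: cinner_sum_right[of ?p] cinner_scaleC_right mult.commute[of "cnj _"] sq del: of_real_power)
  ultimately have "cinner (y - ?p) (y - ?p) = complex_of_real ((norm y)\<^sup>2 - ?s)"
    by (simp only: cinner_diff_left cinner_diff_right cinner_self[of y] of_real_diff) simp
  then have "(norm (y - ?p))\<^sup>2 = (norm y)\<^sup>2 - ?s"
    by (simp only: cinner_self of_real_eq_iff)
  then show ?thesis
    by (metis diff_ge_0_iff_ge zero_le_power2)
qed

lemma orthonormal_coordinates:
  fixes b :: "'j \<Rightarrow> 'a::chilbert_space"
  assumes b: "\<And>i j. i \<in> J \<Longrightarrow> j \<in> J \<Longrightarrow> cinner (b i) (b j) = (if i = j then 1 else 0)"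
  shows "\<exists>W :: 'a \<Rightarrow> 'j ell2. bounded_clinear W \<and> range W \<subseteq> ell2_on J \<and>
    (\<forall>y\<in>closure (cspan (b ` J)). norm (W y) = norm y)"
proof -
  define c where "c y j = (if j \<in> J then cinner y (b j) else 0)" for y j
  define W where "W y = Abs_ell2 (c y)" for y
  have bound: "(\<Sum>j\<in>F. (cmod (c y j))\<^sup>2) \<le> (norm y)\<^sup>2" if "finite F" for F y
  proof -
    have "(\<Sum>j\<in>F. (cmod (c y j))\<^sup>2) = (\<Sum>j\<in>F \<inter> J. (cmod (cinner y (b j)))\<^sup>2)"
      by (rule sum.mono_neutral_cong_right) (auto simp: c_def that)
    also have "\<dots> \<le> (norm y)\<^sup>2"
      using b that by (intro bessel_inequality) auto
    finally show ?thesis .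
  qed
  have summ: "(\<lambda>j. (cmod (c y j))\<^sup>2) summable_on UNIV" for y
    by (rule nonneg_bdd_above_summable_on) (auto intro!: bdd_aboveI2[where M = "(norm y)\<^sup>2"] bound)
  then have coord_W: "coord (W y) = c y" for y
    by (simp add: W_def Abs_ell2_inverse)
  have W: "bounded_clinear W"
  proof (rule bounded_clinearI[where K = 1])
    show "W (x + y) = W x + W y" for x y
      by (rule ell2_eqI) (simp add: coord_W plus_ell2.rep_eq c_def cinner_add_left)
    show "W (a *\<^sub>C x) = a *\<^sub>C W x" for a x
      by (rule ell2_eqI) (simp add: coord_W scaleC_ell2.rep_eq c_def cinner_scaleC_left)
    have le: "(norm (W y))\<^sup>2 \<le> (norm y)\<^sup>2" for y
      unfolding norm_ell2_sq coord_W by (rule infsum_le_finite_sums[OF summ bound])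
    show "norm (W y) \<le> 1 * norm y" for y
      using power2_le_imp_le[OF le[of y]] by simp
  qed
  interpret W: bounded_linear W
    using W by (rule bounded_clinear_bounded_linear)
  \<comment> \<open>With \<open>z\<close> arbitrary the condition is linear in \<open>y\<close>, so
    \<open>S\<close> is a closed subspace and it is enough that it contains every
    \<open>b j\<close>.\<close>
  define S where "S = {y. \<forall>z. cinner (W y) (W z) = cinner y z}"
  have "b j \<in> S" if "j \<in> J" for j
  proof -
    have "W (b j) = ket j"
      by (rule ell2_eqI) (use that b in \<open>auto simp: coord_W c_def ket.rep_eq\<close>)
    moreover have "cinner (ket j) (W z) = cinner (b j) z" for z
      by (subst (1 2) cinner_commute) (use that in \<open>simp add: cinner_ket coord_W c_def\<close>)
    ultimately show ?thesis
      by (simp add: S_def)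
  qed
  moreover have "csubspace S"
    by (auto simp: complex_vector.subspace_def S_def W.zero W.add bounded_clinear_scaleC[OF W]
        cinner_add_left cinner_scaleC_left)
  moreover have "closed S"
  proof -
    have "S = (\<Inter>z. {y. cinner (W y) (W z) = cinner y z})"
      by (auto simp: S_def)
    moreover have "closed {y. cinner (W y) (W z) = cinner y z}" for z
      by (intro closed_Collect_eq bounded_bilinear.continuous_on[OF bounded_bilinear_cinner]
          W.continuous_on continuous_on_const continuous_on_id)
    ultimately show ?thesis
      by auto
  qed
  ultimately have "closure (cspan (b ` J)) \<subseteq> S"
    by (intro closure_minimal complex_vector.span_minimal) auto
  then have "norm (W y) = norm y" if "y \<in> closure (cspan (b ` J))" for y
  proof -
    have "cinner (W y) (W y) = cinner y y"
      using \<open>closure (cspan (b ` J)) \<subseteq> S\<close> that by (auto simp: S_def)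
    then show ?thesis
      by (simp only: cinner_self of_real_eq_iff power2_eq_iff_nonneg norm_ge_zero)
  qed
  moreover have "range W \<subseteq> ell2_on J"
    by (auto simp: ell2_on_def coord_W c_def)
  ultimately show ?thesis
    using W by blast
qed

text \<open>\<open>L\<close> is the square root of \<open>D\<close> followed by coordinates in an
  orthonormal basis of the closed range of \<open>D\<close>, which is also that of the root. The
  rank thereby fixes the multiplicity space \<open>ell2_on {j. enat j < m}\<close>.\<close>

lemma factorization_through_ell2:
  fixes D :: "'a::chilbert_space \<Rightarrow> 'a"
  assumes D: "selfadjoint D" and pos: "\<And>x. 0 \<le> inner (D x) x" and rank: "has_rank D m"
  shows "\<exists>L :: 'a \<Rightarrow> nat ell2. bounded_clinear L \<and> range L \<subseteq> ell2_on {j. enat j < m} \<and>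
    (\<forall>x. (norm (L x))\<^sup>2 = inner (D x) x)"
proof -
  let ?J = "{j. enat j < m}"
  obtain R where R: "selfadjoint R" "\<And>x. R (R x) = D x"
    using positive_sqrt_exists[OF D pos] by blast
  have D_eq: "D = (\<lambda>x. R (R x))"
    using R by auto
  obtain C b where C: "orthonormal C" "closure (cspan C) = closure (range D)" and b: "bij_betw b ?J C"
    using rank unfolding has_rank_def has_hilbert_dim_def by blast
  have C_eq: "b ` ?J = C" and inj: "inj_on b ?J"
    using b by (auto simp: bij_betw_def)
  have "cinner (b i) (b j) = (if i = j then 1 else 0)" if "i \<in> ?J" "j \<in> ?J" for i j
  proof -
    have "b i \<in> C" "b j \<in> C"
      using that C_eq by blast+
    then show ?thesis
      using C(1) inj_on_eq_iff[OF inj that] by (simp add: orthonormal_def)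
  qed
  then obtain W :: "'a \<Rightarrow> nat ell2" where W: "bounded_clinear W" "range W \<subseteq> ell2_on ?J"
    "\<forall>y\<in>closure (cspan (b ` ?J)). norm (W y) = norm y"
    using orthonormal_coordinates[of ?J b] by blast
  have "closure (cspan (b ` ?J)) = closure (range R)"
    unfolding C_eq C(2) D_eq by (rule closure_range_square[OF R(1)])
  then have norm: "norm (W (R x)) = norm (R x)" for x
    using W(3) subsetD[OF closure_subset rangeI, of R x] by simp
  have "(norm (W (R x)))\<^sup>2 = inner (D x) x" for x
    unfolding norm power2_norm_eq_inner D_eq by (simp only: selfadjoint_inner[OF R(1)])
  then show ?thesis
    using bounded_clinear_compose[OF W(1) selfadjoint_bounded_clinear[OF R(1)]] W(2)
    by (intro exI[of _ "\<lambda>x. W (R x)"]) auto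
qed

subsection \<open>Adjoints of the standard shifts\<close>

lemma coord_cadjoint: "bounded_clinear A \<Longrightarrow> coord (cadjoint A f) x = cinner f (A (ket x))"
  by (simp add: cinner_cadjoint_left flip: cinner_ket)

lemma free_tuples_cons:
  "\<alpha> \<in> free_tuples k n \<Longrightarrow> i \<in> {1..k} \<Longrightarrow> s \<in> {1..n i} \<Longrightarrow> \<alpha>(i := s # \<alpha> i) \<in> free_tuples k n"
  by (auto simp: free_tuples_def PiE_iff extensional_def lists_eq_set)

lemma free_tuples_set: "\<alpha> \<in> free_tuples k n \<Longrightarrow> i \<in> {1..k} \<Longrightarrow> set (\<alpha> i) \<subseteq> {1..n i}"
  by (auto simp: free_tuples_def PiE_iff lists_eq_set)

lemma neutral_tuple_free: "neutral_tuple k \<in> free_tuples k n"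
  by (auto simp: neutral_tuple_def free_tuples_def)

lemma bounded_clinear_vacuum_proj: "bounded_clinear (vacuum_proj k)"
proof (rule bounded_clinearI[where K = "norm (ket (neutral_tuple k) :: (nat \<Rightarrow> nat list) ell2)"])
  show "norm (vacuum_proj k f) \<le> norm (ket (neutral_tuple k) :: (nat \<Rightarrow> nat list) ell2) * norm f" for f
    unfolding vacuum_proj_eq norm_scaleC
    by (subst mult.commute) (intro mult_left_mono norm_coord_le norm_ge_zero)
qed (simp_all add: vacuum_proj_eq plus_ell2.rep_eq scaleC_ell2.rep_eq scaleC_add_left scaleC_scaleC)

lemma coord_amplify_vacuum:
  "coord (amplify (vacuum_proj k) f) (\<alpha>, j) = (if \<alpha> = neutral_tuple k then coord f (\<alpha>, j) else 0)"
  by (simp add: coord_amplify bounded_clinear_vacuum_proj vacuum_proj_eq scaleC_ell2.rep_eq ket.rep_eq coord_slice)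

lemma norm_amplify_vacuum:
  "(norm (amplify (vacuum_proj k) f))\<^sup>2 = (\<Sum>\<^sub>\<infinity>j. (cmod (coord f (neutral_tuple k, j)))\<^sup>2)"
proof -
  have "(norm (amplify (vacuum_proj k) f))\<^sup>2 =
      (\<Sum>\<^sub>\<infinity>x\<in>range (Pair (neutral_tuple k)). (cmod (coord f x))\<^sup>2)"
    unfolding norm_ell2_sq
    by (rule infsum_cong_neutral) (auto simp: coord_amplify_vacuum)
  also have "\<dots> = (\<Sum>\<^sub>\<infinity>j. (cmod (coord f (neutral_tuple k, j)))\<^sup>2)"
    by (subst infsum_reindex) (auto simp: inj_on_def o_def)
  finally show ?thesis .
qed

lemma word_phase_Nil [simp]: "word_phase \<Lambda> i j s [] = 1"
  and word_phase_Cons [simp]: "word_phase \<Lambda> i j s (t # w) = \<Lambda> i j s t * word_phase \<Lambda> i j s w"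
  by (simp_all add: word_phase_def)

text \<open>Only components before \<open>i\<close> enter the phase, hence the case distinction. The
  resulting asymmetry is resolved in \<open>cadjoint_shift_commute\<close>.\<close>

lemma shift_phase_cons:
  assumes "j \<noteq> i" "j \<ge> 1"
  shows "shift_phase \<Lambda> i s (\<alpha>(j := t # \<alpha> j)) = (if j < i then \<Lambda> i j s t else 1) * shift_phase \<Lambda> i s \<alpha>"
proof (cases "j < i")
  case True
  then have "j \<in> {1..<i}"
    using assms by simp
  then show ?thesis
    using True by (simp add: shift_phase_def prod.remove[of _ j])
next
  case False
  then show ?thesis
    unfolding shift_phase_def by (auto intro!: prod.cong)
qed

locale phase_system =
  fixes k :: nat and n :: "nat \<Rightarrow> nat" and \<Lambda> :: "nat \<Rightarrow> nat \<Rightarrow> nat \<Rightarrow> nat \<Rightarrow> complex"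
  assumes cmod_\<Lambda>: "\<And>i j s t. \<lbrakk>i \<in> {1..k}; j \<in> {1..k}; i \<noteq> j; s \<in> {1..n i}; t \<in> {1..n j}\<rbrakk>
      \<Longrightarrow> cmod (\<Lambda> i j s t) = 1"
    and cnj_\<Lambda>: "\<And>i j s t. \<lbrakk>i \<in> {1..k}; j \<in> {1..k}; i \<noteq> j; s \<in> {1..n i}; t \<in> {1..n j}\<rbrakk>
      \<Longrightarrow> \<Lambda> j i t s = cnj (\<Lambda> i j s t)"
begin

definition amplified_shift :: "nat \<Rightarrow> nat \<Rightarrow> ((nat \<Rightarrow> nat list) \<times> nat) ell2 \<Rightarrow> ((nat \<Rightarrow> nat list) \<times> nat) ell2"
  where "amplified_shift i s = amplify (std_shift k n \<Lambda> i s)"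

lemma bounded_clinear_amplified_shift:
  assumes "i \<in> {1..k}" "s \<in> {1..n i}"
  shows "bounded_clinear (amplified_shift i s)"
  unfolding amplified_shift_def
  by (intro bounded_clinear_amplify bounded_clinear_std_shift[where k = k and n = n and \<Lambda> = \<Lambda>] cmod_\<Lambda> assms)

text \<open>The coordinate pairs \<open>f\<close> with the image of
  \<open>ket (\<alpha>, j)\<close>, which is a phase times one basis vector for
  \<open>\<alpha>\<close> in \<open>free_tuples k n\<close> and 0 elsewhere, the shift being
  extended by 0. Up to phases the adjoint deletes a leading letter \<open>s\<close>.\<close>

lemma coord_cadjoint_shift:
  assumes i: "i \<in> {1..k}" and s: "s \<in> {1..n i}"
  shows "coord (cadjoint (amplified_shift i s) f) (\<alpha>, j) =
    (if \<alpha> \<in> free_tuples k n then cnj (shift_phase \<Lambda> i s \<alpha>) * coord f (\<alpha>(i := s # \<alpha> i), j) else 0)"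
proof -
  have "bounded_clinear (std_shift k n \<Lambda> i s)"
    by (intro bounded_clinear_std_shift[where k = k and n = n and \<Lambda> = \<Lambda>] cmod_\<Lambda> i s)
  then have V: "amplified_shift i s (ket (\<alpha>, j)) = std_shift k n \<Lambda> i s (ket \<alpha>) \<otimes>\<^sub>2 ket j"
    by (simp add: amplified_shift_def amplify_tensor flip: ket_tensor_ket)
  show ?thesis
  proof (cases "\<alpha> \<in> free_tuples k n")
    case True
    have ket: "std_shift k n \<Lambda> i s (ket \<alpha>) = shift_phase \<Lambda> i s \<alpha> *\<^sub>C ket (\<alpha>(i := s # \<alpha> i))"
      by (intro std_shift_ket[where k = k and n = n and \<Lambda> = \<Lambda>] cmod_\<Lambda> i s True)
    have "std_shift k n \<Lambda> i s (ket \<alpha>) \<otimes>\<^sub>2 ket j = shift_phase \<Lambda> i s \<alpha> *\<^sub>C ket (\<alpha>(i := s # \<alpha> i), j)"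
      unfolding ket ket_tensor_ket[symmetric]
      by (rule ell2_eqI) (auto simp: tensor_ell2.rep_eq scaleC_ell2.rep_eq)
    then show ?thesis
      using True coord_cadjoint[OF bounded_clinear_amplified_shift[OF i s]]
      by (simp add: V cinner_scaleC_right cinner_ket)
  next
    case False
    then have "std_shift k n \<Lambda> i s (ket \<alpha>) = 0"
      by (intro std_shift_eq_0[where k = k and n = n and \<Lambda> = \<Lambda>] cmod_\<Lambda> i s) (auto simp: ket.rep_eq)
    then have "std_shift k n \<Lambda> i s (ket \<alpha>) \<otimes>\<^sub>2 ket j = 0"
      by (intro ell2_eqI) (auto simp: tensor_ell2.rep_eq zero_ell2.rep_eq)
    then show ?thesis
      using False coord_cadjoint[OF bounded_clinear_amplified_shift[OF i s]] by (simp add: V)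
  qed
qed

lemma cmod_shift_phase_free:
  "\<lbrakk>i \<in> {1..k}; s \<in> {1..n i}; \<alpha> \<in> free_tuples k n\<rbrakk> \<Longrightarrow> cmod (shift_phase \<Lambda> i s \<alpha>) = 1"
  by (rule cmod_shift_phase[where k = k and n = n and \<Lambda> = \<Lambda>, OF cmod_\<Lambda>])

lemma cadjoint_shift_commute:
  assumes i: "i \<in> {1..k}" "s \<in> {1..n i}" and j: "j \<in> {1..k}" "t \<in> {1..n j}" and "i \<noteq> j"
  shows "cadjoint (amplified_shift j t) (cadjoint (amplified_shift i s) f) =
    cnj (\<Lambda> i j s t) *\<^sub>C cadjoint (amplified_shift i s) (cadjoint (amplified_shift j t) f)"
proof (rule ell2_eqI)
  fix x :: "(nat \<Rightarrow> nat list) \<times> nat"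
  obtain \<alpha> l where x: "x = (\<alpha>, l)"
    by (cases x)
  have \<Lambda>: "cnj (\<Lambda> i j s t) * cnj (\<Lambda> j i t s) = 1"
    using cmod_\<Lambda>[of i j s t] cnj_\<Lambda>[of i j s t] i j \<open>i \<noteq> j\<close>
    by (simp add: mult.commute flip: complex_norm_square)
  show "coord (cadjoint (amplified_shift j t) (cadjoint (amplified_shift i s) f)) x =
    coord (cnj (\<Lambda> i j s t) *\<^sub>C cadjoint (amplified_shift i s) (cadjoint (amplified_shift j t) f)) x"
  proof (cases "\<alpha> \<in> free_tuples k n")
    case True
    \<comment> \<open>For \<open>j < i\<close> the left-hand side produces the factor
      \<open>\<Lambda> i j s t\<close>; for \<open>i < j\<close> the right-hand side contributes
      \<open>\<Lambda> j i t s\<close>, which cancels it by the relation above.\<close>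
    have "shift_phase \<Lambda> j t \<alpha> * shift_phase \<Lambda> i s (\<alpha>(j := t # \<alpha> j)) =
        \<Lambda> i j s t * (shift_phase \<Lambda> i s \<alpha> * shift_phase \<Lambda> j t (\<alpha>(i := s # \<alpha> i)))"
      using i j \<open>i \<noteq> j\<close> arg_cong[OF \<Lambda>, of cnj] by (simp add: shift_phase_cons)
    from arg_cong[OF this, of cnj] show ?thesis
      using True i j \<open>i \<noteq> j\<close>
      by (simp add: x coord_cadjoint_shift free_tuples_cons scaleC_ell2.rep_eq fun_upd_twist mult.assoc[symmetric])
  next
    case False
    then show ?thesis
      using i j by (simp add: x coord_cadjoint_shift scaleC_ell2.rep_eq)
  qed
qed

end

subsection \<open>The Berezin kernel\<close>

lemma bounded_clinear_fold:
  "(\<And>a. a \<in> set xs \<Longrightarrow> bounded_clinear (f a)) \<Longrightarrow> bounded_clinear (fold f xs)"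
  by (induction xs) (simp_all add: bounded_clinear_id[unfolded id_def] bounded_clinear_compose id_def o_def)

text \<open>The terms are nonnegative and every finite subset lies in some \<open>E Q\<close>, so
  the limit is the supremum of all finite partial sums. It converts sums over words of bounded
  length into a sum over all tuples.\<close>

lemma has_sum_exhaustion:
  fixes h :: "'a \<Rightarrow> real"
  assumes nonneg: "\<And>a. a \<in> A \<Longrightarrow> 0 \<le> h a" and fin: "\<And>Q. finite (E Q)" and mono: "incseq E"
    and A: "(\<Union>Q. E Q) = A" and lim: "(\<lambda>Q. sum h (E Q)) \<longlonglongrightarrow> l"
  shows "(h has_sum l) A"
proof -
  have sub: "E Q \<subseteq> A" for Q
    using A by blast
  have "sum h (E p) \<le> sum h (E q)" if "p \<le> q" for p q
    using sub nonneg by (intro sum_mono2 fin incseqD[OF mono that]) blast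
  then have le_l: "sum h (E Q) \<le> l" for Q
    by (intro incseq_le[OF _ lim] incseq_def[THEN iffD2]) blast
  have fin_le: "sum h S \<le> l" if S: "finite S" "S \<subseteq> A" for S
  proof -
    have "\<exists>Q. S \<subseteq> E Q"
      using S
    proof (induction S)
      case (insert a S)
      then obtain p q where "a \<in> E p" "S \<subseteq> E q"
        using A by blast
      then have "insert a S \<subseteq> E (max p q)"
        using incseqD[OF mono, of p "max p q"] incseqD[OF mono, of q "max p q"] by auto
      then show ?case ..
    qed simp
    then obtain Q where "S \<subseteq> E Q" ..
    then have "sum h S \<le> sum h (E Q)"
      using sub nonneg by (intro sum_mono2 fin) blast+
    with le_l[of Q] show ?thesis
      by linarith
  qed
  have summ: "h summable_on A"
    by (rule nonneg_bdd_above_summable_on) (auto intro!: nonneg bdd_aboveI2[where M = l] fin_le)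
  have "infsum h A \<le> l"
    by (rule infsum_le_finite_sums[OF summ fin_le])
  moreover have "l \<le> infsum h A"
    by (rule LIMSEQ_le_const2[OF lim]) (use nonneg sub in \<open>auto intro!: finite_sum_le_infsum[OF summ] fin\<close>)
  ultimately show ?thesis
    using has_sum_infsum[OF summ] by simp
qed

text \<open>\<open>B\<close> plays the role of the adjoints of \<open>T\<close>, so the phase
  appears conjugated and the order of the factors reversed.\<close>

locale lambda_tuple = phase_system +
  fixes B :: "nat \<Rightarrow> nat \<Rightarrow> 'h::complex_inner \<Rightarrow> 'h"
  assumes bounded_clinear_B: "\<And>i s. i \<in> {1..k} \<Longrightarrow> s \<in> {1..n i} \<Longrightarrow> bounded_clinear (B i s)"
    and lambda_commute: "\<And>i j s t x. \<lbrakk>i \<in> {1..k}; j \<in> {1..k}; i \<noteq> j; s \<in> {1..n i}; t \<in> {1..n j}\<rbrakk>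
      \<Longrightarrow> B j t (B i s x) = cnj (\<Lambda> i j s t) *\<^sub>C B i s (B j t x)"
begin

sublocale commuting_tuple "{1..k}" n B
proof
  fix i j s t
  assume *: "i \<in> {1..k}" "j \<in> {1..k}" "i \<noteq> j" "s \<in> {1..n i}" "t \<in> {1..n j}"
  then show "\<exists>c. cmod c = 1 \<and> (\<forall>x. B i s (B j t x) = c *\<^sub>C B j t (B i s x))"
    using lambda_commute[of j i t s] cmod_\<Lambda>[of j i t s]
    by (intro exI[of _ "cnj (\<Lambda> j i t s)"]) auto
qed (simp add: bounded_clinear_scaleC bounded_clinear_B)

text \<open>On \<open>[1..<Suc k]\<close> this is the adjoint of the product of the words
  \<open>\<alpha> 1\<close>, ..., \<open>\<alpha> k\<close> in the \<open>T i s\<close>. The list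
  argument provides the partial products needed when an operator is moved past some components
  only.\<close>

definition tuple_op :: "(nat \<Rightarrow> nat list) \<Rightarrow> nat list \<Rightarrow> 'h \<Rightarrow> 'h"
  where "tuple_op \<alpha> = fold (\<lambda>i. fold (B i) (\<alpha> i))"

lemma bounded_clinear_word:
  "i \<in> {1..k} \<Longrightarrow> set w \<subseteq> {1..n i} \<Longrightarrow> bounded_clinear (fold (B i) w)"
  by (intro bounded_clinear_fold bounded_clinear_B) auto

lemma bounded_clinear_tuple_op:
  "set js \<subseteq> {1..k} \<Longrightarrow> \<alpha> \<in> free_tuples k n \<Longrightarrow> bounded_clinear (tuple_op \<alpha> js)"
  unfolding tuple_op_def
  by (intro bounded_clinear_fold bounded_clinear_word free_tuples_set) auto

lemma word_shift:
  assumes i: "i \<in> {1..k}" "s \<in> {1..n i}" and j: "j \<in> {1..k}" "set w \<subseteq> {1..n j}" and "i \<noteq> j"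
  shows "fold (B j) w (B i s x) = cnj (word_phase \<Lambda> i j s w) *\<^sub>C B i s (fold (B j) w x)"
  using j(2)
proof (induction w arbitrary: x)
  case (Cons t w)
  have "fold (B j) (t # w) (B i s x) = fold (B j) w (cnj (\<Lambda> i j s t) *\<^sub>C B i s (B j t x))"
    using Cons.prems i j \<open>i \<noteq> j\<close> lambda_commute[of i j s t x] by simp
  also have "\<dots> = cnj (\<Lambda> i j s t) *\<^sub>C fold (B j) w (B i s (B j t x))"
    using Cons.prems j by (intro bounded_clinear_scaleC bounded_clinear_word) auto
  also have "\<dots> = cnj (word_phase \<Lambda> i j s (t # w)) *\<^sub>C B i s (fold (B j) (t # w) x)"
    using Cons by (simp add: scaleC_scaleC)
  finally show ?case .
qed simp

lemma tuple_op_shift_notin: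
  assumes i: "i \<in> {1..k}" "s \<in> {1..n i}" and \<alpha>: "\<alpha> \<in> free_tuples k n"
    and js: "set js \<subseteq> {1..k}" "distinct js" "i \<notin> set js"
  shows "tuple_op \<alpha> js (B i s x) = cnj (\<Prod>j\<in>set js. word_phase \<Lambda> i j s (\<alpha> j)) *\<^sub>C B i s (tuple_op \<alpha> js x)"
  using js
proof (induction js arbitrary: x)
  case (Cons j js)
  then have j: "j \<in> {1..k}" "i \<noteq> j" and js: "set js \<subseteq> {1..k}"
    by auto
  have "tuple_op \<alpha> (j # js) (B i s x) = tuple_op \<alpha> js (fold (B j) (\<alpha> j) (B i s x))"
    by (simp add: tuple_op_def)
  also have "\<dots> = tuple_op \<alpha> js (cnj (word_phase \<Lambda> i j s (\<alpha> j)) *\<^sub>C B i s (fold (B j) (\<alpha> j) x))"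
    by (simp only: word_shift[OF i j(1) free_tuples_set[OF \<alpha> j(1)] j(2)])
  also have "\<dots> = cnj (word_phase \<Lambda> i j s (\<alpha> j)) *\<^sub>C tuple_op \<alpha> js (B i s (fold (B j) (\<alpha> j) x))"
    by (intro bounded_clinear_scaleC bounded_clinear_tuple_op js \<alpha>)
  also have "\<dots> = cnj (\<Prod>j\<in>set (j # js). word_phase \<Lambda> i j s (\<alpha> j)) *\<^sub>C B i s (tuple_op \<alpha> (j # js) x)"
    using Cons by (simp add: scaleC_scaleC tuple_op_def)
  finally show ?case .
qed (simp add: tuple_op_def)

text \<open>\<open>B i s\<close> has to cross the components before \<open>i\<close>, which yields
  exactly \<open>shift_phase\<close>, and is then absorbed as a new first letter of
  \<open>\<alpha> i\<close>. Read coordinatewise, this is the intertwining relation with the adjoint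
  shift.\<close>

lemma tuple_op_shift:
  assumes i: "i \<in> {1..k}" "s \<in> {1..n i}" and \<alpha>: "\<alpha> \<in> free_tuples k n"
  shows "tuple_op \<alpha> [1..<Suc k] (B i s x) =
    cnj (shift_phase \<Lambda> i s \<alpha>) *\<^sub>C tuple_op (\<alpha>(i := s # \<alpha> i)) [1..<Suc k] x"
proof -
  let ?\<beta> = "\<alpha>(i := s # \<alpha> i)"
  have js: "[1..<Suc k] = [1..<i] @ i # [Suc i..<Suc k]"
    using i upt_add_eq_append[of 1 i "Suc k - i"] upt_conv_Cons[of i "Suc k"] by simp
  have upd: "tuple_op ?\<beta> js x = tuple_op \<alpha> js x" if "i \<notin> set js" for js x
    unfolding tuple_op_def by (rule fold_cong) (use that in auto)
  have "tuple_op \<alpha> [1..<Suc k] (B i s x) =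
      tuple_op \<alpha> [Suc i..<Suc k] (fold (B i) (\<alpha> i) (tuple_op \<alpha> [1..<i] (B i s x)))"
    unfolding js by (simp add: tuple_op_def)
  also have "tuple_op \<alpha> [1..<i] (B i s x) = cnj (shift_phase \<Lambda> i s \<alpha>) *\<^sub>C B i s (tuple_op \<alpha> [1..<i] x)"
    using i \<alpha> by (subst tuple_op_shift_notin) (auto simp: shift_phase_def)
  also have "fold (B i) (\<alpha> i) \<dots> = cnj (shift_phase \<Lambda> i s \<alpha>) *\<^sub>C fold (B i) (\<alpha> i) (B i s (tuple_op \<alpha> [1..<i] x))"
    by (rule bounded_clinear_scaleC[OF bounded_clinear_word[OF i(1) free_tuples_set[OF \<alpha> i(1)]]])
  also have "tuple_op \<alpha> [Suc i..<Suc k] \<dots> =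
      cnj (shift_phase \<Lambda> i s \<alpha>) *\<^sub>C tuple_op \<alpha> [Suc i..<Suc k] (fold (B i) (\<alpha> i) (B i s (tuple_op \<alpha> [1..<i] x)))"
    using i by (intro bounded_clinear_scaleC bounded_clinear_tuple_op \<alpha>) auto
  also have "fold (B i) (\<alpha> i) (B i s (tuple_op \<alpha> [1..<i] x)) = fold (B i) (?\<beta> i) (tuple_op ?\<beta> [1..<i] x)"
    by (simp add: upd)
  also have "tuple_op \<alpha> [Suc i..<Suc k] \<dots> = tuple_op ?\<beta> [1..<Suc k] x"
    unfolding js by (simp add: upd[symmetric]) (simp add: tuple_op_def)
  finally show ?thesis .
qed

text \<open>For adjoints \<open>B\<close> of \<open>T\<close>, \<open>p\<close> is the form of the
  defect operator. Its sum over words shorter than \<open>Q\<close> is the telescoped fold, which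
  tends to the squared norm.\<close>

lemma has_sum_tuple_op:
  assumes contr: "\<And>i x. i \<in> {1..k} \<Longrightarrow> form_map 1 (n i) (B i) (\<lambda>x. (norm x)\<^sup>2) x \<le> (norm x)\<^sup>2"
    and pure: "\<And>i x. i \<in> {1..k} \<Longrightarrow> (\<lambda>Q. (form_map 1 (n i) (B i) ^^ Q) (\<lambda>x. (norm x)\<^sup>2) x) \<longlonglongrightarrow> 0"
    and p: "p = foldr (\<lambda>i p x. p x - form_map 1 (n i) (B i) p x) [1..<Suc k] (\<lambda>x. (norm x)\<^sup>2)"
    and nonneg: "\<And>x. 0 \<le> p x"
  shows "((\<lambda>\<alpha>. p (tuple_op \<alpha> [1..<Suc k] x)) has_sum (norm x)\<^sup>2) (free_tuples k n)"
proof (rule has_sum_exhaustion)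
  let ?E = "\<lambda>Q. \<Pi>\<^sub>E i\<in>{1..k}. {w. set w \<subseteq> {1..n i} \<and> length w < Q}"
  have set: "set [1..<Suc k] = {1..k}"
    by auto
  show "finite (?E Q)" for Q
    by (intro finite_PiE finite_words_less) simp
  show "incseq ?E"
    by (intro incseq_SucI PiE_mono) auto
  show "(\<Union>Q. ?E Q) = free_tuples k n"
  proof
    show "(\<Union>Q. ?E Q) \<subseteq> free_tuples k n"
      by (auto simp: free_tuples_def PiE_iff lists_eq_set)
    show "free_tuples k n \<subseteq> (\<Union>Q. ?E Q)"
    proof
      fix \<alpha> assume \<alpha>: "\<alpha> \<in> free_tuples k n"
      \<comment> \<open>The sum of all component lengths bounds each single one, so the next box
        contains \<open>\<alpha>\<close>.\<close>
      have "length (\<alpha> i) < Suc (\<Sum>i=1..k. length (\<alpha> i))" if "i \<in> {1..k}" for i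
        using member_le_sum[OF that, of "\<lambda>i. length (\<alpha> i)"] by simp
      then have "\<alpha> \<in> ?E (Suc (\<Sum>i=1..k. length (\<alpha> i)))"
        using \<alpha> by (auto simp: free_tuples_def PiE_iff lists_eq_set)
      then show "\<alpha> \<in> (\<Union>Q. ?E Q)"
        by blast
    qed
  qed
  have "(\<Sum>\<alpha>\<in>?E Q. p (tuple_op \<alpha> [1..<Suc k] x)) =
      foldr (\<lambda>i p x. p x - (form_map 1 (n i) (B i) ^^ Q) p x) [1..<Suc k] (\<lambda>x. (norm x)\<^sup>2) x" for Q
  proof -
    have "(\<Sum>\<alpha>\<in>?E Q. p (tuple_op \<alpha> [1..<Suc k] x)) =
        foldr (\<lambda>i. geometric_form Q (n i) (B i)) [1..<Suc k] p x"
      using foldr_G_words[of "[1..<Suc k]" Q p x] by (simp only: set tuple_op_def distinct_upt)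
    also have "\<dots> = foldr (\<lambda>i p x. p x - (form_map 1 (n i) (B i) ^^ Q) p x) [1..<Suc k] (\<lambda>x. (norm x)\<^sup>2) x"
      unfolding p by (subst foldr_telescope) (auto simp: phase_invariant_def norm_scaleC)
    finally show ?thesis .
  qed
  then show "(\<lambda>Q. \<Sum>\<alpha>\<in>?E Q. p (tuple_op \<alpha> [1..<Suc k] x)) \<longlonglongrightarrow> (norm x)\<^sup>2"
    using foldr_telescope_tendsto[OF contr pure, of "[1..<Suc k]" x] by (simp only: set order_refl)
qed (rule nonneg)

text \<open>The slice of \<open>K x\<close> at \<open>\<alpha>\<close> is \<open>L\<close> applied
  to \<open>tuple_op \<alpha>\<close>. The hypothesis \<open>sum\<close> makes \<open>K\<close>
  isometric and \<open>tuple_op_shift\<close> makes it intertwine.\<close>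

lemma berezin_kernel:
  fixes L :: "'h \<Rightarrow> nat ell2"
  assumes L: "bounded_clinear L" and ran: "range L \<subseteq> ell2_on J"
    and sum: "\<And>x. ((\<lambda>\<alpha>. (norm (L (tuple_op \<alpha> [1..<Suc k] x)))\<^sup>2) has_sum (norm x)\<^sup>2) (free_tuples k n)"
  shows "\<exists>K. clinear K \<and> (\<forall>x. norm (K x) = norm x) \<and> range K \<subseteq> ell2_on (free_tuples k n \<times> J) \<and>
    (\<forall>x. norm (amplify (vacuum_proj k) (K x)) = norm (L x)) \<and>
    (\<forall>i\<in>{1..k}. \<forall>s\<in>{1..n i}. \<forall>x. K (B i s x) = cadjoint (amplified_shift i s) (K x))"
proof -
  let ?\<Gamma> = "free_tuples k n"
  define c where "c x = (\<lambda>(\<alpha>, j). if \<alpha> \<in> ?\<Gamma> then coord (L (tuple_op \<alpha> [1..<Suc k] x)) j else 0)" for x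
  define K where "K x = Abs_ell2 (c x)" for x
  have sum_c: "((\<lambda>y. (cmod (c x y))\<^sup>2) has_sum (norm x)\<^sup>2) UNIV" for x
  proof -
    let ?h = "\<lambda>\<alpha> j. (cmod (coord (L (tuple_op \<alpha> [1..<Suc k] x)) j))\<^sup>2"
    have inner: "(?h \<alpha> has_sum (norm (L (tuple_op \<alpha> [1..<Suc k] x)))\<^sup>2) UNIV" for \<alpha>
      unfolding norm_ell2_sq by (rule has_sum_infsum[OF coord_sq_summable])
    have "(\<lambda>(\<alpha>, j). ?h \<alpha> j) summable_on Sigma ?\<Gamma> (\<lambda>_. UNIV)"
    proof (rule summable_on_SigmaI[where g = "\<lambda>\<alpha>. (norm (L (tuple_op \<alpha> [1..<Suc k] x)))\<^sup>2"])
      show "(\<lambda>\<alpha>. (norm (L (tuple_op \<alpha> [1..<Suc k] x)))\<^sup>2) summable_on ?\<Gamma>"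
        by (rule has_sum_imp_summable[OF sum])
    qed (use inner in auto)
    then have "((\<lambda>(\<alpha>, j). ?h \<alpha> j) has_sum (norm x)\<^sup>2) (Sigma ?\<Gamma> (\<lambda>_. UNIV))"
      by (intro has_sum_SigmaI[OF _ sum]) (use inner in auto)
    then show ?thesis
      by (rule has_sum_cong_neutral[THEN iffD1, rotated -1]) (auto simp: c_def split: if_splits)
  qed
  then have coord_K: "coord (K x) = c x" for x
    unfolding K_def by (intro Abs_ell2_inverse) (auto simp: summable_on_def)
  have lin: "bounded_clinear (\<lambda>x. L (tuple_op \<alpha> [1..<Suc k] x))" if "\<alpha> \<in> ?\<Gamma>" for \<alpha>
    by (rule bounded_clinear_compose[OF L bounded_clinear_tuple_op[OF _ that]]) auto
  have "clinear K"
  proof (rule clinearI)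
    show "K (x + y) = K x + K y" for x y
      using linear_add[OF bounded_linear.linear[OF bounded_clinear_bounded_linear[OF lin]]]
      by (intro ell2_eqI) (auto simp: coord_K c_def plus_ell2.rep_eq)
    show "K (a *\<^sub>C x) = a *\<^sub>C K x" for a x
      using bounded_clinear_scaleC[OF lin]
      by (intro ell2_eqI) (auto simp: coord_K c_def scaleC_ell2.rep_eq)
  qed
  moreover have "norm (K x) = norm x" for x
  proof -
    have "(norm (K x))\<^sup>2 = (norm x)\<^sup>2"
      unfolding norm_ell2_sq coord_K by (rule infsumI[OF sum_c])
    then show ?thesis
      by simp
  qed
  moreover have "range K \<subseteq> ell2_on (?\<Gamma> \<times> J)"
  proof -
    have "coord (L y) j = 0" if "j \<notin> J" for y j
      using subsetD[OF ran rangeI, of y] that by (simp add: ell2_on_def)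
    then show ?thesis
      by (auto simp: ell2_on_def coord_K c_def)
  qed
  moreover have "norm (amplify (vacuum_proj k) (K x)) = norm (L x)" for x
  proof -
    \<comment> \<open>The neutral tuple applies no operator, so the vacuum slice of
      \<open>K x\<close> is \<open>L x\<close>.\<close>
    have "tuple_op (neutral_tuple k) js x = x" if "set js \<subseteq> {1..k}" for js
      using that unfolding tuple_op_def by (induction js) (auto simp: neutral_tuple_def)
    moreover have "set [1..<Suc k] \<subseteq> {1..k}"
      by auto
    ultimately have "tuple_op (neutral_tuple k) [1..<Suc k] x = x" .
    then have "(norm (amplify (vacuum_proj k) (K x)))\<^sup>2 = (norm (L x))\<^sup>2"
      unfolding norm_amplify_vacuum by (simp add: coord_K c_def neutral_tuple_free norm_ell2_sq)
    then show ?thesis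
      by simp
  qed
  moreover have "K (B i s x) = cadjoint (amplified_shift i s) (K x)" if "i \<in> {1..k}" "s \<in> {1..n i}" for i s x
  proof (rule ell2_eqI)
    fix y :: "(nat \<Rightarrow> nat list) \<times> nat"
    obtain \<alpha> j where y: "y = (\<alpha>, j)"
      by (cases y)
    show "coord (K (B i s x)) y = coord (cadjoint (amplified_shift i s) (K x)) y"
    proof (cases "\<alpha> \<in> ?\<Gamma>")
      case True
      have "coord (K (B i s x)) y = coord (L (tuple_op \<alpha> [1..<Suc k] (B i s x))) j"
        using True by (simp add: coord_K c_def y)
      also have "\<dots> = cnj (shift_phase \<Lambda> i s \<alpha>) * coord (L (tuple_op (\<alpha>(i := s # \<alpha> i)) [1..<Suc k] x)) j"
        by (simp only: tuple_op_shift[OF that True] bounded_clinear_scaleC[OF L] scaleC_ell2.rep_eq)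
      also have "\<dots> = coord (cadjoint (amplified_shift i s) (K x)) y"
        using True free_tuples_cons[OF True that]
        by (simp only: coord_cadjoint_shift[OF that] coord_K c_def y if_True split_conv)
      finally show ?thesis .
    next
      case False
      then show ?thesis
        by (simp add: coord_cadjoint_shift[OF that] coord_K c_def y)
    qed
  qed
  ultimately show ?thesis
    by blast
qed

end

subsection \<open>Compressions of the standard shifts\<close>

text \<open>Through \<open>U\<close> the operators \<open>B i s\<close> become restrictions of the
  adjoint shifts to the range of \<open>U\<close>, so their forms can be computed in
  coordinates.\<close>

locale shift_compression = phase_system +
  fixes B :: "nat \<Rightarrow> nat \<Rightarrow> 'h::complex_inner \<Rightarrow> 'h" and U :: "'h \<Rightarrow> ((nat \<Rightarrow> nat list) \<times> nat) ell2"
  assumes norm_U: "\<And>x. norm (U x) = norm x"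
    and U_ell2_on: "\<And>x. U x \<in> ell2_on (free_tuples k n \<times> UNIV)"
    and U_B: "\<And>i s x. i \<in> {1..k} \<Longrightarrow> s \<in> {1..n i} \<Longrightarrow> U (B i s x) = cadjoint (amplified_shift i s) (U x)"
begin

definition weighted_form :: "((nat \<Rightarrow> nat list) \<Rightarrow> real) \<Rightarrow> ((nat \<Rightarrow> nat list) \<times> nat) ell2 \<Rightarrow> real"
  where "weighted_form w f = (\<Sum>\<^sub>\<infinity>x\<in>free_tuples k n \<times> UNIV. w (fst x) * (cmod (coord f x))\<^sup>2)"

lemma weighted_summable:
  assumes w: "\<And>\<alpha>. 0 \<le> w \<alpha> \<and> w \<alpha> \<le> (1 :: real)"
  shows "(\<lambda>x. w (fst x) * (cmod (coord f x))\<^sup>2) summable_on X"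
proof (rule summable_on_comparison_test)
  show "(\<lambda>x. (cmod (coord f x))\<^sup>2) summable_on X"
    by (rule summable_on_subset[OF coord_sq_summable]) simp
qed (use w in \<open>auto intro!: mult_left_le_one_le\<close>)

lemma weighted_form_nonneg: "(\<And>\<alpha>. 0 \<le> w \<alpha>) \<Longrightarrow> 0 \<le> weighted_form w f"
  unfolding weighted_form_def by (intro infsum_nonneg) simp

lemma weighted_form_cong:
  "(\<And>\<alpha>. \<alpha> \<in> free_tuples k n \<Longrightarrow> w \<alpha> = w' \<alpha>) \<Longrightarrow> weighted_form w f = weighted_form w' f"
  unfolding weighted_form_def by (intro infsum_cong) auto

lemma weighted_form_1: "weighted_form (\<lambda>_. 1) (U x) = (norm x)\<^sup>2"
  unfolding weighted_form_def norm_U[symmetric] norm_ell2_sq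
  by (rule infsum_cong_neutral) (use U_ell2_on[of x] in \<open>auto simp: ell2_on_def\<close>)

text \<open>Up to a phase the adjoint shift reads \<open>f\<close> at the tuple with
  \<open>s\<close> prepended in component \<open>i\<close>. For varying \<open>s\<close> these
  tuples partition those with nonempty component \<open>i\<close>, and \<open>tl\<close> recovers
  the original tuple. Weights between 0 and 1 keep all sums convergent.\<close>

lemma sum_weighted_form_shift:
  assumes i: "i \<in> {1..k}" and w: "\<And>\<alpha>. 0 \<le> w \<alpha> \<and> w \<alpha> \<le> 1"
  shows "(\<Sum>s=1..n i. weighted_form w (cadjoint (amplified_shift i s) f)) =
    weighted_form (\<lambda>\<alpha>. if \<alpha> i = [] then 0 else w (\<alpha>(i := tl (\<alpha> i)))) f"
proof -
  let ?A = "free_tuples k n \<times> (UNIV :: nat set)"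
  define g where "g = (\<lambda>x. w ((fst x)(i := tl (fst x i))) * (cmod (coord f x))\<^sup>2)"
  define h where "h s = (\<lambda>(\<alpha>, j :: nat). (\<alpha>(i := s # \<alpha> i), j))" for s :: nat
  have inj: "inj_on (h s) ?A" for s
    using inj_cons_at[of i s "free_tuples k n"] by (auto simp: inj_on_def h_def)
  have "weighted_form w (cadjoint (amplified_shift i s) f) = infsum g (h s ` ?A)" if s: "s \<in> {1..n i}" for s
  proof -
    have "w \<alpha> * (cmod (coord (cadjoint (amplified_shift i s) f) (\<alpha>, j)))\<^sup>2 = g (h s (\<alpha>, j))"
      if "\<alpha> \<in> free_tuples k n" for \<alpha> j
      using that cmod_shift_phase_free[OF i s that]
      by (simp add: coord_cadjoint_shift[OF i s] g_def h_def norm_mult)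
    then show ?thesis
      unfolding weighted_form_def infsum_reindex[OF inj] o_def by (intro infsum_cong) auto
  qed
  then have "(\<Sum>s=1..n i. weighted_form w (cadjoint (amplified_shift i s) f)) = (\<Sum>s=1..n i. infsum g (h s ` ?A))"
    by (intro sum.cong) auto
  also have "\<dots> = infsum g (\<Union>s\<in>{1..n i}. h s ` ?A)"
  proof (rule sum_infsum)
    show "g summable_on h s ` ?A" for s
      unfolding g_def by (rule weighted_summable[where w = "\<lambda>\<alpha>. w (\<alpha>(i := tl (\<alpha> i)))"]) (rule w)
    show "h s ` ?A \<inter> h t ` ?A = {}" if "s \<noteq> t" for s t
      using that by (auto simp: h_def dest: fun_cong[where x = i])
  qed simp
  also have "(\<Union>s\<in>{1..n i}. h s ` ?A) = {x \<in> ?A. fst x i \<noteq> []}"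
  proof (intro equalityI subsetI)
    fix x assume "x \<in> (\<Union>s\<in>{1..n i}. h s ` ?A)"
    then obtain s \<alpha> j where "s \<in> {1..n i}" "\<alpha> \<in> free_tuples k n" "x = h s (\<alpha>, j)"
      by blast
    then show "x \<in> {x \<in> ?A. fst x i \<noteq> []}"
      using free_tuples_cons[of \<alpha> k n i s] i by (simp add: h_def)
  next
    fix x assume "x \<in> {x \<in> ?A. fst x i \<noteq> []}"
    then obtain \<beta> j where x: "x = (\<beta>, j)" and \<beta>: "\<beta> \<in> free_tuples k n" "\<beta> i \<noteq> []"
      by (cases x) auto
    then obtain s v where sv: "\<beta> i = s # v"
      by (cases "\<beta> i") auto
    have "\<beta>(i := v) \<in> free_tuples k n" "s \<in> {1..n i}"
      using \<beta>(1) i free_tuples_set[OF \<beta>(1) i] unfolding sv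
      by (auto simp: free_tuples_def PiE_iff extensional_def lists_eq_set)
    moreover have "x = h s (\<beta>(i := v), j)"
      using sv by (auto simp: x h_def fun_eq_iff)
    ultimately show "x \<in> (\<Union>s\<in>{1..n i}. h s ` ?A)"
      by blast
  qed
  also have "infsum g {x \<in> ?A. fst x i \<noteq> []} = weighted_form (\<lambda>\<alpha>. if \<alpha> i = [] then 0 else w (\<alpha>(i := tl (\<alpha> i)))) f"
    unfolding weighted_form_def by (rule infsum_cong_neutral) (auto simp: g_def)
  finally show ?thesis .
qed

lemma form_map_weighted:
  assumes i: "i \<in> {1..k}" and w: "\<And>\<alpha>. 0 \<le> w \<alpha> \<and> w \<alpha> \<le> 1"
  shows "form_map r (n i) (B i) (\<lambda>x. weighted_form w (U x)) x =
    r\<^sup>2 * weighted_form (\<lambda>\<alpha>. if \<alpha> i = [] then 0 else w (\<alpha>(i := tl (\<alpha> i)))) (U x)"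
  using sum_weighted_form_shift[of i w "U x"] i w
  by (simp add: form_map_def U_B flip: sum_distrib_left)

text \<open>The diagonal of the defect formed over the components in \<open>js\<close>; at
  \<open>r = 1\<close> it is the indicator of the tuples in which all these components are
  empty.\<close>

definition weight :: "real \<Rightarrow> nat list \<Rightarrow> (nat \<Rightarrow> nat list) \<Rightarrow> real"
  where "weight r js \<alpha> = (\<Prod>i\<in>set js. if \<alpha> i = [] then 1 else 1 - r\<^sup>2)"

lemma weight_bounds:
  assumes "0 \<le> r" "r \<le> 1"
  shows "0 \<le> weight r js \<alpha> \<and> weight r js \<alpha> \<le> 1"
  unfolding weight_def using assms by (auto intro!: prod_nonneg prod_le_1 simp: power_le_one)

lemma defect_weighted_form:
  assumes r: "0 \<le> r" "r \<le> 1" and js: "distinct js" "set js \<subseteq> {1..k}"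
  shows "foldr (\<lambda>i p x. p x - form_map r (n i) (B i) p x) js (\<lambda>x. (norm x)\<^sup>2) =
    (\<lambda>x. weighted_form (weight r js) (U x))"
  using js
proof (induction js)
  case Nil
  show ?case
    by (simp add: weight_def weighted_form_1)
next
  case (Cons i js)
  then have i: "i \<in> {1..k}" "i \<notin> set js"
    by auto
  \<comment> \<open>The weight for \<open>js\<close> ignores component \<open>i\<close>, so deleting
    a letter there leaves it unchanged. Subtracting the image under \<open>form_map\<close> then
    multiplies it by 1 or \<open>1 - r\<^sup>2\<close>.\<close>
  have \<sigma>: "weight r js (\<alpha>(i := v)) = weight r js \<alpha>" for \<alpha> v
    using i(2) unfolding weight_def by (intro prod.cong) auto
  let ?w = "weight r js" and ?w' = "\<lambda>\<alpha>. if \<alpha> i = [] then 0 else weight r js \<alpha>"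
  have w': "0 \<le> ?w' \<alpha> \<and> ?w' \<alpha> \<le> 1" for \<alpha>
    using weight_bounds[OF r, of js \<alpha>] by simp
  have "weighted_form ?w f - r\<^sup>2 * weighted_form ?w' f = weighted_form (weight r (i # js)) f" for f
  proof -
    have "weighted_form (weight r (i # js)) f + r\<^sup>2 * weighted_form ?w' f =
        (\<Sum>\<^sub>\<infinity>x\<in>free_tuples k n \<times> UNIV.
          weight r (i # js) (fst x) * (cmod (coord f x))\<^sup>2 + r\<^sup>2 * (?w' (fst x) * (cmod (coord f x))\<^sup>2))"
      unfolding weighted_form_def infsum_cmult_right'[symmetric]
      by (intro infsum_add[symmetric] summable_on_cmult_right weighted_summable w' weight_bounds r)
    also have "\<dots> = weighted_form ?w f"
      unfolding weighted_form_def using i(2)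
      by (intro infsum_cong) (auto simp: weight_def algebra_simps)
    finally show ?thesis
      by simp
  qed
  moreover have "foldr (\<lambda>i p x. p x - form_map r (n i) (B i) p x) js (\<lambda>x. (norm x)\<^sup>2) =
      (\<lambda>x. weighted_form ?w (U x))"
    using Cons by simp
  ultimately show ?case
    by (simp only: foldr.simps o_apply form_map_weighted[OF i(1) weight_bounds[OF r]] \<sigma>)
qed

lemma defect_form_vacuum:
  "foldr (\<lambda>i p x. p x - form_map 1 (n i) (B i) p x) [1..<Suc k] (\<lambda>x. (norm x)\<^sup>2) x =
    (norm (amplify (vacuum_proj k) (U x)))\<^sup>2"
proof -
  have set: "set [1..<Suc k] = {1..k}"
    by auto
  \<comment> \<open>A nonempty component contributes the factor 0, so only the neutral tuple
    survives. Extensionality of \<open>free_tuples\<close> places any difference from it at an index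
    in \<open>{1..k}\<close>.\<close>
  have *: "weight 1 [1..<Suc k] \<alpha> = (if \<alpha> = neutral_tuple k then 1 else 0)" if \<alpha>: "\<alpha> \<in> free_tuples k n" for \<alpha>
  proof (cases "\<alpha> = neutral_tuple k")
    case True
    then show ?thesis
      unfolding weight_def set by (auto simp: neutral_tuple_def intro!: prod.neutral)
  next
    case False
    then obtain i where "\<alpha> i \<noteq> neutral_tuple k i"
      by blast
    then have "i \<in> {1..k}" "\<alpha> i \<noteq> []"
      using \<alpha> by (auto simp: neutral_tuple_def free_tuples_def PiE_iff extensional_def split: if_splits)
    then show ?thesis
      unfolding weight_def set using False by (auto intro!: prod_zero bexI[of _ i])
  qed
  have "foldr (\<lambda>i p x. p x - form_map 1 (n i) (B i) p x) [1..<Suc k] (\<lambda>x. (norm x)\<^sup>2) x =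
      weighted_form (weight 1 [1..<Suc k]) (U x)"
    by (subst defect_weighted_form) auto
  also have "\<dots> = weighted_form (\<lambda>\<alpha>. if \<alpha> = neutral_tuple k then 1 else 0) (U x)"
    by (rule weighted_form_cong) (rule *)
  also have "\<dots> = (norm (amplify (vacuum_proj k) (U x)))\<^sup>2"
    unfolding weighted_form_def norm_ell2_sq
    by (rule infsum_cong_neutral) (auto simp: coord_amplify_vacuum neutral_tuple_free split: if_splits)
  finally show ?thesis .
qed

lemma form_map_funpow_weighted:
  assumes i: "i \<in> {1..k}"
  shows "(form_map 1 (n i) (B i) ^^ Q) (\<lambda>x. (norm x)\<^sup>2) =
    (\<lambda>x. weighted_form (\<lambda>\<alpha>. if Q \<le> length (\<alpha> i) then 1 else 0) (U x))"
proof (induction Q)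
  case 0
  show ?case
    by (simp add: weighted_form_1)
next
  case (Suc Q)
  let ?w = "\<lambda>Q (\<alpha> :: nat \<Rightarrow> nat list). if Q \<le> length (\<alpha> i) then 1 else (0 :: real)"
  have "(form_map 1 (n i) (B i) ^^ Suc Q) (\<lambda>x. (norm x)\<^sup>2) =
      form_map 1 (n i) (B i) (\<lambda>x. weighted_form (?w Q) (U x))"
    by (simp only: funpow.simps o_apply Suc)
  also have "\<dots> = (\<lambda>x. weighted_form (?w (Suc Q)) (U x))"
  proof
    fix x
    have "(if \<alpha> i = [] then 0 else ?w Q (\<alpha>(i := tl (\<alpha> i)))) = ?w (Suc Q) \<alpha>" for \<alpha>
      by (cases "\<alpha> i") auto
    then show "form_map 1 (n i) (B i) (\<lambda>x. weighted_form (?w Q) (U x)) x = weighted_form (?w (Suc Q)) (U x)"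
      using form_map_weighted[OF i, of "?w Q" 1 x] by simp
  qed
  finally show ?case .
qed

lemma form_map_funpow_tendsto:
  assumes i: "i \<in> {1..k}"
  shows "(\<lambda>Q. (form_map 1 (n i) (B i) ^^ Q) (\<lambda>x. (norm x)\<^sup>2) x) \<longlonglongrightarrow> 0"
proof (rule metric_LIMSEQ_I)
  fix e :: real assume "0 < e"
  let ?A = "free_tuples k n \<times> (UNIV :: nat set)" and ?h = "\<lambda>y. (cmod (coord (U x) y))\<^sup>2"
  let ?w = "\<lambda>Q (\<alpha> :: nat \<Rightarrow> nat list). if Q \<le> length (\<alpha> i) then 1 else (0 :: real)"
  have summ: "?h summable_on X" for X
    by (rule summable_on_subset[OF coord_sq_summable]) simp
  obtain F where F: "finite F" "F \<subseteq> ?A" "dist (sum ?h F) (infsum ?h ?A) \<le> e / 2"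
    using infsum_finite_approximation[OF summ, of "e / 2" ?A] \<open>0 < e\<close> by auto
  \<comment> \<open>\<open>F\<close> carries all but \<open>e / 2\<close> of the squared norm. Once
    \<open>Q\<close> exceeds the length of component \<open>i\<close> throughout \<open>F\<close>,
    the weighted form sees only the complement of \<open>F\<close>.\<close>
  define N where "N = Suc (\<Sum>y\<in>F. length (fst y i))"
  have "\<bar>weighted_form (?w Q) (U x)\<bar> < e" if "Q \<ge> N" for Q
  proof -
    have "\<not> Q \<le> length (fst y i)" if "y \<in> F" for y
      using member_le_sum[OF that, of "\<lambda>y. length (fst y i)"] F(1) \<open>Q \<ge> N\<close> by (simp add: N_def)
    then have "weighted_form (?w Q) (U x) = (\<Sum>\<^sub>\<infinity>y\<in>?A - F. ?w Q (fst y) * ?h y)"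
      unfolding weighted_form_def by (intro infsum_cong_neutral) auto
    also have "\<dots> \<le> infsum ?h (?A - F)"
      by (intro infsum_mono weighted_summable summ) auto
    also have "\<dots> = infsum ?h ?A - sum ?h F"
      using F by (subst infsum_Diff[OF summ summ]) auto
    also have "\<dots> < e"
      using F(3) \<open>0 < e\<close> unfolding dist_real_def by linarith
    finally show ?thesis
      using weighted_form_nonneg[of "?w Q" "U x"] by simp
  qed
  then show "\<exists>N. \<forall>Q\<ge>N. dist ((form_map 1 (n i) (B i) ^^ Q) (\<lambda>x. (norm x)\<^sup>2) x) 0 < e"
    unfolding form_map_funpow_weighted[OF i] by (auto simp: dist_real_def)
qed

end

section \<open>The polyball conditions in terms of adjoints and quadratic forms\<close>

lemma row_contraction_iff:
  assumes A: "\<And>s. s \<in> {1..N} \<Longrightarrow> bounded_clinear (A s)"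
  shows "op_le (\<lambda>x. \<Sum>s=1..N. A s (cadjoint (A s) x)) id \<longleftrightarrow>
    (\<forall>x. form_map 1 N (\<lambda>s. cadjoint (A s)) (\<lambda>x. (norm x)\<^sup>2) x \<le> (norm x)\<^sup>2)"
proof -
  have eq: "(\<lambda>x. \<Sum>s=1..N. A s (cadjoint (A s) x)) = cp_map 1 N A id"
    by (simp add: cp_map_def)
  have "selfadjoint (\<lambda>x. id x - cp_map 1 N A id x)"
    by (intro selfadjoint_diff selfadjoint_id selfadjoint_cp_map A)
  moreover have "inner (cp_map 1 N A id x) x = form_map 1 N (\<lambda>s. cadjoint (A s)) (\<lambda>x. (norm x)\<^sup>2) x" for x
    using cp_map_form[where A = A and X = id and r = 1, OF A] by (simp add: power2_norm_eq_inner)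
  ultimately show ?thesis
    unfolding eq op_le_def by (simp add: positive_op_selfadjoint inner_diff_left power2_norm_eq_inner)
qed

text \<open>Row contractivity places the powers between 0 and I, so
  \<open>positive_norm_sq_le\<close> bounds the squared norm of each image of \<open>x\<close> by
  the form at \<open>x\<close>. Weak convergence to 0 is thus strong.\<close>

lemma pure_iff:
  assumes A: "\<And>s. s \<in> {1..N} \<Longrightarrow> bounded_clinear (A s)"
    and contr: "\<And>x. form_map 1 N (\<lambda>s. cadjoint (A s)) (\<lambda>x. (norm x)\<^sup>2) x \<le> (norm x)\<^sup>2"
  shows "(\<forall>x. (\<lambda>q. (cp_map 1 N A ^^ q) id x) \<longlonglongrightarrow> 0) \<longleftrightarrow>
    (\<forall>x. (\<lambda>q. (form_map 1 N (\<lambda>s. cadjoint (A s)) ^^ q) (\<lambda>x. (norm x)\<^sup>2) x) \<longlonglongrightarrow> 0)"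
proof (intro iff_allI iffI)
  fix x
  let ?X = "\<lambda>q. (cp_map 1 N A ^^ q) id"
  have form: "(form_map 1 N (\<lambda>s. cadjoint (A s)) ^^ q) (\<lambda>x. (norm x)\<^sup>2) x = inner (?X q x) x" for q x
    by (rule cp_map_funpow_form[symmetric]) (rule A)
  show "(\<lambda>q. (form_map 1 N (\<lambda>s. cadjoint (A s)) ^^ q) (\<lambda>x. (norm x)\<^sup>2) x) \<longlonglongrightarrow> 0"
    if "(\<lambda>q. ?X q x) \<longlonglongrightarrow> 0"
    unfolding form using tendsto_inner[OF that tendsto_const, of x] by simp
  show "(\<lambda>q. ?X q x) \<longlonglongrightarrow> 0"
    if lim: "(\<lambda>q. (form_map 1 N (\<lambda>s. cadjoint (A s)) ^^ q) (\<lambda>x. (norm x)\<^sup>2) x) \<longlonglongrightarrow> 0"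
  proof -
    have pos: "0 \<le> inner (?X q y) y" for q y
      unfolding form[symmetric] form_map_funpow_words by (intro sum_nonneg) simp
    have le: "inner (?X q y) y \<le> 1 * (norm y)\<^sup>2" for q y
    proof (induction q)
      case (Suc q)
      have "(form_map 1 N (\<lambda>s. cadjoint (A s)) ^^ Suc q) (\<lambda>x. (norm x)\<^sup>2) y \<le>
          (form_map 1 N (\<lambda>s. cadjoint (A s)) ^^ q) (\<lambda>x. (norm x)\<^sup>2) y"
        unfolding funpow_Suc_right o_def by (rule form_map_funpow_mono) (rule contr)
      with Suc show ?case
        unfolding form by linarith
    qed (simp add: power2_norm_eq_inner)
    have "(norm (?X q x))\<^sup>2 \<le> inner (?X q x) x" for q
      using positive_norm_sq_le[OF selfadjoint_cp_map_funpow[OF A, where r = 1] pos le, of q x] by simp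
    then have "(\<lambda>q. (norm (?X q x))\<^sup>2) \<longlonglongrightarrow> 0"
      by (intro tendsto_sandwich[OF always_eventually always_eventually tendsto_const lim[unfolded form]]) auto
    from tendsto_real_sqrt[OF this] have "(\<lambda>q. norm (?X q x)) \<longlonglongrightarrow> 0"
      by simp
    then show ?thesis
      by (rule tendsto_norm_zero_cancel)
  qed
qed

lemma commute_adjoint_iff:
  assumes A: "bounded_clinear A" and C: "bounded_clinear C"
  shows "(\<forall>x. A (C x) = c *\<^sub>C C (A x)) \<longleftrightarrow>
    (\<forall>x. cadjoint C (cadjoint A x) = cnj c *\<^sub>C cadjoint A (cadjoint C x))"
proof -
  have "cinner (A (C x)) y = cinner x (cadjoint C (cadjoint A y))"
    "cinner (c *\<^sub>C C (A x)) y = cinner x (cnj c *\<^sub>C cadjoint A (cadjoint C y))" for x y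
    by (simp_all add: cinner_cadjoint_right A C cinner_scaleC_left cinner_scaleC_right)
  moreover have "(\<forall>x. A (C x) = c *\<^sub>C C (A x)) \<longleftrightarrow> (\<forall>x y. cinner (A (C x)) y = cinner (c *\<^sub>C C (A x)) y)"
    by (metis cinner_extI)
  moreover have "(\<forall>y. cadjoint C (cadjoint A y) = cnj c *\<^sub>C cadjoint A (cadjoint C y)) \<longleftrightarrow>
      (\<forall>y x. cinner x (cadjoint C (cadjoint A y)) = cinner x (cnj c *\<^sub>C cadjoint A (cadjoint C y)))"
    by (metis cinner_commute cinner_extI)
  ultimately show ?thesis
    by auto
qed

text \<open>The polyball gives positivity only for \<open>r < 1\<close>; continuity in
  \<open>r\<close> carries it to the defect at \<open>r = 1\<close>.\<close>

lemma tendsto_defect_form: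
  "((\<lambda>r. foldr (\<lambda>i p x. p x - form_map r (n i) (B i) p x) js p x) \<longlongrightarrow>
    foldr (\<lambda>i p x. p x - form_map a (n i) (B i) p x) js p x) (at a within S)"
  by (induction js arbitrary: x) (auto simp: form_map_def intro!: tendsto_diff tendsto_sum tendsto_mult tendsto_power tendsto_ident_at)

text \<open>The shape in which \<open>lambda_tuple\<close> consumes and
  \<open>shift_compression\<close> produces the polyball conditions.\<close>

lemma regular_polyball_iff:
  assumes T: "\<forall>i\<in>{1..k}. \<forall>s\<in>{1..n i}. bounded_clinear (T i s)"
  shows "T \<in> regular_polyball k n \<Lambda> \<longleftrightarrow>
    (\<forall>i\<in>{1..k}. \<forall>x. form_map 1 (n i) (\<lambda>s. cadjoint (T i s)) (\<lambda>x. (norm x)\<^sup>2) x \<le> (norm x)\<^sup>2) \<and>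
    (\<forall>i\<in>{1..k}. \<forall>j\<in>{1..k}. i \<noteq> j \<longrightarrow> (\<forall>s\<in>{1..n i}. \<forall>t\<in>{1..n j}. \<forall>x.
      cadjoint (T j t) (cadjoint (T i s) x) = cnj (\<Lambda> i j s t) *\<^sub>C cadjoint (T i s) (cadjoint (T j t) x))) \<and>
    (\<forall>r\<in>{0..<1}. \<forall>x. 0 \<le> inner (defect r k n T x) x)"
proof -
  have T': "bounded_clinear (T i s)" if "i \<in> {1..k}" "s \<in> {1..n i}" for i s
    using T that by blast
  have pos: "positive_op (defect r k n T) \<longleftrightarrow> (\<forall>x. 0 \<le> inner (defect r k n T x) x)" for r
    by (intro positive_op_selfadjoint selfadjoint_defect T')
  have contr: "op_le (\<lambda>x. \<Sum>s=1..n i. T i s (cadjoint (T i s) x)) id \<longleftrightarrow>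
      (\<forall>x. form_map 1 (n i) (\<lambda>s. cadjoint (T i s)) (\<lambda>x. (norm x)\<^sup>2) x \<le> (norm x)\<^sup>2)" if "i \<in> {1..k}" for i
    by (rule row_contraction_iff[OF T'[OF that]])
  have comm: "(\<forall>x. T i s (T j t x) = \<Lambda> i j s t *\<^sub>C T j t (T i s x)) \<longleftrightarrow>
      (\<forall>x. cadjoint (T j t) (cadjoint (T i s) x) = cnj (\<Lambda> i j s t) *\<^sub>C cadjoint (T i s) (cadjoint (T j t) x))"
    if "i \<in> {1..k}" "j \<in> {1..k}" "s \<in> {1..n i}" "t \<in> {1..n j}" for i j s t
    by (rule commute_adjoint_iff[OF T'[OF that(1,3)] T'[OF that(2,4)]])
  show ?thesis
    unfolding regular_polyball_def mem_Collect_eq pos eqTrueI[OF T] simp_thms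
    by (intro conj_cong ball_cong imp_cong refl contr comm)
qed

lemma clinear_amplify_vacuum:
  fixes U :: "'h::complex_inner \<Rightarrow> ((nat \<Rightarrow> nat list) \<times> 'b) ell2"
  assumes U: "clinear U"
  shows "clinear (\<lambda>x. amplify (vacuum_proj k) (U x))"
proof -
  interpret U: Vector_Spaces.linear scaleC scaleC U
    by (rule U)
  have vac: "bounded_clinear (amplify (vacuum_proj k) :: ((nat \<Rightarrow> nat list) \<times> 'b) ell2 \<Rightarrow> _)"
    by (rule bounded_clinear_amplify[OF bounded_clinear_vacuum_proj])
  show ?thesis
    by (rule clinearI) (simp_all add: U.add U.scale bounded_clinear_scaleC[OF vac]
        linear_add[OF bounded_linear.linear[OF bounded_clinear_bounded_linear[OF vac]]])
qed

section \<open>The two implications for isometries that intertwine the adjoints\<close>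

context phase_system
begin

text \<open>Formulated through adjoints: the range of an isometry that intertwines the adjoint
  tuples is co-invariant, and compressing the shifts to it recovers \<open>T\<close>.\<close>

lemma polyball_dilation:
  fixes T :: "nat \<Rightarrow> nat \<Rightarrow> 'h::chilbert_space \<Rightarrow> 'h"
  assumes T: "\<And>i s. i \<in> {1..k} \<Longrightarrow> s \<in> {1..n i} \<Longrightarrow> bounded_clinear (T i s)"
    and ball: "T \<in> regular_polyball k n \<Lambda>" and pure: "pure_tuple k n T" and rank: "has_rank (defect 1 k n T) m"
  shows "\<exists>K. clinear K \<and> (\<forall>x. norm (K x) = norm x) \<and>
    range K \<subseteq> ell2_on (free_tuples k n \<times> {j. enat j < m}) \<and>
    has_hilbert_dim (range (\<lambda>x. amplify (vacuum_proj k) (K x))) m \<and>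
    (\<forall>i\<in>{1..k}. \<forall>s\<in>{1..n i}. \<forall>x. K (cadjoint (T i s) x) = cadjoint (amplified_shift i s) (K x))"
proof -
  define B where "B i s = cadjoint (T i s)" for i s
  have T': "\<forall>i\<in>{1..k}. \<forall>s\<in>{1..n i}. bounded_clinear (T i s)"
    using T by blast
  note polyball = ball[unfolded regular_polyball_iff[OF T'], folded B_def]
  interpret lambda_tuple k n \<Lambda> B
  proof
    show "bounded_clinear (B i s)" if "i \<in> {1..k}" "s \<in> {1..n i}" for i s
      unfolding B_def by (rule bounded_clinear_cadjoint[OF T[OF that]])
    show "B j t (B i s x) = cnj (\<Lambda> i j s t) *\<^sub>C B i s (B j t x)"
      if "i \<in> {1..k}" "j \<in> {1..k}" "i \<noteq> j" "s \<in> {1..n i}" "t \<in> {1..n j}" for i j s t x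
      using polyball that by blast
  qed
  have contr: "form_map 1 (n i) (B i) (\<lambda>x. (norm x)\<^sup>2) x \<le> (norm x)\<^sup>2" if "i \<in> {1..k}" for i x
    using polyball that unfolding B_def by blast
  have pure': "(\<lambda>Q. (form_map 1 (n i) (B i) ^^ Q) (\<lambda>x. (norm x)\<^sup>2) x) \<longlonglongrightarrow> 0" if "i \<in> {1..k}" for i x
  proof -
    have "\<forall>x. (\<lambda>q. (cp_map 1 (n i) (T i) ^^ q) id x) \<longlonglongrightarrow> 0"
      using pure that by (auto simp: pure_tuple_def)
    then show ?thesis
      using pure_iff[OF T[OF that] contr[OF that, unfolded B_def]] unfolding B_def by blast
  qed
  define p where "p r = foldr (\<lambda>i p x. p x - form_map r (n i) (B i) p x) [1..<Suc k] (\<lambda>x. (norm x)\<^sup>2)" for r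
  have defect: "inner (defect r k n T x) x = p r x" for r x
    unfolding p_def B_def by (rule defect_form) (rule T)
  have p_pos: "0 \<le> p 1 x" for x
  proof (rule tendsto_lowerbound)
    show "((\<lambda>r. p r x) \<longlongrightarrow> p 1 x) (at_left 1)"
      unfolding p_def by (rule tendsto_defect_form)
    have "0 \<le> p r x" if "r \<in> {0<..<1}" for r
      using polyball that by (auto simp: defect)
    then show "\<forall>\<^sub>F r in at_left 1. 0 \<le> p r x"
      using eventually_at_leftI[of 0 1 "\<lambda>r. 0 \<le> p r x"] by simp
  qed simp
  have sa: "selfadjoint (defect 1 k n T)"
    by (rule selfadjoint_defect) (rule T)
  obtain L :: "'h \<Rightarrow> nat ell2" where L: "bounded_clinear L" "range L \<subseteq> ell2_on {j. enat j < m}"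
    "\<And>x. (norm (L x))\<^sup>2 = p 1 x"
    using factorization_through_ell2[OF sa _ rank] p_pos unfolding defect by blast
  have sum: "((\<lambda>\<alpha>. (norm (L (tuple_op \<alpha> [1..<Suc k] x)))\<^sup>2) has_sum (norm x)\<^sup>2) (free_tuples k n)" for x
    unfolding L(3) by (rule has_sum_tuple_op[OF contr pure' p_def p_pos])
  obtain K where K: "clinear K" "\<And>x. norm (K x) = norm x"
    "range K \<subseteq> ell2_on (free_tuples k n \<times> {j. enat j < m})"
    "\<And>x. norm (amplify (vacuum_proj k) (K x)) = norm (L x)"
    "\<forall>i\<in>{1..k}. \<forall>s\<in>{1..n i}. \<forall>x. K (B i s x) = cadjoint (amplified_shift i s) (K x)"
    using berezin_kernel[OF L(1,2) sum] by blast
  \<comment> \<open>The vacuum part of \<open>K\<close> has the form of the defect operator, so its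
    dimension is the rank.\<close>
  have "inner (defect 1 k n T x) x = (norm (amplify (vacuum_proj k) (K x)))\<^sup>2" for x
    by (simp only: defect K(4) L(3))
  then have "has_hilbert_dim (range (\<lambda>x. amplify (vacuum_proj k) (K x))) m"
    using has_rank_iff_isometric[OF sa clinear_amplify_vacuum[OF K(1)]] rank by blast
  then show ?thesis
    using K unfolding B_def by blast
qed

lemma polyball_of_compression:
  fixes T :: "nat \<Rightarrow> nat \<Rightarrow> 'h::chilbert_space \<Rightarrow> 'h"
  assumes T: "\<And>i s. i \<in> {1..k} \<Longrightarrow> s \<in> {1..n i} \<Longrightarrow> bounded_clinear (T i s)"
    and U: "clinear U" "\<And>x. norm (U x) = norm x" "range U \<subseteq> ell2_on (free_tuples k n \<times> UNIV)"
    and inter: "\<And>i s x. i \<in> {1..k} \<Longrightarrow> s \<in> {1..n i} \<Longrightarrow>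
      U (cadjoint (T i s) x) = cadjoint (amplified_shift i s) (U x)"
    and dim: "has_hilbert_dim (range (\<lambda>x. amplify (vacuum_proj k) (U x))) m"
  shows "T \<in> regular_polyball k n \<Lambda> \<and> pure_tuple k n T \<and> has_rank (defect 1 k n T) m"
proof -
  define B where "B i s = cadjoint (T i s)" for i s
  interpret shift_compression k n \<Lambda> B U
    using U inter by unfold_locales (auto simp: B_def)
  interpret U: Vector_Spaces.linear scaleC scaleC U
    by (rule U(1))
  have contr: "form_map 1 (n i) (B i) (\<lambda>x. (norm x)\<^sup>2) x \<le> (norm x)\<^sup>2" if "i \<in> {1..k}" for i x
  proof -
    \<comment> \<open>The defect over the single component \<open>i\<close> at \<open>r = 1\<close>
      is the identity minus the row sum, so its nonnegative weight gives row contractivity.\<close>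
    have "(norm x)\<^sup>2 - form_map 1 (n i) (B i) (\<lambda>x. (norm x)\<^sup>2) x = weighted_form (weight 1 [i]) (U x)"
      using fun_cong[OF defect_weighted_form[of 1 "[i]"], of x] that by simp
    then show ?thesis
      using weighted_form_nonneg[of "weight 1 [i]" "U x"] weight_bounds[of 1 "[i]"] by simp
  qed
  have comm: "B j t (B i s x) = cnj (\<Lambda> i j s t) *\<^sub>C B i s (B j t x)"
    if "i \<in> {1..k}" "j \<in> {1..k}" "i \<noteq> j" "s \<in> {1..n i}" "t \<in> {1..n j}" for i j s t x
  proof -
    \<comment> \<open>The relation holds for the adjoint shifts and is pulled back along the
      injective \<open>U\<close>.\<close>
    have "U (B j t (B i s x)) = U (cnj (\<Lambda> i j s t) *\<^sub>C B i s (B j t x))"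
      using cadjoint_shift_commute[OF that(1,4) that(2,5) that(3), of "U x"]
      by (simp only: U.scale U_B that)
    then have "norm (U (B j t (B i s x) - cnj (\<Lambda> i j s t) *\<^sub>C B i s (B j t x))) = 0"
      by (simp add: U.diff)
    then show ?thesis
      by (simp add: norm_U)
  qed
  have defect: "inner (defect r k n T x) x =
      foldr (\<lambda>i p x. p x - form_map r (n i) (B i) p x) [1..<Suc k] (\<lambda>x. (norm x)\<^sup>2) x" for r x
    unfolding B_def by (rule defect_form) (rule T)
  have set: "set [1..<Suc k] \<subseteq> {1..k}"
    by auto
  have pos: "0 \<le> inner (defect r k n T x) x" if "r \<in> {0..<1}" for r x
  proof -
    have r: "0 \<le> r" "r \<le> 1"
      using that by auto
    show ?thesis
      unfolding defect defect_weighted_form[OF r distinct_upt set]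
      using weight_bounds[OF r] by (intro weighted_form_nonneg) blast
  qed
  have "\<forall>i\<in>{1..k}. \<forall>s\<in>{1..n i}. bounded_clinear (T i s)"
    using T by blast
  from regular_polyball_iff[OF this, of \<Lambda>, folded B_def] have "T \<in> regular_polyball k n \<Lambda>"
    using contr comm pos by blast
  moreover have "pure_tuple k n T"
    unfolding pure_tuple_def
  proof
    fix i assume i: "i \<in> {1..k}"
    show "\<forall>x. (\<lambda>q. (cp_map 1 (n i) (T i) ^^ q) id x) \<longlonglongrightarrow> 0"
      using pure_iff[OF T[OF i] contr[OF i, unfolded B_def]] form_map_funpow_tendsto[OF i, unfolded B_def] by blast
  qed
  moreover have "has_rank (defect 1 k n T) m"
  proof -
    have "selfadjoint (defect 1 k n T)"
      by (rule selfadjoint_defect) (rule T)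
    moreover have "inner (defect 1 k n T x) x = (norm (amplify (vacuum_proj k) (U x)))\<^sup>2" for x
      by (simp only: defect defect_form_vacuum)
    ultimately show ?thesis
      using has_rank_iff_isometric[OF _ clinear_amplify_vacuum[OF U(1)]] dim by blast
  qed
  ultimately show ?thesis
    by blast
qed

end

section \<open>Ranges of isometries and the equivalence\<close>

lemma range_isometry:
  fixes U :: "'a::chilbert_space \<Rightarrow> 'b::chilbert_space"
  assumes U: "clinear U" "\<And>x. norm (U x) = norm x"
  shows "csubspace (range U)" "closed (range U)"
proof -
  interpret U: Vector_Spaces.linear scaleC scaleC U
    by (rule U(1))
  show "csubspace (range U)"
    by (rule csubspace_range[OF U(1)])
  have lin: "bounded_clinear U"
    unfolding bounded_clinear_def using U by (auto intro!: exI[of _ 1])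
  have "complete (range U)"
    by (rule complete_isometric_image[of 1 UNIV U])
      (use bounded_clinear_bounded_linear[OF lin] U in \<open>auto simp: complete_UNIV\<close>)
  then show "closed (range U)"
    by (rule complete_imp_closed)
qed

theorem theorem5p7:
  fixes k :: nat and n :: "nat \<Rightarrow> nat"
    and \<Lambda> :: "nat \<Rightarrow> nat \<Rightarrow> nat \<Rightarrow> nat \<Rightarrow> complex"
    and T :: "nat \<Rightarrow> nat \<Rightarrow> 'h::chilbert_space \<Rightarrow> 'h"
    and m :: enat
  assumes "k \<ge> 1"
    and "\<And>i. i \<in> {1..k} \<Longrightarrow> n i \<ge> 1"
    and "\<And>i j s t. \<lbrakk>i \<in> {1..k}; j \<in> {1..k}; i \<noteq> j; s \<in> {1..n i}; t \<in> {1..n j}\<rbrakk>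
      \<Longrightarrow> cmod (\<Lambda> i j s t) = 1"
    and "\<And>i j s t. \<lbrakk>i \<in> {1..k}; j \<in> {1..k}; i \<noteq> j; s \<in> {1..n i}; t \<in> {1..n j}\<rbrakk>
      \<Longrightarrow> \<Lambda> j i t s = cnj (\<Lambda> i j s t)"
    and "\<And>i s. \<lbrakk>i \<in> {1..k}; s \<in> {1..n i}\<rbrakk> \<Longrightarrow> bounded_clinear (T i s)"
    and "m \<ge> 1"
  shows "T \<in> regular_polyball k n \<Lambda> \<and> pure_tuple k n T \<and> has_rank (defect 1 k n T) m \<longleftrightarrow>
    (\<exists>M :: ((nat \<Rightarrow> nat list) \<times> nat) ell2 set.
      M \<subseteq> ell2_on (free_tuples k n \<times> {j. enat j < m}) \<and> csubspace M \<and> closed M \<and>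
      jointly_coinvariant k n (\<lambda>i s. amplify (std_shift k n \<Lambda> i s)) M \<and>
      has_hilbert_dim (amplify (vacuum_proj k) ` M) m \<and>
      unitarily_equiv_compression k n T (\<lambda>i s. amplify (std_shift k n \<Lambda> i s)) M)"
    (is "?polyball \<longleftrightarrow> _")
proof -
  interpret phase_system k n \<Lambda>
    using assms(3,4) by unfold_locales
  note T = assms(5)
  have V: "(\<lambda>i s. amplify (std_shift k n \<Lambda> i s)) = amplified_shift"
    by (simp add: amplified_shift_def fun_eq_iff)
  show ?thesis
    unfolding V
  proof
    assume ?polyball
    then obtain K where K: "clinear K" "\<And>x. norm (K x) = norm x"
      "range K \<subseteq> ell2_on (free_tuples k n \<times> {j. enat j < m})"
      "has_hilbert_dim (range (\<lambda>x. amplify (vacuum_proj k) (K x))) m"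
      "\<And>i s x. i \<in> {1..k} \<Longrightarrow> s \<in> {1..n i} \<Longrightarrow> K (cadjoint (T i s) x) = cadjoint (amplified_shift i s) (K x)"
      using polyball_dilation[of T m] T by blast
    have cinner_K: "cinner (K x) (K y) = cinner x y" for x y
      using isometric_cinner[of K "\<lambda>x. x"] K(1,2) complex_vector.linear_ident by blast
    \<comment> \<open>Paired with \<open>K y\<close>, the shift moves over as its adjoint, which
      \<open>K\<close> intertwines with the adjoint of \<open>T i s\<close>. So
      \<open>K (T i s x)\<close> has the property that characterizes the projection.\<close>
    have "K (T i s x) = orth_proj (range K) (amplified_shift i s (K x))"
      if "i \<in> {1..k}" "s \<in> {1..n i}" for i s x
    proof (rule orth_proj_unique[symmetric])
      fix z assume "z \<in> range K"
      then obtain y where z: "z = K y"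
        by blast
      have "cinner (amplified_shift i s (K x)) z = cinner (K x) (K (cadjoint (T i s) y))"
        by (simp add: z K(5)[OF that] cinner_cadjoint_right bounded_clinear_amplified_shift[OF that])
      also have "\<dots> = cinner (K (T i s x)) z"
        by (simp add: z cinner_K cinner_cadjoint_right T[OF that])
      finally show "cinner (amplified_shift i s (K x) - K (T i s x)) z = 0"
        by (simp add: cinner_diff_left)
    qed (use range_isometry(1)[OF K(1,2)] in auto)
    then have "unitarily_equiv_compression k n T amplified_shift (range K)"
      unfolding unitarily_equiv_compression_def using K(1) cinner_K by blast
    moreover have "jointly_coinvariant k n amplified_shift (range K)"
      unfolding jointly_coinvariant_def using K(5) by (auto simp flip: K(5))
    moreover have "has_hilbert_dim (amplify (vacuum_proj k) ` range K) m"
      using K(4) by (simp add: image_image)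
    ultimately show "\<exists>M. M \<subseteq> ell2_on (free_tuples k n \<times> {j. enat j < m}) \<and> csubspace M \<and> closed M \<and>
        jointly_coinvariant k n amplified_shift M \<and> has_hilbert_dim (amplify (vacuum_proj k) ` M) m \<and>
        unitarily_equiv_compression k n T amplified_shift M"
      using K(3) range_isometry[OF K(1,2)] by blast
  next
    assume "\<exists>M. M \<subseteq> ell2_on (free_tuples k n \<times> {j. enat j < m}) \<and> csubspace M \<and> closed M \<and>
        jointly_coinvariant k n amplified_shift M \<and> has_hilbert_dim (amplify (vacuum_proj k) ` M) m \<and>
        unitarily_equiv_compression k n T amplified_shift M"
    then obtain M where M: "M \<subseteq> ell2_on (free_tuples k n \<times> {j. enat j < m})" "csubspace M" "closed M"
      and coinv: "jointly_coinvariant k n amplified_shift M"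
      and dim: "has_hilbert_dim (amplify (vacuum_proj k) ` M) m"
      and equiv: "unitarily_equiv_compression k n T amplified_shift M"
      by blast
    obtain U where U: "clinear U" "\<And>x y. cinner (U x) (U y) = cinner x y" "range U = M"
      and UT: "\<And>i s x. i \<in> {1..k} \<Longrightarrow> s \<in> {1..n i} \<Longrightarrow> U (T i s x) = orth_proj M (amplified_shift i s (U x))"
      using equiv unfolding unitarily_equiv_compression_def by blast
    have norm_U: "norm (U x) = norm x" for x
      using U(2)[of x x] by (simp only: cinner_self of_real_eq_iff power2_eq_iff_nonneg norm_ge_zero)
    have "U (cadjoint (T i s) x) = cadjoint (amplified_shift i s) (U x)"
      if mem: "i \<in> {1..k}" "s \<in> {1..n i}" for i s x
    proof -
      have "cadjoint (amplified_shift i s) ` M \<subseteq> M"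
        using coinv mem unfolding jointly_coinvariant_def by blast
      then have "cadjoint (amplified_shift i s) (U x) \<in> M"
        using U(3) by blast
      \<comment> \<open>Co-invariance keeps the adjoint shift inside the range of \<open>U\<close>;
        the preimage \<open>z\<close> is then identified by pairing with every \<open>y\<close> and
        using the compression formula.\<close>
      then obtain z where z: "cadjoint (amplified_shift i s) (U x) = U z"
        using U(3) by blast
      have "cinner z y = cinner (cadjoint (T i s) x) y" for y
      proof -
        have "cinner (U y) (U z) = cinner (amplified_shift i s (U y)) (U x)"
          by (simp only: z[symmetric] cinner_cadjoint_right[OF bounded_clinear_amplified_shift[OF mem]])
        also have "\<dots> = cinner (U (T i s y)) (U x)"
          unfolding UT[OF mem] using U(3) by (intro cinner_orth_proj[symmetric] M) blast
        also have "\<dots> = cinner (U y) (U (cadjoint (T i s) x))"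
          by (simp only: U(2) cinner_cadjoint_right[OF T[OF mem]])
        finally show ?thesis
          unfolding U(2) by (metis cinner_commute)
      qed
      then have "z = cadjoint (T i s) x"
        by (rule cinner_extI)
      then show ?thesis
        using z by simp
    qed
    moreover have "range U \<subseteq> ell2_on (free_tuples k n \<times> UNIV)"
      using M(1) U(3) by (auto simp: ell2_on_def)
    moreover have "has_hilbert_dim (range (\<lambda>x. amplify (vacuum_proj k) (U x))) m"
      using dim unfolding U(3)[symmetric] image_image .
    ultimately show ?polyball
      by (intro polyball_of_compression[where U = U] T U(1) norm_U)
  qed
qed

end
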